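(* Let $T\in\mathbb{N}$, $p\in(1,\infty)$, $q=p/(p-1)$, $P\in\mathcal{P}_p(\mathbb{R}^T)$, and fix a constant $L\ge 0$. Let $f\colon\mathbb{R}^T\times\mathbb{R}^T\to\mathbb{R}$, $(x,a)\mapsto f(x,a)$, be convex in its second argument $a$, and assume: (1) for every $x\in\mathbb{R}^T$, $f(x,\cdot)$ is twice continuously differentiable and strongly convex in the sense that $\nabla_a^2 f(x,a)-\varepsilon(x) I$ is positive semidefinite for all $a\in[-L,L]^T$, where $I$ is the $T\times T$ identity matrix and $\varepsilon\colon\mathbb{R}^T\to\mathbb{R}$ is Borel with $P(\varepsilon(X)>0)=1$; (2) $f(\cdot,a)$ is differentiable for every $a\in\mathbb{R}^T$, the partial derivatives $\partial_{x_t}f$ are jointly continuous in $(x,a)$, and there is a constant $c>0$ such that $$\sum_{s=1}^T |\partial_{x_s} f(x,a)|\le c\Big(1+\sum_{s=1}^T|x_s|^{p-1}\Big)\qquad\text{for every } x\in\mathbb{R}^T \text{ and } a\in[-L,L]^T.$$ Then there exists exactly one (up to $P$-almost sure equality) $a^\ast\in\mathcal{A}$ such that $v(P)=E_P[f(X,a^\ast(X))]$. Furthermore, as $r\downarrow 0$, $$\sup_{Q\in B_r(P)} v(Q) = v(P) + r\cdot\Big(\sum_{t=1}^T E_P\big[|E_P[\partial_{x_t}f(X,a^\ast(X))\,|\,\mathcal{F}_t^X]|^q\big]\Big)^{1/q}+o(r).$$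
   Context: $\mathcal{P}_p(\mathbb{R}^T)$ is the set of Borel probability measures on $\mathbb{R}^T$ with finite $p$-th moment. $X=(X_t)_{t=1}^T$ is the canonical process (identity map) on $\mathbb{R}^T$, and $\mathcal{F}^X_t=\sigma(X_s: s\le t)$, with $\mathcal{F}^X_0$ trivial. $\partial_{x_t}f$ is the partial derivative in the $t$-th coordinate of $x$, and $\nabla_a^2f$ is the Hessian in $a$. $\mathcal{A}$ is the set of predictable controls bounded by $L$: all $a=(a_t)_{t=1}^T$ with $a_t\colon\mathbb{R}^T\to\mathbb{R}$ Borel, $a_t(x)$ depending only on $x_1,\dots,x_{t-1}$ ($a_1$ is deterministic), and $|a_t|\le L$. For $Q\in\mathcal{P}_p(\mathbb{R}^T)$, $v(Q)=\inf_{a\in\mathcal{A}}E_Q[f(X,a(X))]$. On $\mathbb{R}^T\times\mathbb{R}^T$, let $X,Y$ denote the projections to the first and second coordinate. A coupling $\pi$ between $P,Q\in\mathcal{P}_p(\mathbb{R}^T)$ is a Borel probability measure on $\mathbb{R}^T\times\mathbb{R}^T$ with first marginal $P$ and second marginal $Q$. It is causal if, $\pi$-almost surely, $\pi((Y_1,\dots,Y_t)\in A\,|\,X_1,\dots,X_T)=\pi((Y_1,\dots,Y_t)\in A\,|\,X_1,\dots,X_t)$ for all Borel $A\subseteq\mathbb{R}^t$ and all $1\le t\le T$. It is bicausal if it is causal and the same condition holds with the roles of $X$ and $Y$ reversed. The adapted Wasserstein distance is $\mathcal{AW}_p(P,Q)=\inf_\pi\big(\sum_{t=1}^T E_\pi[|X_t-Y_t|^p]\big)^{1/p}$,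 where the infimum is over all bicausal couplings $\pi$ between $P$ and $Q$. For $r\ge 0$, $B_r(P)=\{Q\in\mathcal{P}_p(\mathbb{R}^T):\mathcal{AW}_p(P,Q)\le r\}$. *)

theory Defs
  imports "HOL-Probability.Probability" "HOL-Library.Landau_Symbols"
begin

text \<open>The time set \<open>{1, \<dots>, T}\<close> is an arbitrary finite linearly ordered type \<open>'n\<close>, so that
  \<open>T = CARD('n)\<close> and \<open>\<real>\<^sup>T\<close> is \<^typ>\<open>real ^ 'n\<close>. The order of \<open>'n\<close> is the order of time.\<close>


subsection \<open>Derivatives\<close>

definition partial_deriv :: "(real ^ 'n \<Rightarrow> real) \<Rightarrow> 'n::finite \<Rightarrow> real ^ 'n \<Rightarrow> real" where
  "partial_deriv g t x = deriv (\<lambda>u. g (\<chi> s. if s = t then u else x $ s)) (x $ t)"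

definition gradient :: "(real ^ 'n \<Rightarrow> real) \<Rightarrow> real ^ 'n \<Rightarrow> real ^ 'n::finite" where
  "gradient g x = (\<chi> t. partial_deriv g t x)"

definition hessian :: "(real ^ 'n \<Rightarrow> real) \<Rightarrow> real ^ 'n \<Rightarrow> real ^ 'n ^ 'n::finite" where
  "hessian g x = (\<chi> s t. partial_deriv (partial_deriv g t) s x)"

definition twice_continuously_differentiable :: "(real ^ 'n::finite \<Rightarrow> real) \<Rightarrow> bool" where
  "twice_continuously_differentiable g \<longleftrightarrow>
     (\<forall>x. g differentiable (at x)) \<and>
     (\<forall>x. gradient g differentiable (at x)) \<and>
     continuous_on UNIV (hessian g)"

text \<open>Symmetry is not part of the definition; the Hessians to which it is applied are symmetric
  by Schwarz's theorem.\<close>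

definition positive_semidefinite :: "real ^ 'n ^ 'n::finite \<Rightarrow> bool" where
  "positive_semidefinite M \<longleftrightarrow> (\<forall>h. 0 \<le> h \<bullet> (M *v h))"


subsection \<open>Probability measures and filtrations\<close>

definition finite_moment_measures :: "real \<Rightarrow> (real ^ 'n::finite) measure set" where
  "finite_moment_measures p =
     {P. prob_space P \<and> sets P = sets borel \<and> integrable P (\<lambda>x. norm x powr p)}"

text \<open>The \<open>\<sigma>\<close>-algebra generated by the coordinates \<open>Z\<^sub>s\<close>, \<open>s \<in> I\<close>, of \<open>Z\<close>.\<close>

definition generated_sigma :: "('w \<Rightarrow> real ^ 'n::finite) \<Rightarrow> 'n set \<Rightarrow> 'w measure" where
  "generated_sigma Z I = sigma UNIV {(\<lambda>\<omega>. Z \<omega> $ s) -` A | s A. s \<in> I \<and> A \<in> sets borel}"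

abbreviation canonical_filtration :: "'n::{finite,linorder} \<Rightarrow> (real ^ 'n::{finite,linorder}) measure" where
  "canonical_filtration t \<equiv> generated_sigma (\<lambda>x. x) {..t}"

abbreviation cond_probability :: "'w measure \<Rightarrow> 'w measure \<Rightarrow> 'w set \<Rightarrow> 'w \<Rightarrow> real" where
  "cond_probability M G E \<equiv> real_cond_exp M G (indicator E)"


subsection \<open>Controls and the value of the control problem\<close>

definition control_box :: "real \<Rightarrow> (real ^ 'n::finite) set" where
  "control_box L = {a. \<forall>t. a $ t \<in> {-L..L}}"

definition controls :: "real \<Rightarrow> (real ^ 'n::{finite,linorder} \<Rightarrow> real ^ 'n::{finite,linorder}) set" where
  "controls L = {a. \<forall>t.
     (\<lambda>x. a x $ t) \<in> borel_measurable borel \<and>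
     (\<forall>x y. (\<forall>s<t. x $ s = y $ s) \<longrightarrow> a x $ t = a y $ t) \<and>
     (\<forall>x. \<bar>a x $ t\<bar> \<le> L)}"

text \<open>As a real infimum this presupposes that \<open>L \<ge> 0\<close> and that the integrals exist and are bounded
  below, as is the case when \<open>f\<close> has growth of order \<open>p\<close> in \<open>x\<close> and \<open>Q\<close> has a finite \<open>p\<close>-th moment.\<close>

definition control_value ::
  "(real ^ 'n::{finite,linorder} \<Rightarrow> real ^ 'n::{finite,linorder} \<Rightarrow> real)
    \<Rightarrow> real \<Rightarrow> (real ^ 'n::{finite,linorder}) measure \<Rightarrow> real" where
  "control_value f L Q = (INF a\<in>controls L. \<integral>x. f x (a x) \<partial>Q)"


subsection \<open>Adapted Wasserstein distance\<close>

definition couplings ::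
  "(real ^ 'n::finite) measure \<Rightarrow> (real ^ 'n::finite) measure
    \<Rightarrow> ((real ^ 'n::finite) \<times> (real ^ 'n::finite)) measure set" where
  "couplings P Q =
     {\<pi>. prob_space \<pi> \<and> sets \<pi> = sets borel \<and> distr \<pi> borel fst = P \<and> distr \<pi> borel snd = Q}"

text \<open>Borel subsets of \<open>\<real>\<^sup>t\<close> are the measurable sets of the product of the Borel spaces
  over \<open>{..t}\<close>.\<close>

definition causal ::
  "'w measure \<Rightarrow> ('w \<Rightarrow> real ^ 'n::{finite,linorder}) \<Rightarrow> ('w \<Rightarrow> real ^ 'n::{finite,linorder}) \<Rightarrow> bool" where
  "causal \<pi> X Y \<longleftrightarrow>
     (\<forall>t. \<forall>A \<in> sets (\<Pi>\<^sub>M s\<in>{..t}. (borel :: real measure)).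
        AE \<omega> in \<pi>.
          cond_probability \<pi> (generated_sigma X UNIV) {\<omega>. (\<lambda>s\<in>{..t}. Y \<omega> $ s) \<in> A} \<omega> =
          cond_probability \<pi> (generated_sigma X {..t}) {\<omega>. (\<lambda>s\<in>{..t}. Y \<omega> $ s) \<in> A} \<omega>)"

definition bicausal_couplings ::
  "(real ^ 'n::{finite,linorder}) measure \<Rightarrow> (real ^ 'n::{finite,linorder}) measure
    \<Rightarrow> ((real ^ 'n::{finite,linorder}) \<times> (real ^ 'n::{finite,linorder})) measure set" where
  "bicausal_couplings P Q = {\<pi> \<in> couplings P Q. causal \<pi> fst snd \<and> causal \<pi> snd fst}"

text \<open>The infimum is only meaningful in \<open>\<real>\<close> for \<open>P\<close> and \<open>Q\<close> with finite \<open>p\<close>-th moment: then the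
  product coupling is bicausal and all integrals below are finite.\<close>

definition adapted_wasserstein ::
  "real \<Rightarrow> (real ^ 'n::{finite,linorder}) measure \<Rightarrow> (real ^ 'n::{finite,linorder}) measure \<Rightarrow> real" where
  "adapted_wasserstein p P Q =
     (INF \<pi>\<in>bicausal_couplings P Q.
        (\<Sum>t\<in>UNIV. \<integral>\<omega>. \<bar>fst \<omega> $ t - snd \<omega> $ t\<bar> powr p \<partial>\<pi>) powr (1 / p))"

definition aw_ball ::
  "real \<Rightarrow> (real ^ 'n::{finite,linorder}) measure \<Rightarrow> real \<Rightarrow> (real ^ 'n::{finite,linorder}) measure set" where
  "aw_ball p P r = {Q \<in> finite_moment_measures p. adapted_wasserstein p P Q \<le> r}"

end

theory Submission
  imports Defs
begin

text \<open>
  The value is compared with \<open>P\<close> from both sides, to first order in the radius \<open>r\<close>.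

  Strong convexity at midpoints shows that two controls whose costs are close to optimal are close to each
  other in a weighted \<open>L\<^sup>2\<close> distance (\<open>weighted_distance_le\<close>).  This yields uniqueness of the optimal
  control \<open>a\<close>, its existence as an almost sure limit of a minimising sequence, and the continuity of the
  first-order term at \<open>a\<close> (\<open>gradient_stability\<close>).

  Upper bound (\<open>value_upper_bound\<close>).  Let \<open>Q\<close> lie in the ball and let \<open>(X, Y)\<close> be a bicausal coupling of
  \<open>P\<close> and \<open>Q\<close> with cost close to \<open>r\<close>.  The conditional expectation of \<open>a\<^sub>t(X)\<close> given \<open>Y\<close> depends,
  by causality from \<open>Y\<close> to \<open>X\<close>, only on the past of \<open>Y\<close>, so it is an admissible control for \<open>Q\<close>; by
  convexity its cost is at most \<open>E f(Y, a(X))\<close> (\<open>transfer_control\<close>).  Expanding in the first argument,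
  the linear term is \<open>E (\<Sum>t. \<partial>\<^sub>t f(X, a(X)) (Y\<^sub>t - X\<^sub>t))\<close>; causality from \<open>X\<close> to \<open>Y\<close> replaces each
  partial derivative by its projection on the information at time \<open>t\<close>, and Hoelder's inequality gives the
  stated coefficient (\<open>first_order_term_le\<close>).  The remainder is of smaller order uniformly over couplings
  (\<open>expected_remainder\<close>).

  Lower bound (\<open>value_lower_bound\<close>).  The extremal direction in Hoelder's inequality is approximated by
  a bounded Lipschitz adapted direction \<open>Z\<close> (\<open>steepest_direction\<close>).  For small \<open>r\<close> the map
  \<open>x \<mapsto> x + r Z(x)\<close> is an adapted bijection with adapted inverse, so its graph is a bicausal coupling and
  the image of \<open>P\<close> lies in the ball (\<open>perturbed_measure_in_ball\<close>).  A nearly optimal control for this image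
  becomes, after composition with the map, a nearly optimal control for \<open>P\<close>, to which the stability
  statement applies.
\<close>

section \<open>Partial derivatives, gradients and Hessians\<close>

lemma line_in_coordinate:
  fixes x :: "real ^ 'n::finite"
  shows "(\<chi> s. if s = t then u else x $ s) = x + (u - x $ t) *\<^sub>R axis t 1"
  by (simp add: vec_eq_iff axis_def)

lemma partial_deriv_eq_frechet:
  fixes g :: "real ^ 'n::finite \<Rightarrow> real"
  assumes "(g has_derivative g') (at x)"
  shows "partial_deriv g t x = g' (axis t 1)"
proof -
  interpret bounded_linear g' using assms by (rule has_derivative_bounded_linear)
  have line: "((\<lambda>u. x + (u - x $ t) *\<^sub>R axis t 1) has_derivative (\<lambda>h. h *\<^sub>R axis t 1)) (at (x $ t))"
    by (auto intro!: derivative_eq_intros)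
  have "((\<lambda>u. g (x + (u - x $ t) *\<^sub>R axis t 1)) has_derivative (\<lambda>h. g' (h *\<^sub>R axis t 1))) (at (x $ t))"
    by (rule has_derivative_compose[OF line]) (simp add: assms)
  then have "((\<lambda>u. g (x + (u - x $ t) *\<^sub>R axis t 1)) has_field_derivative g' (axis t 1)) (at (x $ t))"
    by (simp add: has_field_derivative_def scaleR mult_commute_abs)
  then show ?thesis
    unfolding partial_deriv_def line_in_coordinate by (rule DERIV_imp_deriv)
qed

lemma has_derivative_partial_deriv:
  fixes g :: "real ^ 'n::finite \<Rightarrow> real"
  assumes "g differentiable (at x)"
  shows "(g has_derivative (\<lambda>h. \<Sum>t\<in>UNIV. partial_deriv g t x * h $ t)) (at x)"
proof -
  obtain g' where g': "(g has_derivative g') (at x)"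
    using assms by (auto simp: differentiable_def)
  interpret bounded_linear g' using g' by (rule has_derivative_bounded_linear)
  have "g' h = (\<Sum>t\<in>UNIV. partial_deriv g t x * h $ t)" for h
  proof -
    have "g' h = g' (\<Sum>t\<in>UNIV. h $ t *\<^sub>R axis t 1)"
      using basis_expansion[of h] by (simp add: scalar_mult_eq_scaleR)
    also have "\<dots> = (\<Sum>t\<in>UNIV. h $ t * g' (axis t 1))"
      by (simp add: sum scaleR)
    finally show ?thesis
      by (simp add: partial_deriv_eq_frechet[OF g'] mult.commute)
  qed
  then show ?thesis using g' by (metis (no_types, lifting) ext)
qed

lemma has_field_derivative_on_line:
  fixes g :: "real ^ 'n::finite \<Rightarrow> real"
  assumes "\<And>x. g differentiable (at x)"
  shows "((\<lambda>s. g (x + s *\<^sub>R h)) has_real_derivative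
    (\<Sum>t\<in>UNIV. partial_deriv g t (x + s *\<^sub>R h) * h $ t)) (at s)"
proof -
  have line: "((\<lambda>s. x + s *\<^sub>R h) has_derivative (\<lambda>u. u *\<^sub>R h)) (at s)"
    by (auto intro!: derivative_eq_intros)
  have "(\<lambda>u. \<Sum>t\<in>UNIV. partial_deriv g t (x + s *\<^sub>R h) * (u *\<^sub>R h) $ t)
    = (*) (\<Sum>t\<in>UNIV. partial_deriv g t (x + s *\<^sub>R h) * h $ t)"
    by (simp add: fun_eq_iff sum_distrib_left sum_distrib_right mult_ac)
  then show ?thesis
    using has_derivative_compose[OF line has_derivative_partial_deriv[OF assms]]
    by (simp add: has_field_derivative_def)
qed

lemma mean_value_partial_deriv:
  fixes g :: "real ^ 'n::finite \<Rightarrow> real"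
  assumes "\<And>x. g differentiable (at x)"
  obtains s where "0 < s" "s < 1"
    "g y - g x = (\<Sum>t\<in>UNIV. partial_deriv g t (x + s *\<^sub>R (y - x)) * (y $ t - x $ t))"
proof -
  have "\<exists>s>0. s < 1 \<and> g (x + 1 *\<^sub>R (y - x)) - g (x + 0 *\<^sub>R (y - x)) =
      (1 - 0) * (\<Sum>t\<in>UNIV. partial_deriv g t (x + s *\<^sub>R (y - x)) * (y - x) $ t)"
    by (rule MVT2) (simp, rule has_field_derivative_on_line[OF assms])
  then show ?thesis using that by auto
qed

lemma gradient_inequality:
  fixes g :: "real ^ 'n::finite \<Rightarrow> real"
  assumes "convex_on UNIV g" and "\<And>x. g differentiable (at x)"
  shows "g b + (\<Sum>t\<in>UNIV. partial_deriv g t b * (a $ t - b $ t)) \<le> g a"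
proof -
  let ?\<phi> = "\<lambda>s. g (b + s *\<^sub>R (a - b))"
  have "convex_on UNIV ?\<phi>"
  proof (rule convex_onI)
    fix t x y :: real assume t: "0 < t" "t < 1"
    have "b + ((1 - t) *\<^sub>R x + t *\<^sub>R y) *\<^sub>R (a - b)
        = (1 - t) *\<^sub>R (b + x *\<^sub>R (a - b)) + t *\<^sub>R (b + y *\<^sub>R (a - b))"
      by (simp add: algebra_simps)
    then show "?\<phi> ((1 - t) *\<^sub>R x + t *\<^sub>R y) \<le> (1 - t) * ?\<phi> x + t * ?\<phi> y"
      using convex_onD[OF assms(1), of t "b + x *\<^sub>R (a - b)" "b + y *\<^sub>R (a - b)"] t
      by (simp del: scaleR_add_left)
  qed simp
  then have "?\<phi> 1 - ?\<phi> 0 \<ge> (\<Sum>t\<in>UNIV. partial_deriv g t (b + 0 *\<^sub>R (a - b)) * (a - b) $ t) * (1 - 0)"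
    by (rule convex_on_imp_above_tangent[where A = UNIV])
       (use has_field_derivative_on_line[OF assms(2), of b "a - b" 0] in auto)
  then show ?thesis by simp
qed

text \<open>The bound on the Hessian is used only on the segment between the two points, and only through its
  quadratic form, for which symmetry of the Hessian is irrelevant.\<close>

lemma strongly_convex_midpoint:
  fixes g :: "real ^ 'n::finite \<Rightarrow> real"
  assumes g: "twice_continuously_differentiable g"
    and psd: "\<And>a. a \<in> control_box L \<Longrightarrow> positive_semidefinite (hessian g a - mat e)"
    and a: "a \<in> control_box L" and b: "b \<in> control_box L"
  shows "g ((1/2) *\<^sub>R (a + b)) \<le> (g a + g b) / 2 - e / 8 * (norm (a - b))\<^sup>2"
proof -
  define h where "h = b - a"
  have diff: "\<And>x. g differentiable (at x)" "\<And>x. gradient g differentiable (at x)"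
    using g by (auto simp: twice_continuously_differentiable_def)
  have diffp: "partial_deriv g t differentiable (at x)" for t x
  proof -
    obtain G' where "(gradient g has_derivative G') (at x)"
      using diff(2)[of x] by (auto simp: differentiable_def)
    then have "((\<lambda>x. gradient g x $ t) has_derivative (\<lambda>h. G' h $ t)) (at x)"
      by (rule bounded_linear.has_derivative[OF bounded_linear_vec_nth])
    then show ?thesis
      by (auto simp: gradient_def differentiable_def)
  qed
  let ?l = "\<lambda>s. a + s *\<^sub>R h"
  let ?\<phi> = "\<lambda>s. g (?l s)"
  let ?\<phi>' = "\<lambda>s. \<Sum>t\<in>UNIV. partial_deriv g t (?l s) * h $ t"
  let ?\<phi>'' = "\<lambda>s. \<Sum>t\<in>UNIV. (\<Sum>u\<in>UNIV. partial_deriv (partial_deriv g t) u (?l s) * h $ u) * h $ t"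
  let ?e = "e * (norm h)\<^sup>2"
  have d1: "(?\<phi> has_real_derivative ?\<phi>' s) (at s)" for s
    by (rule has_field_derivative_on_line[OF diff(1)])
  have d2: "(?\<phi>' has_real_derivative ?\<phi>'' s) (at s)" for s
    by (intro DERIV_sum DERIV_cmult_right has_field_derivative_on_line diffp)
  have box: "?l s \<in> control_box L" if "s \<in> {0..1}" for s
  proof -
    have "(1 - s) *\<^sub>R a $ t + s *\<^sub>R b $ t \<in> {-L..L}" for t
      using a b that convexD_alt[OF convex_real_interval(5)[of "-L" L], of "a $ t" "b $ t" s]
      by (simp add: control_box_def)
    then show ?thesis by (simp add: control_box_def h_def algebra_simps)
  qed
  have lower: "?\<phi>'' s \<ge> ?e" if "s \<in> {0..1}" for s
  proof -
    have "0 \<le> h \<bullet> ((hessian g (?l s) - mat e) *v h)"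
      using psd[OF box[OF that]] by (simp add: positive_semidefinite_def)
    also have "\<dots> = h \<bullet> (hessian g (?l s) *v h) - h \<bullet> (mat e *v h)"
      by (simp add: matrix_vector_mult_diff_rdistrib inner_diff_right)
    also have "mat e *v h = e *\<^sub>R h"
      by (simp add: vec_eq_iff matrix_vector_mult_def mat_def if_distrib if_distribR cong: if_cong)
    also have "h \<bullet> (hessian g (?l s) *v h) = ?\<phi>'' s"
      unfolding inner_vec_def matrix_vector_mult_def hessian_def
      by (simp add: sum_distrib_left sum_distrib_right)
         (subst sum.swap, simp add: mult_ac)
    finally show ?thesis by (simp add: power2_norm_eq_inner)
  qed
  have "convex_on {0..1} (\<lambda>s. ?\<phi> s - ?e / 2 * s\<^sup>2)"
  proof (rule f''_ge0_imp_convex)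
    show "((\<lambda>s. ?\<phi> s - ?e / 2 * s\<^sup>2) has_real_derivative ?\<phi>' s - ?e * s) (at s)" for s
      by (rule derivative_eq_intros d1 refl | simp)+
    show "((\<lambda>s. ?\<phi>' s - ?e * s) has_real_derivative ?\<phi>'' s - ?e) (at s)" for s
      by (rule derivative_eq_intros d2 refl | simp)+
  qed (use lower in auto)
  from convex_onD[OF this, of "1/2" 0 1]
  have "?\<phi> (1/2) - ?e / 2 * (1/2)\<^sup>2 \<le> ?\<phi> 0 / 2 + (?\<phi> 1 - ?e / 2) / 2"
    by simp
  moreover have "?l (1/2) = (1/2) *\<^sub>R (a + b)"
    by (simp add: h_def vec_eq_iff field_simps)
  moreover have "?l 1 = b" by (simp add: h_def)
  moreover have "norm h = norm (a - b)" by (simp add: h_def norm_minus_commute)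
  ultimately show ?thesis by (simp add: power2_eq_square field_simps)
qed

section \<open>Growth and regularity of the cost\<close>

lemma powr_add_le:
  fixes u v s :: real
  assumes "0 \<le> u" "0 \<le> v" "0 \<le> s"
  shows "(u + v) powr s \<le> 2 powr s * (u powr s + v powr s)"
proof -
  have "(u + v) powr s \<le> (2 * max u v) powr s"
    using assms by (intro powr_mono2) auto
  also have "\<dots> = 2 powr s * max u v powr s"
    using assms by (simp add: powr_mult)
  also have "\<dots> \<le> 2 powr s * (u powr s + v powr s)"
    by (intro mult_left_mono) (auto simp: max_def)
  finally show ?thesis .
qed

lemma powr_le_one_plus:
  fixes u s t :: real
  assumes "0 \<le> u" "0 \<le> s" "s \<le> t"
  shows "u powr s \<le> 1 + u powr t"
proof (cases "u \<le> 1")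
  case True
  then have "u powr s \<le> 1 powr s" using assms by (intro powr_mono2) auto
  then show ?thesis by (simp add: add_increasing2)
next
  case False
  then show ?thesis using assms powr_mono[of s t u] by linarith
qed

lemma powr_minus_one_mult:
  fixes u p :: real
  assumes "0 \<le> u" "p \<noteq> 1"
  shows "u * u powr (p - 1) = u powr p"
  using assms by (cases "u = 0") (auto simp: powr_diff)

lemma control_box_eq_cbox: "control_box L = cbox (\<chi> t. - L) (\<chi> t. L)"
  by (auto simp: control_box_def mem_box_cart)

lemma compact_control_box: "compact (control_box L)"
  by (simp add: control_box_eq_cbox)

text \<open>The data of the control problem.  The measure \<open>P\<close> is the reference model; the cost is convex in the
  control, strongly so at \<open>P\<close>-almost every path, and its gradient in the path has growth of order
  \<open>p - 1\<close>, so that it is \<open>q\<close>-integrable along any admissible control.\<close>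

locale control_problem =
  fixes p q L :: real
    and P :: "(real ^ 'n::{finite,linorder}) measure"
    and f :: "real ^ 'n::{finite,linorder} \<Rightarrow> real ^ 'n::{finite,linorder} \<Rightarrow> real"
    and \<epsilon> :: "real ^ 'n::{finite,linorder} \<Rightarrow> real"
  assumes p: "1 < p" and q_eq: "q = p / (p - 1)" and L: "0 \<le> L"
    and P: "P \<in> finite_moment_measures p"
    and convex: "\<And>x. convex_on UNIV (f x)"
    and C2: "\<And>x. twice_continuously_differentiable (f x)"
    and eps_borel: "\<epsilon> \<in> borel_measurable borel"
    and eps_pos: "measure P {x. 0 < \<epsilon> x} = 1"
    and strongly_convex:
      "\<And>x a. a \<in> control_box L \<Longrightarrow> positive_semidefinite (hessian (f x) a - mat (\<epsilon> x))"
    and differentiable_x: "\<And>a x. (\<lambda>x. f x a) differentiable (at x)"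
    and continuous_partials:
      "\<And>t. continuous_on UNIV (\<lambda>(x, a). partial_deriv (\<lambda>x. f x a) t x)"
    and growth:
      "\<exists>c>0. \<forall>x. \<forall>a\<in>control_box L.
         (\<Sum>s\<in>UNIV. \<bar>partial_deriv (\<lambda>x. f x a) s x\<bar>) \<le> c * (1 + (\<Sum>s\<in>UNIV. \<bar>x $ s\<bar> powr (p - 1)))"
begin

lemma q: "1 < q" "1 / p + 1 / q = 1" "(p - 1) * q = p" "q - 1 = 1 / (p - 1)" "(q - 1) * p = q"
  using p by (auto simp: q_eq field_simps)

text \<open>The gradient of the cost in the state variable.\<close>

definition grad_x :: "(real, 'n) vec \<Rightarrow> (real, 'n) vec \<Rightarrow> (real, 'n) vec" where
  "grad_x x a = gradient (\<lambda>x. f x a) x"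

lemma grad_x_nth: "grad_x x a $ t = partial_deriv (\<lambda>x. f x a) t x"
  by (simp add: grad_x_def gradient_def)

lemma continuous_grad_x: "continuous_on UNIV (\<lambda>z. grad_x (fst z) (snd z))"
  unfolding grad_x_def gradient_def
  using continuous_partials by (intro continuous_on_vec_lambda) (auto simp: case_prod_unfold)

lemma mean_value_grad_x:
  obtains s where "0 < s" "s < 1" "f y a - f x a = grad_x (x + s *\<^sub>R (y - x)) a \<bullet> (y - x)"
proof -
  obtain s where "0 < s" "s < 1"
    "f y a - f x a = (\<Sum>t\<in>UNIV. partial_deriv (\<lambda>x. f x a) t (x + s *\<^sub>R (y - x)) * (y $ t - x $ t))"
    by (rule mean_value_partial_deriv[OF differentiable_x])
  then show ?thesis by (intro that[of s]) (auto simp: inner_vec_def grad_x_nth)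
qed

lemma grad_x_bound:
  "\<exists>C>0. \<forall>x. \<forall>a\<in>control_box L. norm (grad_x x a) \<le> C * (1 + norm x powr (p - 1))"
proof -
  obtain c where c: "c > 0" "\<And>x a. a \<in> control_box L \<Longrightarrow>
         (\<Sum>s\<in>UNIV. \<bar>partial_deriv (\<lambda>x. f x a) s x\<bar>) \<le> c * (1 + (\<Sum>s\<in>UNIV. \<bar>x $ s\<bar> powr (p - 1)))"
    using growth by blast
  let ?N = "real CARD('n)"
  have N: "?N \<ge> 1" by (simp add: Suc_leI)
  show ?thesis
  proof (intro exI[of _ "c * ?N"] conjI allI ballI)
    show "c * ?N > 0" using c by simp
    fix x a :: "(real, 'n) vec" assume a: "a \<in> control_box L"
    have "norm (grad_x x a) \<le> (\<Sum>s\<in>UNIV. \<bar>partial_deriv (\<lambda>x. f x a) s x\<bar>)"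
      using norm_le_l1_cart[of "grad_x x a"] by (simp add: grad_x_nth)
    also have "\<dots> \<le> c * (1 + (\<Sum>s\<in>UNIV. \<bar>x $ s\<bar> powr (p - 1)))" by (rule c(2)[OF a])
    also have "\<dots> \<le> c * (?N + (\<Sum>s\<in>(UNIV :: 'n set). norm x powr (p - 1)))"
      using c(1) p N by (intro mult_left_mono add_mono sum_mono powr_mono2) (auto simp: component_le_norm_cart)
    finally show "norm (grad_x x a) \<le> c * ?N * (1 + norm x powr (p - 1))"
      by (simp add: algebra_simps)
  qed
qed

lemma grad_x_segment_bound:
  "\<exists>C>0. \<forall>x h. \<forall>s\<in>{0..1}. \<forall>a\<in>control_box L.
    norm (grad_x (x + s *\<^sub>R h) a) \<le> C * (1 + norm x powr (p - 1) + norm h powr (p - 1))"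
proof -
  obtain C where C: "C > 0" "\<And>x a. a \<in> control_box L \<Longrightarrow> norm (grad_x x a) \<le> C * (1 + norm x powr (p - 1))"
    using grad_x_bound by blast
  show ?thesis
  proof (intro exI[of _ "C * (1 + 2 powr (p - 1))"] conjI allI ballI)
    show "C * (1 + 2 powr (p - 1)) > 0" using C(1) by (simp add: add_pos_pos)
    fix x h a :: "(real, 'n) vec" and s :: real
    assume s: "s \<in> {0..1}" and a: "a \<in> control_box L"
    have "norm (x + s *\<^sub>R h) \<le> norm x + \<bar>s\<bar> * norm h"
      by (metis norm_triangle_ineq norm_scaleR)
    also have "\<bar>s\<bar> * norm h \<le> norm h" using s by (simp add: mult_left_le_one_le)
    finally have "norm (x + s *\<^sub>R h) powr (p - 1) \<le> (norm x + norm h) powr (p - 1)"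
      using p by (intro powr_mono2) auto
    also have "\<dots> \<le> 2 powr (p - 1) * (norm x powr (p - 1) + norm h powr (p - 1))"
      using p by (intro powr_add_le) auto
    finally have *: "norm (x + s *\<^sub>R h) powr (p - 1) \<le> 2 powr (p - 1) * (norm x powr (p - 1) + norm h powr (p - 1))" .
    have "norm (grad_x (x + s *\<^sub>R h) a) \<le> C * (1 + norm (x + s *\<^sub>R h) powr (p - 1))"
      by (rule C(2)[OF a])
    also have "\<dots> \<le> C * (1 + 2 powr (p - 1) * (norm x powr (p - 1) + norm h powr (p - 1)))"
      using * C(1) by simp
    also have "\<dots> \<le> C * ((1 + 2 powr (p - 1)) * (1 + norm x powr (p - 1) + norm h powr (p - 1)))"
      using C(1) by (intro mult_left_mono) (auto simp: algebra_simps intro!: add_increasing add_nonneg_nonneg)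
    finally show "norm (grad_x (x + s *\<^sub>R h) a)
        \<le> C * (1 + 2 powr (p - 1)) * (1 + norm x powr (p - 1) + norm h powr (p - 1))"
      by (simp add: mult.assoc)
  qed
qed

text \<open>The remainder of the first-order expansion of the cost in the state variable.\<close>

definition remainder :: "(real, 'n) vec \<Rightarrow> (real, 'n) vec \<Rightarrow> (real, 'n) vec \<Rightarrow> real" where
  "remainder x y a = f y a - f x a - grad_x x a \<bullet> (y - x)"

lemma remainder_uniformly_small:
  assumes "0 < \<eta>"
  shows "\<exists>\<delta>>0. \<forall>x y. \<forall>a\<in>control_box L. norm x \<le> N \<longrightarrow> norm (y - x) \<le> \<delta> \<longrightarrow>
    \<bar>remainder x y a\<bar> \<le> \<eta> * norm (y - x)"
proof -
  let ?K = "cball (0 :: (real, 'n) vec) (N + 1) \<times> (control_box L :: (real, 'n) vec set)"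
  have "uniformly_continuous_on ?K (\<lambda>z. grad_x (fst z) (snd z))"
    by (intro compact_uniformly_continuous compact_Times compact_control_box compact_cball
        continuous_on_subset[OF continuous_grad_x]) auto
  then obtain d where d: "d > 0" "\<And>z z'. z \<in> ?K \<Longrightarrow> z' \<in> ?K \<Longrightarrow> dist z' z < d \<Longrightarrow>
      dist (grad_x (fst z') (snd z')) (grad_x (fst z) (snd z)) < \<eta>"
    using assms unfolding uniformly_continuous_on_def by meson
  show ?thesis
  proof (intro exI[of _ "min 1 (d / 2)"] conjI allI ballI impI)
    show "0 < min 1 (d / 2)" using d by simp
    fix x y a :: "(real, 'n) vec"
    assume a: "a \<in> control_box L" and x: "norm x \<le> N" and y: "norm (y - x) \<le> min 1 (d / 2)"
    obtain s where s: "0 < s" "s < 1" "f y a - f x a = grad_x (x + s *\<^sub>R (y - x)) a \<bullet> (y - x)"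
      by (rule mean_value_grad_x)
    have sy: "norm (s *\<^sub>R (y - x)) \<le> norm (y - x)" using s by (simp add: mult_left_le_one_le)
    then have "norm (x + s *\<^sub>R (y - x)) \<le> N + 1"
      using norm_triangle_ineq[of x "s *\<^sub>R (y - x)"] x y by linarith
    moreover have "dist (x + s *\<^sub>R (y - x), a) (x, a) < d"
      using sy y d(1) by (simp add: dist_Pair_Pair dist_norm del: norm_scaleR)
    ultimately have "dist (grad_x (x + s *\<^sub>R (y - x)) a) (grad_x x a) < \<eta>"
      using d(2)[of "(x, a)" "(x + s *\<^sub>R (y - x), a)"] a x by simp
    then have "\<bar>(grad_x (x + s *\<^sub>R (y - x)) a - grad_x x a) \<bullet> (y - x)\<bar> \<le> \<eta> * norm (y - x)"
      by (intro order_trans[OF Cauchy_Schwarz_ineq2] mult_right_mono) (auto simp: dist_norm)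
    then show "\<bar>remainder x y a\<bar> \<le> \<eta> * norm (y - x)"
      by (simp add: remainder_def s(3) inner_diff_left)
  qed
qed

lemma cost_increment_bound:
  "\<exists>C>0. \<forall>x y. \<forall>a\<in>control_box L.
    \<bar>f y a - f x a\<bar> \<le> C * norm (y - x) * (1 + norm x powr (p - 1) + norm (y - x) powr (p - 1)) \<and>
    \<bar>remainder x y a\<bar> \<le> C * norm (y - x) * (1 + norm x powr (p - 1) + norm (y - x) powr (p - 1))"
proof -
  obtain C where C: "C > 0" "\<And>x h s a. s \<in> {0..1} \<Longrightarrow> a \<in> control_box L \<Longrightarrow>
    norm (grad_x (x + s *\<^sub>R h) a) \<le> C * (1 + norm x powr (p - 1) + norm h powr (p - 1))"
    using grad_x_segment_bound by blast
  show ?thesis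
  proof (intro exI[of _ "2 * C"] allI ballI)
    show "2 * C > 0 \<and> (\<forall>x y. \<forall>a\<in>control_box L.
      \<bar>f y a - f x a\<bar> \<le> 2 * C * norm (y - x) * (1 + norm x powr (p - 1) + norm (y - x) powr (p - 1)) \<and>
      \<bar>remainder x y a\<bar> \<le> 2 * C * norm (y - x) * (1 + norm x powr (p - 1) + norm (y - x) powr (p - 1)))"
    proof (intro conjI allI ballI)
      fix x y a :: "(real, 'n) vec" assume a: "a \<in> control_box L"
      let ?B = "C * (1 + norm x powr (p - 1) + norm (y - x) powr (p - 1))"
      have B: "?B \<ge> 0" using C(1) by simp
      obtain s where s: "0 < s" "s < 1" "f y a - f x a = grad_x (x + s *\<^sub>R (y - x)) a \<bullet> (y - x)"
        by (rule mean_value_grad_x)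
      have 1: "\<bar>f y a - f x a\<bar> \<le> ?B * norm (y - x)"
        unfolding s(3) using s a
        by (intro order_trans[OF Cauchy_Schwarz_ineq2] mult_right_mono C(2)) auto
      have 2: "\<bar>grad_x x a \<bullet> (y - x)\<bar> \<le> ?B * norm (y - x)"
        using a C(2)[of 0 a x "y - x"]
        by (intro order_trans[OF Cauchy_Schwarz_ineq2] mult_right_mono) auto
      have 0: "0 \<le> ?B * norm (y - x)" using B by (simp add: mult_nonneg_nonneg)
      show "\<bar>f y a - f x a\<bar> \<le> 2 * C * norm (y - x) * (1 + norm x powr (p - 1) + norm (y - x) powr (p - 1))"
        using 1 0 by (simp add: mult_ac)
      show "\<bar>remainder x y a\<bar> \<le> 2 * C * norm (y - x) * (1 + norm x powr (p - 1) + norm (y - x) powr (p - 1))"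
        using 1 2 unfolding remainder_def by (simp add: mult_ac)
    qed (use C in auto)
  qed
qed

text \<open>For a path in the ball of radius \<open>N\<close> and a short displacement, uniform continuity of the gradient on
  compact sets makes the remainder small relative to the displacement.  For a long displacement the growth
  bound is absorbed by its \<open>p\<close>-th power, and outside the ball a \<open>q\<close>-integrable tail appears.  The bound
  is uniform in the control, which allows an arbitrary measurable control to be inserted later.\<close>

lemma remainder_bound:
  "\<exists>C>0. \<forall>\<eta>>0. \<forall>N\<ge>0. \<exists>K\<ge>0. \<forall>x y. \<forall>a\<in>control_box L.
    \<bar>remainder x y a\<bar> \<le> norm (y - x) *
      (\<eta> + C * (indicator {x. N < norm x} x * (1 + norm x powr (p - 1))) + K * norm (y - x) powr (p - 1))"
proof -
  obtain C where C: "C > 0" "\<And>x y a. a \<in> control_box L \<Longrightarrow>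
    \<bar>remainder x y a\<bar> \<le> C * norm (y - x) * (1 + norm x powr (p - 1) + norm (y - x) powr (p - 1))"
    using cost_increment_bound by blast
  show ?thesis
  proof (rule exI[of _ C], intro conjI allI impI)
    show "C > 0" by (rule C(1))
  next
    fix \<eta> N :: real assume \<eta>: "0 < \<eta>" and N: "0 \<le> N"
    obtain \<delta> where \<delta>: "\<delta> > 0" "\<And>x y a. a \<in> control_box L \<Longrightarrow> norm x \<le> N \<Longrightarrow> norm (y - x) \<le> \<delta> \<Longrightarrow>
      \<bar>remainder x y a\<bar> \<le> \<eta> * norm (y - x)"
      using remainder_uniformly_small[OF \<eta>, of N] by blast
    define K where "K = C * ((1 + N powr (p - 1)) / \<delta> powr (p - 1) + 1)"
    have K: "0 \<le> K" "C \<le> K" using C(1) \<delta>(1) by (auto simp: K_def)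
    show "\<exists>K\<ge>0. \<forall>x y. \<forall>a\<in>control_box L.
      \<bar>remainder x y a\<bar> \<le> norm (y - x) *
        (\<eta> + C * (indicator {x. N < norm x} x * (1 + norm x powr (p - 1))) + K * norm (y - x) powr (p - 1))"
    proof (intro exI[of _ K] conjI allI ballI)
      show "0 \<le> K" by (rule K)
    next
      fix x y a :: "(real, 'n) vec" assume a: "a \<in> control_box L"
      let ?d = "norm (y - x)"
      consider "N < norm x" | "norm x \<le> N" "?d \<le> \<delta>" | "norm x \<le> N" "\<delta> < ?d" by linarith
      then show "\<bar>remainder x y a\<bar> \<le> ?d *
        (\<eta> + C * (indicator {x. N < norm x} x * (1 + norm x powr (p - 1))) + K * ?d powr (p - 1))"
      proof cases
        case 1
        have "C * ?d * (1 + norm x powr (p - 1) + ?d powr (p - 1))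
          = ?d * (C * (1 + norm x powr (p - 1)) + C * ?d powr (p - 1))" by (simp add: algebra_simps)
        also have "\<dots> \<le> ?d * (\<eta> + C * (1 + norm x powr (p - 1)) + K * ?d powr (p - 1))"
          using K(2) \<eta> mult_right_mono[OF K(2), of "?d powr (p - 1)"]
          by (intro mult_left_mono) auto
        finally show ?thesis using C(2)[OF a, of x y] 1 by simp
      next
        case 2
        have "\<eta> * ?d \<le> ?d * (\<eta> + K * ?d powr (p - 1))"
          using K by (simp add: distrib_left mult.commute)
        then show ?thesis using \<delta>(2)[OF a 2] 2 by simp
      next
        case 3
        have "1 + norm x powr (p - 1) \<le> 1 + N powr (p - 1)"
          using 3 p by (simp add: powr_mono2)
        also have "\<dots> \<le> (1 + N powr (p - 1)) * (?d powr (p - 1) / \<delta> powr (p - 1))"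
        proof -
          have "\<delta> powr (p - 1) \<le> ?d powr (p - 1)" using 3 \<delta>(1) p by (intro powr_mono2) auto
          then have "1 \<le> ?d powr (p - 1) / \<delta> powr (p - 1)" using \<delta>(1) by simp
          then have "(1 + N powr (p - 1)) * 1 \<le> (1 + N powr (p - 1)) * (?d powr (p - 1) / \<delta> powr (p - 1))"
            by (intro mult_left_mono) auto
          then show ?thesis by simp
        qed
        finally have "C * (1 + norm x powr (p - 1))
            \<le> C * ((1 + N powr (p - 1)) * (?d powr (p - 1) / \<delta> powr (p - 1)))"
          using C(1) by (intro mult_left_mono) auto
        then have "C * (1 + norm x powr (p - 1) + ?d powr (p - 1)) \<le> K * ?d powr (p - 1)"
          by (simp add: K_def algebra_simps)
        then have "?d * (C * (1 + norm x powr (p - 1) + ?d powr (p - 1))) \<le> ?d * (\<eta> + K * ?d powr (p - 1))"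
          using \<eta> by (intro mult_left_mono) auto
        then show ?thesis using C(2)[OF a, of x y] 3 by (simp add: mult_ac)
      qed
    qed
  qed
qed

lemma continuous_f: "continuous_on UNIV (f x)"
  using C2[of x] by (auto simp: twice_continuously_differentiable_def continuous_on_eq_continuous_at
      differentiable_imp_continuous_within)

lemma f_bound: "\<exists>C>0. \<forall>x. \<forall>a\<in>control_box L. \<bar>f x a\<bar> \<le> C * (1 + norm x powr p)"
proof -
  obtain C where C: "C > 0" "\<And>x y a. a \<in> control_box L \<Longrightarrow>
    \<bar>f y a - f x a\<bar> \<le> C * norm (y - x) * (1 + norm x powr (p - 1) + norm (y - x) powr (p - 1))"
    using cost_increment_bound by blast
  have "compact (f 0 ` control_box L)"
    by (intro compact_continuous_image compact_control_box continuous_on_subset[OF continuous_f]) auto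
  then obtain B where B: "\<And>a. a \<in> control_box L \<Longrightarrow> \<bar>f 0 a\<bar> \<le> B"
    using compact_imp_bounded[of "f 0 ` control_box L"] by (auto simp: bounded_iff)
  have "\<bar>f x a\<bar> \<le> (\<bar>B\<bar> + 2 * C) * (1 + norm x powr p)" if a: "a \<in> control_box L" for x a
  proof -
    have "\<bar>f x a\<bar> \<le> \<bar>B\<bar> + C * norm x * (1 + norm x powr (p - 1))"
      using C(2)[OF a, of x 0] B[OF a] p by auto
    also have "C * norm x * (1 + norm x powr (p - 1)) = C * (norm x + norm x powr p)"
      using p by (simp add: algebra_simps powr_minus_one_mult)
    also have "\<dots> \<le> C * (1 + 2 * norm x powr p)"
      using C(1) p powr_le_one_plus[of "norm x" 1 p] by auto
    finally have "\<bar>f x a\<bar> \<le> \<bar>B\<bar> + C * (1 + 2 * norm x powr p)" by simp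
    moreover have "0 \<le> \<bar>B\<bar> * norm x powr p" "0 \<le> C * norm x powr p" using C(1) by auto
    moreover have "(\<bar>B\<bar> + 2 * C) * (1 + norm x powr p)
        = \<bar>B\<bar> + C * (1 + 2 * norm x powr p) + C + \<bar>B\<bar> * norm x powr p"
      by (simp add: algebra_simps)
    ultimately show ?thesis using C(1) by linarith
  qed
  moreover have "\<bar>B\<bar> + 2 * C > 0" using C(1) by linarith
  ultimately show ?thesis by blast
qed

text \<open>Joint continuity: the increments in the path are controlled by the gradient, which is locally bounded
  jointly in the path and the control.\<close>

lemma continuous_cost: "continuous_on UNIV (\<lambda>z. f (fst z) (snd z))"
proof (rule continuous_at_imp_continuous_on, rule ballI)
  fix z :: "(real, 'n) vec \<times> (real, 'n) vec"
  obtain x a where z: "z = (x, a)" by fastforce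
  have "isCont (\<lambda>z. grad_x (fst z) (snd z)) z"
    using continuous_grad_x by (cases z) (simp add: continuous_on_eq_continuous_at)
  then have "\<forall>\<^sub>F z' in nhds z. dist (grad_x (fst z') (snd z')) (grad_x x a) < 1"
    unfolding isCont_def z using tendstoD[of "\<lambda>z. grad_x (fst z) (snd z)" _ "at (x, a)" 1]
    by (auto simp: eventually_nhds_conv_at)
  then obtain d where d: "d > 0" "\<And>x' a'. dist (x', a') (x, a) < d \<Longrightarrow> dist (grad_x x' a') (grad_x x a) < 1"
    by (auto simp: eventually_nhds_metric z)
  define M where "M = norm (grad_x x a) + 1"
  have incr: "\<bar>f x' a' - f x a'\<bar> \<le> M * norm (x' - x)" if "dist (x', a') (x, a) < d" for x' a'
  proof -
    obtain s where s: "0 < s" "s < 1" "f x' a' - f x a' = grad_x (x + s *\<^sub>R (x' - x)) a' \<bullet> (x' - x)"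
      by (rule mean_value_grad_x)
    have "norm (s *\<^sub>R (x' - x)) \<le> norm (x' - x)" using s by (simp add: mult_left_le_one_le)
    then have "dist (x + s *\<^sub>R (x' - x), a') (x, a) \<le> dist (x', a') (x, a)"
      unfolding dist_Pair_Pair by (intro real_sqrt_le_mono add_right_mono power_mono) (auto simp: dist_norm)
    then have "dist (grad_x (x + s *\<^sub>R (x' - x)) a') (grad_x x a) < 1"
      using that by (intro d(2)) auto
    then have "norm (grad_x (x + s *\<^sub>R (x' - x)) a') \<le> M"
      using norm_triangle_ineq2[of "grad_x (x + s *\<^sub>R (x' - x)) a'" "grad_x x a"]
      by (simp add: M_def dist_norm)
    then show ?thesis unfolding s(3)
      by (intro order_trans[OF Cauchy_Schwarz_ineq2] mult_right_mono) auto
  qed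
  have near: "\<forall>\<^sub>F z' in at z. dist z' z < d"
    using d(1) by (auto simp: eventually_at)
  have "((\<lambda>z'. f (fst z') (snd z') - f x (snd z')) \<longlongrightarrow> 0) (at z)"
  proof (rule Lim_null_comparison)
    show "\<forall>\<^sub>F z' in at z. norm (f (fst z') (snd z') - f x (snd z')) \<le> M * norm (fst z' - x)"
      using near by eventually_elim (use incr z in \<open>auto simp: case_prod_unfold\<close>)
    have "((\<lambda>z'. M * norm (fst z' - x)) \<longlongrightarrow> M * norm (fst z - x)) (at z)"
      by (intro tendsto_intros)
    then show "((\<lambda>z'. M * norm (fst z' - x)) \<longlongrightarrow> 0) (at z)" by (simp add: z)
  qed
  moreover have "((\<lambda>z'. f x (snd z')) \<longlongrightarrow> f x (snd z)) (at z)"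
    using continuous_f[of x] tendsto_snd[OF tendsto_ident_at, of z UNIV]
    by (intro isCont_tendsto_compose[of _ "f x"]) (simp_all add: continuous_on_eq_continuous_at)
  ultimately have "((\<lambda>z'. f (fst z') (snd z') - f x (snd z') + f x (snd z')) \<longlongrightarrow> 0 + f x (snd z)) (at z)"
    by (rule tendsto_add)
  then show "isCont (\<lambda>z. f (fst z) (snd z)) z" by (simp add: isCont_def z)
qed

lemma f_measurable [measurable]: "(\<lambda>z. f (fst z) (snd z)) \<in> borel_measurable borel"
  by (rule borel_measurable_continuous_onI[OF continuous_cost])

lemma f_measurable_compose [measurable (raw)]:
  assumes [measurable]: "g \<in> borel_measurable M" "h \<in> borel_measurable M"
  shows "(\<lambda>w. f (g w) (h w)) \<in> borel_measurable M"
  using measurable_compose[OF borel_measurable_Pair[OF assms] f_measurable] by simp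

lemma grad_x_measurable_compose [measurable (raw)]:
  assumes [measurable]: "g \<in> borel_measurable M" "h \<in> borel_measurable M"
  shows "(\<lambda>w. grad_x (g w) (h w)) \<in> borel_measurable M"
  using measurable_compose[OF borel_measurable_Pair[OF assms]
      borel_measurable_continuous_onI[OF continuous_grad_x]] by simp

lemma grad_a_measurable_compose:
  assumes [measurable]: "g \<in> borel_measurable M" "h \<in> borel_measurable M"
  shows "(\<lambda>w. partial_deriv (f (g w)) t (h w)) \<in> borel_measurable M"
proof (rule borel_measurable_LIMSEQ_real[where u = "\<lambda>i w. (f (g w) (h w + inverse (real (Suc i)) *\<^sub>R axis t 1)
      - f (g w) (h w)) / inverse (real (Suc i))"])
  let ?e = "\<lambda>i. inverse (real (Suc i))"
  fix w
  have "((\<lambda>s. f (g w) (h w + s *\<^sub>R axis t 1)) has_real_derivative partial_deriv (f (g w)) t (h w)) (at 0)"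
    using has_field_derivative_on_line[of "f (g w)" "h w" "axis t 1" 0] C2[of "g w"]
    by (simp add: twice_continuously_differentiable_def axis_def if_distrib cong: if_cong)
  then have "((\<lambda>s. (f (g w) (h w + s *\<^sub>R axis t 1) - f (g w) (h w)) / s) \<longlongrightarrow> partial_deriv (f (g w)) t (h w)) (at 0)"
    by (simp add: DERIV_def)
  moreover have "filterlim ?e (at 0) sequentially"
    unfolding filterlim_at using LIMSEQ_inverse_real_of_nat by auto
  ultimately show "(\<lambda>i. (f (g w) (h w + ?e i *\<^sub>R axis t 1) - f (g w) (h w)) / ?e i)
      \<longlonglongrightarrow> partial_deriv (f (g w)) t (h w)"
    by (rule filterlim_compose)
next
  fix i
  have "(\<lambda>w. h w + inverse (real (Suc i)) *\<^sub>R axis t 1) \<in> borel_measurable M" by measurable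
  then show "(\<lambda>w. (f (g w) (h w + inverse (real (Suc i)) *\<^sub>R axis t 1) - f (g w) (h w)) / inverse (real (Suc i)))
      \<in> borel_measurable M"
    by (intro borel_measurable_divide borel_measurable_diff f_measurable_compose assms borel_measurable_const)
qed

end

section \<open>Sigma-algebras generated by coordinates, and causality\<close>

lemma borel_measurable_vec_nth [measurable (raw)]:
  "g \<in> borel_measurable M \<Longrightarrow> (\<lambda>w. (g w :: real ^ 'n::finite) $ s) \<in> borel_measurable M"
  by (rule measurable_compose[OF _ borel_measurable_continuous_onI])
     (auto intro: continuous_on_component continuous_on_id)

lemma borel_measurable_vecI:
  fixes g :: "'a \<Rightarrow> real ^ 'n::finite"
  assumes "\<And>s. (\<lambda>w. g w $ s) \<in> borel_measurable M"
  shows "g \<in> borel_measurable M"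
  unfolding borel_measurable_euclidean_space[of g]
  using assms by (auto simp: Basis_vec_def inner_axis)

lemma integrable_mult_bounded:
  fixes g u :: "'a \<Rightarrow> real"
  assumes "integrable M g" and "u \<in> borel_measurable M" and "\<And>x. \<bar>u x\<bar> \<le> B"
  shows "integrable M (\<lambda>x. g x * u x)"
proof (rule Bochner_Integration.integrable_bound)
  show "integrable M (\<lambda>x. B * g x)" using assms(1) by simp
  have "0 \<le> B" using assms(3)[of undefined] by linarith
  then show "AE x in M. norm (g x * u x) \<le> norm (B * g x)"
    using assms(3) by (auto simp: abs_mult mult.commute[of B] intro!: mult_left_mono)
qed (use assms in measurable)

lemma space_generated_sigma [simp]: "space (generated_sigma Z I) = UNIV"
  by (simp add: generated_sigma_def)

lemma sets_generated_sigma: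
  "sets (generated_sigma Z I) = sigma_sets UNIV {(\<lambda>\<omega>. Z \<omega> $ s) -` A | s A. s \<in> I \<and> A \<in> sets borel}"
  by (simp add: generated_sigma_def)

lemma generated_sigma_coordinate:
  "s \<in> I \<Longrightarrow> (\<lambda>\<omega>. Z \<omega> $ s) \<in> borel_measurable (generated_sigma Z I)"
  by (rule measurableI) (auto simp: sets_generated_sigma)

lemma measurable_generated_sigma:
  assumes "\<And>s. s \<in> I \<Longrightarrow> (\<lambda>w. Z (g w) $ s) \<in> borel_measurable M"
  shows "g \<in> measurable M (generated_sigma Z I)"
  unfolding generated_sigma_def
proof (rule measurable_measure_of)
  fix B assume "B \<in> {(\<lambda>\<omega>. Z \<omega> $ s) -` A | s A. s \<in> I \<and> A \<in> sets borel}"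
  then obtain s A where "B = (\<lambda>\<omega>. Z \<omega> $ s) -` A" "s \<in> I" "A \<in> sets borel" by blast
  with measurable_sets[OF assms, of s A] show "g -` B \<inter> space M \<in> sets M"
    by (simp add: vimage_def)
qed auto

lemma subalgebra_generated_sigma:
  assumes "Z \<in> borel_measurable M" "space M = UNIV"
  shows "subalgebra M (generated_sigma Z I)"
proof -
  have "(\<lambda>x. x) \<in> measurable M (generated_sigma Z I)"
    using assms(1) by (intro measurable_generated_sigma borel_measurable_vec_nth)
  then show ?thesis
    using measurable_sets[of "\<lambda>x. x" M "generated_sigma Z I"] assms(2)
    by (auto simp: subalgebra_def)
qed

lemma subalgebra_generated_sigma_mono:
  "I \<subseteq> J \<Longrightarrow> subalgebra (generated_sigma Z J) (generated_sigma Z I)"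
  by (auto simp: subalgebra_def sets_generated_sigma intro!: sigma_sets_mono')

text \<open>The vector whose coordinates outside \<open>I\<close> are set to zero.\<close>

definition restrict_coords :: "'n set \<Rightarrow> real ^ 'n::finite \<Rightarrow> real ^ 'n" where
  "restrict_coords I x = (\<chi> s. if s \<in> I then x $ s else 0)"

lemma restrict_coords_nth [simp]: "restrict_coords I x $ s = (if s \<in> I then x $ s else 0)"
  by (simp add: restrict_coords_def)

lemma restrict_coords_measurable:
  "(\<lambda>\<omega>. restrict_coords I (Z \<omega>)) \<in> borel_measurable (generated_sigma Z I)"
proof (rule borel_measurable_vecI)
  show "(\<lambda>\<omega>. restrict_coords I (Z \<omega>) $ s) \<in> borel_measurable (generated_sigma Z I)" for s
    by (cases "s \<in> I") (simp_all add: generated_sigma_coordinate)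
qed

lemma adapted_measurable_generated_sigma:
  assumes "\<phi> \<in> borel_measurable borel" "\<And>x y. (\<And>s. s \<in> I \<Longrightarrow> x $ s = y $ s) \<Longrightarrow> \<phi> x = \<phi> y"
  shows "(\<lambda>\<omega>. \<phi> (Z \<omega>)) \<in> borel_measurable (generated_sigma Z I)"
proof -
  have "(\<lambda>\<omega>. \<phi> (Z \<omega>)) = (\<lambda>\<omega>. \<phi> (restrict_coords I (Z \<omega>)))"
    by (rule ext, rule assms(2)) simp
  then show ?thesis using measurable_compose[OF restrict_coords_measurable assms(1)] by simp
qed

text \<open>A function measurable with respect to the generated \<open>\<sigma>\<close>-algebra is a function of the generating
  coordinates.\<close>

lemma generated_sigma_factor:
  fixes h :: "'w \<Rightarrow> real"
  assumes "h \<in> borel_measurable (generated_sigma Z I)" and "\<And>s. s \<in> I \<Longrightarrow> Z \<omega> $ s = Z \<omega>' $ s"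
  shows "h \<omega> = h \<omega>'"
proof -
  have *: "\<omega> \<in> S \<longleftrightarrow> \<omega>' \<in> S" if "S \<in> sigma_sets UNIV {(\<lambda>\<omega>. Z \<omega> $ s) -` A | s A. s \<in> I \<and> A \<in> sets borel}" for S
    using that by induction (use assms(2) in auto)
  have "h -` {h \<omega>} \<in> sets (generated_sigma Z I)"
    using measurable_sets[OF assms(1), of "{h \<omega>}"] by simp
  with *[of "h -` {h \<omega>}"] show ?thesis by (simp add: sets_generated_sigma)
qed

lemma sets_generated_sigma_vimage:
  assumes "S \<in> sets (generated_sigma Z I)"
  obtains B where "B \<in> sets (generated_sigma (\<lambda>x. x) I)" "S = Z -` B"
proof -
  let ?g = "{(\<lambda>\<omega>. \<omega> $ s) -` A | s A. s \<in> I \<and> A \<in> sets (borel :: real measure)}"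
  have "(\<lambda>\<omega>. Z \<omega> $ s) -` A = Z -` ((\<lambda>\<omega>. \<omega> $ s) -` A)" for s A
    by (simp add: vimage_def)
  then have "{(\<lambda>\<omega>. Z \<omega> $ s) -` A | s A. s \<in> I \<and> A \<in> sets (borel :: real measure)}
      = {Z -` B \<inter> UNIV | B. B \<in> ?g}"
    by blast
  then have "S \<in> {Z -` B \<inter> UNIV | B. B \<in> sigma_sets UNIV ?g}"
    using assms unfolding sets_generated_sigma by (subst sigma_sets_vimage_commute) simp_all
  then obtain B where "B \<in> sigma_sets UNIV ?g" "S = Z -` B"
    by (elim CollectE exE conjE) (rule that, simp_all)
  then show ?thesis
    by (intro that[of B]) (simp_all add: sets_generated_sigma)
qed

lemma sets_generated_sigma_UNIV: "sets (generated_sigma (\<lambda>x. x) I) \<subseteq> sets borel"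
  using subalgebra_generated_sigma[of "\<lambda>x. x" borel I] by (simp add: subalgebra_def)

lemma path_event_measurable:
  assumes "A \<in> sets (\<Pi>\<^sub>M s\<in>I. (borel :: real measure))"
  shows "{\<omega>. (\<lambda>s\<in>I. Y \<omega> $ s) \<in> A} \<in> sets (generated_sigma Y I)"
proof -
  have "(\<lambda>\<omega>. \<lambda>s\<in>I. Y \<omega> $ s) \<in> measurable (generated_sigma Y I) (\<Pi>\<^sub>M s\<in>I. borel)"
    by (intro measurable_restrict generated_sigma_coordinate)
  from measurable_sets[OF this assms] show ?thesis by (simp add: vimage_def)
qed

lemma path_event_exists:
  fixes Y :: "'w \<Rightarrow> real ^ 'n::finite"
  assumes "E \<in> sets (generated_sigma Y I)"
  shows "\<exists>A\<in>sets (\<Pi>\<^sub>M s\<in>I. (borel :: real measure)). E = {\<omega>. (\<lambda>s\<in>I. Y \<omega> $ s) \<in> A}"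
proof -
  let ?M = "\<Pi>\<^sub>M s\<in>I. (borel :: real measure)"
  define r where "r \<omega> = (\<lambda>s\<in>I. Y \<omega> $ s)" for \<omega>
  have r_space: "r \<omega> \<in> space ?M" for \<omega> by (simp add: r_def space_PiM)
  have r_nth: "s \<in> I \<Longrightarrow> r \<omega> s = Y \<omega> $ s" for s \<omega> by (simp add: r_def)
  have "\<exists>A\<in>sets ?M. E = r -` A"
    using assms unfolding sets_generated_sigma
  proof induction
    case (Basic S)
    then obtain s A where S: "S = (\<lambda>\<omega>. Y \<omega> $ s) -` A" "s \<in> I" "A \<in> sets borel" by blast
    have "(\<lambda>x. x s) -` A \<inter> space ?M \<in> sets ?M"
      using S by (intro measurable_sets[of _ _ borel]) auto
    moreover have "S = r -` ((\<lambda>x. x s) -` A \<inter> space ?M)"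
      using S r_space r_nth by auto
    ultimately show ?case by blast
  next
    case Empty show ?case by (intro bexI[of _ "{}"]) auto
  next
    case (Compl S)
    then obtain A where "A \<in> sets ?M" "S = r -` A" by blast
    then show ?case
      using r_space by (intro bexI[of _ "space ?M - A"] sets.compl_sets) auto
  next
    case (Union S)
    then have "\<forall>i. \<exists>A. A \<in> sets ?M \<and> S i = r -` A" by blast
    from choice[OF this] obtain A where "\<forall>i. A i \<in> sets ?M \<and> S i = r -` A i" by blast
    then show ?case by (intro bexI[of _ "\<Union>i. A i"]) auto
  qed
  then show ?thesis by (simp add: r_def vimage_def)
qed

lemma causalD:
  assumes "causal \<pi> X Y" "E \<in> sets (generated_sigma Y {..t})"
  shows "AE \<omega> in \<pi>. cond_probability \<pi> (generated_sigma X UNIV) E \<omega>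
    = cond_probability \<pi> (generated_sigma X {..t}) E \<omega>"
  using assms path_event_exists[OF assms(2)] unfolding causal_def by blast

lemma causalI:
  assumes "\<And>t E. E \<in> sets (generated_sigma Y {..t}) \<Longrightarrow>
    AE \<omega> in \<pi>. cond_probability \<pi> (generated_sigma X UNIV) E \<omega>
      = cond_probability \<pi> (generated_sigma X {..t}) E \<omega>"
  shows "causal \<pi> X Y"
  unfolding causal_def using assms path_event_measurable by blast

text \<open>Two processes on a common probability space.  In the applications they are the projections of a coupling,
  in either order.\<close>

locale coupled_processes = prob_space \<pi> for \<pi> :: "'w measure" +
  fixes X Y :: "'w \<Rightarrow> real ^ 'n::{finite,linorder}"
  assumes space_eq: "space \<pi> = UNIV"
    and X [measurable]: "X \<in> borel_measurable \<pi>" and Y [measurable]: "Y \<in> borel_measurable \<pi>"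
begin

lemma cond_exp_X: "finite_measure_subalgebra \<pi> (generated_sigma X I)"
  by unfold_locales (rule subalgebra_generated_sigma[OF X space_eq])

lemma cond_exp_Y: "finite_measure_subalgebra \<pi> (generated_sigma Y I)"
  by unfold_locales (rule subalgebra_generated_sigma[OF Y space_eq])

lemma sets_X: "E \<in> sets (generated_sigma X I) \<Longrightarrow> E \<in> sets \<pi>"
  using subalgebra_generated_sigma[OF X space_eq, of I] by (auto simp: subalgebra_def)

lemma sets_Y: "E \<in> sets (generated_sigma Y I) \<Longrightarrow> E \<in> sets \<pi>"
  using subalgebra_generated_sigma[OF Y space_eq, of I] by (auto simp: subalgebra_def)

lemma causal_integral_event:
  assumes causal: "causal \<pi> X Y"
    and E: "E \<in> sets (generated_sigma Y {..t})"
    and g: "g \<in> borel_measurable (generated_sigma X UNIV)" "integrable \<pi> g"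
  shows "(\<integral>\<omega>. g \<omega> * indicator E \<omega> \<partial>\<pi>)
    = (\<integral>\<omega>. real_cond_exp \<pi> (generated_sigma X {..t}) g \<omega> * indicator E \<omega> \<partial>\<pi>)"
proof -
  let ?F = "generated_sigma X UNIV" and ?G = "generated_sigma X {..t}"
  interpret F: finite_measure_subalgebra \<pi> ?F by (rule cond_exp_X)
  interpret G: finite_measure_subalgebra \<pi> ?G by (rule cond_exp_X)
  have E': "E \<in> sets \<pi>" by (rule sets_Y[OF E])
  note [measurable] = E'
  have [measurable]: "g \<in> borel_measurable \<pi>" using g(2) by simp
  have eq: "AE \<omega> in \<pi>. real_cond_exp \<pi> ?F (indicator E) \<omega> = real_cond_exp \<pi> ?G (indicator E) \<omega>"
    by (rule causalD[OF causal E])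
  have i1: "integrable \<pi> (\<lambda>\<omega>. g \<omega> * indicator E \<omega>)"
    using g(2) by (rule integrable_mult_bounded[where B = 1]) (auto split: split_indicator)
  have i2: "integrable \<pi> (\<lambda>\<omega>. real_cond_exp \<pi> ?G g \<omega> * indicator E \<omega>)"
    using G.real_cond_exp_int(1)[OF g(2)]
    by (rule integrable_mult_bounded[where B = 1]) (auto split: split_indicator)
  have i3: "integrable \<pi> (\<lambda>\<omega>. real_cond_exp \<pi> ?G (indicator E) \<omega> * g \<omega>)"
  proof (rule integrable_cong_AE_imp)
    show "integrable \<pi> (\<lambda>\<omega>. g \<omega> * real_cond_exp \<pi> ?F (indicator E) \<omega>)"
      using i1 g(1) by (intro F.real_cond_exp_intg(1)) auto
  qed (use eq in \<open>auto simp: mult.commute\<close>)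
  have "(\<integral>\<omega>. g \<omega> * indicator E \<omega> \<partial>\<pi>) = (\<integral>\<omega>. g \<omega> * real_cond_exp \<pi> ?F (indicator E) \<omega> \<partial>\<pi>)"
    using i1 g(1) by (intro F.real_cond_exp_intg(2)[symmetric]) auto
  also have "\<dots> = (\<integral>\<omega>. real_cond_exp \<pi> ?G (indicator E) \<omega> * g \<omega> \<partial>\<pi>)"
    using eq by (intro integral_cong_AE) auto
  also have "\<dots> = (\<integral>\<omega>. real_cond_exp \<pi> ?G (indicator E) \<omega> * real_cond_exp \<pi> ?G g \<omega> \<partial>\<pi>)"
    using i3 by (intro G.real_cond_exp_intg(2)[symmetric]) auto
  also have "\<dots> = (\<integral>\<omega>. real_cond_exp \<pi> ?G g \<omega> * real_cond_exp \<pi> ?G (indicator E) \<omega> \<partial>\<pi>)"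
    by (simp add: mult.commute)
  also have "\<dots> = (\<integral>\<omega>. real_cond_exp \<pi> ?G g \<omega> * indicator E \<omega> \<partial>\<pi>)"
    using i2 by (intro G.real_cond_exp_intg(2)) auto
  finally show ?thesis .
qed

text \<open>Causality in integrated form: against the past of \<open>Y\<close>, the past of \<open>X\<close> already determines
  the projection of any function of the whole path of \<open>X\<close>.\<close>

lemma causal_integral:
  assumes causal: "causal \<pi> X Y"
    and u: "u \<in> borel_measurable (generated_sigma Y {..t})"
    and g: "g \<in> borel_measurable (generated_sigma X UNIV)" "integrable \<pi> g"
    and gu: "integrable \<pi> (\<lambda>\<omega>. g \<omega> * u \<omega>)"
      "integrable \<pi> (\<lambda>\<omega>. real_cond_exp \<pi> (generated_sigma X {..t}) g \<omega> * u \<omega>)"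
  shows "(\<integral>\<omega>. g \<omega> * u \<omega> \<partial>\<pi>) = (\<integral>\<omega>. real_cond_exp \<pi> (generated_sigma X {..t}) g \<omega> * u \<omega> \<partial>\<pi>)"
proof -
  let ?G = "generated_sigma X {..t}" and ?H = "generated_sigma Y {..t}"
  interpret G: finite_measure_subalgebra \<pi> ?G by (rule cond_exp_X)
  interpret H: finite_measure_subalgebra \<pi> ?H by (rule cond_exp_Y)
  \<comment> \<open>The integral of \<open>?k\<close> over every event in the past of \<open>Y\<close> vanishes, hence so does its projection.\<close>
  let ?k = "\<lambda>\<omega>. g \<omega> - real_cond_exp \<pi> ?G g \<omega>"
  have ig: "integrable \<pi> (real_cond_exp \<pi> ?G g)" by (rule G.real_cond_exp_int(1)[OF g(2)])
  have k: "integrable \<pi> ?k" using g(2) ig by simp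
  have "AE \<omega> in \<pi>. real_cond_exp \<pi> ?H ?k \<omega> = 0"
  proof (rule H.real_cond_exp_charact)
    fix E assume E: "E \<in> sets ?H"
    have E': "E \<in> sets \<pi>" by (rule sets_Y[OF E])
    have "integrable \<pi> (\<lambda>\<omega>. g \<omega> * indicator E \<omega>)"
      "integrable \<pi> (\<lambda>\<omega>. real_cond_exp \<pi> ?G g \<omega> * indicator E \<omega>)"
      using E' g(2) ig by (auto intro!: integrable_mult_bounded[where B = 1] split: split_indicator)
    then show "(\<integral>\<omega>\<in>E. ?k \<omega> \<partial>\<pi>) = (\<integral>\<omega>\<in>E. 0 \<partial>\<pi>)"
      using causal_integral_event[OF causal E g]
      by (simp add: set_lebesgue_integral_def right_diff_distrib mult.commute[of "indicator E _"])
  qed (use k in auto)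
  then have "(\<integral>\<omega>. u \<omega> * real_cond_exp \<pi> ?H ?k \<omega> \<partial>\<pi>) = (\<integral>\<omega>. 0 \<partial>\<pi>)"
    using measurable_from_subalg[OF H.subalg u] by (intro integral_cong_AE) auto
  moreover have "(\<integral>\<omega>. u \<omega> * real_cond_exp \<pi> ?H ?k \<omega> \<partial>\<pi>) = (\<integral>\<omega>. u \<omega> * ?k \<omega> \<partial>\<pi>)"
    using gu k u by (intro H.real_cond_exp_intg(2)) (auto simp: right_diff_distrib mult.commute[of "u _"])
  moreover have "(\<integral>\<omega>. u \<omega> * ?k \<omega> \<partial>\<pi>)
      = (\<integral>\<omega>. g \<omega> * u \<omega> \<partial>\<pi>) - (\<integral>\<omega>. real_cond_exp \<pi> ?G g \<omega> * u \<omega> \<partial>\<pi>)"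
    using gu by (subst Bochner_Integration.integral_diff[symmetric]) (auto simp: right_diff_distrib mult.commute[of "u _"])
  ultimately show ?thesis by simp
qed

text \<open>Conditioning a function of \<open>X\<close> on coordinates of \<open>X\<close> may be carried out under the law of \<open>X\<close>.\<close>

lemma real_cond_exp_distr:
  assumes P: "distr \<pi> borel X = P" and g: "integrable P g"
  shows "AE \<omega> in \<pi>. real_cond_exp \<pi> (generated_sigma X I) (\<lambda>\<omega>. g (X \<omega>)) \<omega>
    = real_cond_exp P (generated_sigma (\<lambda>x. x) I) g (X \<omega>)"
proof -
  let ?G = "generated_sigma X I" and ?G' = "generated_sigma (\<lambda>x. x) I"
  interpret G: finite_measure_subalgebra \<pi> ?G by (rule cond_exp_X)
  interpret P: prob_space P using P prob_space_distr[OF X] by simp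
  have setsP: "sets P = sets borel" "space P = UNIV" using P by (auto simp: space_distr)
  interpret G': finite_measure_subalgebra P ?G'
    by unfold_locales (rule subalgebra_generated_sigma, use setsP in \<open>auto simp: measurable_cong_sets[OF setsP(1) refl]\<close>)
  have [measurable]: "g \<in> borel_measurable borel"
    using g setsP by (simp cong: measurable_cong_sets)
  let ?h = "real_cond_exp P ?G' g"
  have h: "integrable P ?h" by (rule G'.real_cond_exp_int(1)[OF g])
  have hG': "?h \<in> borel_measurable ?G'" by (rule borel_measurable_cond_exp)
  have [measurable]: "?h \<in> borel_measurable borel"
    using h setsP by (simp cong: measurable_cong_sets)
  have XG: "X \<in> measurable ?G ?G'"
    by (intro measurable_generated_sigma generated_sigma_coordinate)
  show ?thesis
  proof (rule G.real_cond_exp_charact)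
    fix A assume "A \<in> sets ?G"
    then obtain B where B: "B \<in> sets ?G'" "A = X -` B"
      by (rule sets_generated_sigma_vimage)
    have [measurable]: "B \<in> sets borel" using B(1) sets_generated_sigma_UNIV by blast
    have [simp]: "indicator (X -` B) \<omega> = (indicator B (X \<omega>) :: real)" for \<omega>
      by (simp add: indicator_def)
    have "(\<integral>\<omega>\<in>A. g (X \<omega>) \<partial>\<pi>) = (\<integral>x\<in>B. g x \<partial>P)"
      unfolding set_lebesgue_integral_def B(2) P[symmetric]
      by (subst integral_distr[OF X]) auto
    also have "\<dots> = (\<integral>x\<in>B. ?h x \<partial>P)"
      by (rule G'.real_cond_exp_intA[OF g B(1)])
    also have "\<dots> = (\<integral>\<omega>\<in>A. ?h (X \<omega>) \<partial>\<pi>)"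
      unfolding set_lebesgue_integral_def B(2)
      using integral_distr[OF X, of "\<lambda>x. indicator B x *\<^sub>R ?h x"] P by simp
    finally show "(\<integral>\<omega>\<in>A. g (X \<omega>) \<partial>\<pi>) = (\<integral>\<omega>\<in>A. ?h (X \<omega>) \<partial>\<pi>)" .
  next
    show "integrable \<pi> (\<lambda>\<omega>. g (X \<omega>))" using g P integrable_distr_eq[OF X, of g] by auto
    show "integrable \<pi> (\<lambda>\<omega>. ?h (X \<omega>))" using h P integrable_distr_eq[OF X, of ?h] by auto
    show "(\<lambda>\<omega>. ?h (X \<omega>)) \<in> borel_measurable ?G" by (rule measurable_compose[OF XG hG'])
  qed
qed

text \<open>If the past of \<open>Y\<close> is contained in the past of \<open>X\<close> up to null sets, both conditional
  probabilities in the definition of causality are indicators.\<close>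

lemma causal_of_adapted:
  assumes "\<And>t E. E \<in> sets (generated_sigma Y {..t}) \<Longrightarrow>
    \<exists>E'\<in>sets (generated_sigma X {..t}). AE \<omega> in \<pi>. \<omega> \<in> E \<longleftrightarrow> \<omega> \<in> E'"
  shows "causal \<pi> X Y"
proof (rule causalI)
  fix t E assume E: "E \<in> sets (generated_sigma Y {..t})"
  obtain E' where E': "E' \<in> sets (generated_sigma X {..t})" "AE \<omega> in \<pi>. \<omega> \<in> E \<longleftrightarrow> \<omega> \<in> E'"
    using assms[OF E] by blast
  note [measurable] = sets_Y[OF E] sets_X[OF E'(1)]
  have "AE \<omega> in \<pi>. real_cond_exp \<pi> (generated_sigma X J) (indicator E) \<omega> = indicator E' \<omega>"
    if "{..t} \<subseteq> J" for J
  proof -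
    interpret F: finite_measure_subalgebra \<pi> "generated_sigma X J" by (rule cond_exp_X)
    have "E' \<in> sets (generated_sigma X J)"
      using E'(1) subalgebra_generated_sigma_mono[OF that, of X] by (auto simp: subalgebra_def)
    then have "AE \<omega> in \<pi>. real_cond_exp \<pi> (generated_sigma X J) (indicator E') \<omega> = indicator E' \<omega>"
      by (intro F.real_cond_exp_F_meas) (auto simp: less_top[symmetric])
    moreover have "AE \<omega> in \<pi>. real_cond_exp \<pi> (generated_sigma X J) (indicator E) \<omega>
        = real_cond_exp \<pi> (generated_sigma X J) (indicator E') \<omega>"
      using E'(2) by (intro F.real_cond_exp_cong) (auto simp: indicator_def)
    ultimately show ?thesis by auto
  qed
  from this[of UNIV] this[of "{..t}"]
  show "AE \<omega> in \<pi>. real_cond_exp \<pi> (generated_sigma X UNIV) (indicator E) \<omega>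
      = real_cond_exp \<pi> (generated_sigma X {..t}) (indicator E) \<omega>"
    by auto
qed

lemma causal_of_independent:
  assumes "\<And>A E. A \<in> sets (generated_sigma X UNIV) \<Longrightarrow> E \<in> sets (generated_sigma Y UNIV) \<Longrightarrow>
    prob (A \<inter> E) = prob A * prob E"
  shows "causal \<pi> X Y"
proof (rule causalI)
  fix t E assume E: "E \<in> sets (generated_sigma Y {..t})"
  then have E': "E \<in> sets (generated_sigma Y UNIV)"
    using subalgebra_generated_sigma_mono[of "{..t}" UNIV Y] by (auto simp: subalgebra_def)
  note [measurable] = sets_Y[OF E]
  have "AE \<omega> in \<pi>. real_cond_exp \<pi> (generated_sigma X J) (indicator E) \<omega> = prob E" for J
  proof -
    interpret F: finite_measure_subalgebra \<pi> "generated_sigma X J" by (rule cond_exp_X)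
    show ?thesis
    proof (rule F.real_cond_exp_charact)
      fix A assume A: "A \<in> sets (generated_sigma X J)"
      then have A': "A \<in> sets (generated_sigma X UNIV)"
        using subalgebra_generated_sigma_mono[of J UNIV X] by (auto simp: subalgebra_def)
      note [measurable] = sets_X[OF A]
      have "(\<integral>\<omega>\<in>A. indicator E \<omega> \<partial>\<pi>) = (\<integral>\<omega>. indicator (A \<inter> E) \<omega> \<partial>\<pi>)"
        unfolding set_lebesgue_integral_def
        by (intro Bochner_Integration.integral_cong) (auto split: split_indicator)
      also have "\<dots> = prob (A \<inter> E)" by simp
      also have "\<dots> = (\<integral>\<omega>\<in>A. prob E \<partial>\<pi>)"
        using assms[OF A' E'] by (simp add: set_lebesgue_integral_def)
      finally show "(\<integral>\<omega>\<in>A. indicator E \<omega> \<partial>\<pi>) = (\<integral>\<omega>\<in>A. prob E \<partial>\<pi>)" .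
    qed (auto simp: less_top[symmetric])
  qed
  from this[of UNIV] this[of "{..t}"]
  show "AE \<omega> in \<pi>. real_cond_exp \<pi> (generated_sigma X UNIV) (indicator E) \<omega>
      = real_cond_exp \<pi> (generated_sigma X {..t}) (indicator E) \<omega>"
    by auto
qed

end

section \<open>The optimal control\<close>

lemma AE_tendsto_zero_of_summable:
  fixes g :: "nat \<Rightarrow> 'a \<Rightarrow> real"
  assumes int: "\<And>n. integrable M (g n)" and pos: "\<And>n x. 0 \<le> g n x"
    and sum: "summable (\<lambda>n. \<integral>x. g n x \<partial>M)"
  shows "AE x in M. (\<lambda>n. g n x) \<longlonglongrightarrow> 0"
proof -
  have [measurable]: "g n \<in> borel_measurable M" for n using int by simp
  have "(\<integral>\<^sup>+x. (\<Sum>n. ennreal (g n x)) \<partial>M) = (\<Sum>n. \<integral>\<^sup>+x. ennreal (g n x) \<partial>M)"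
    by (rule nn_integral_suminf) measurable
  also have "\<dots> = (\<Sum>n. ennreal (\<integral>x. g n x \<partial>M))"
    by (intro suminf_cong nn_integral_eq_integral int) (simp add: pos)
  also have "\<dots> = ennreal (\<Sum>n. \<integral>x. g n x \<partial>M)"
    using pos by (intro suminf_ennreal2 sum integral_nonneg_AE) auto
  finally have "(\<integral>\<^sup>+x. (\<Sum>n. ennreal (g n x)) \<partial>M) \<noteq> \<infinity>" by simp
  then have "AE x in M. (\<Sum>n. ennreal (g n x)) \<noteq> \<infinity>"
    by (intro nn_integral_PInf_AE) auto
  then show ?thesis
  proof eventually_elim
    case (elim x)
    then have "summable (\<lambda>n. g n x)" using pos by (intro summable_suminf_not_top) (auto simp: top_unique)
    then show ?case by (rule summable_LIMSEQ_zero)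
  qed
qed

lemma controls_measurable:
  assumes "a \<in> controls L" shows "a \<in> borel_measurable borel"
  using assms by (intro borel_measurable_vecI) (simp add: controls_def)

lemma controls_adapted:
  assumes "a \<in> controls L" "\<And>s. s < t \<Longrightarrow> x $ s = y $ s" shows "a x $ t = a y $ t"
  using assms by (simp add: controls_def)

lemma controls_box:
  assumes "a \<in> controls L" shows "a x \<in> control_box L"
  using assms by (simp add: controls_def control_box_def abs_le_iff minus_le_iff)

lemma controls_midpoint:
  assumes "a \<in> controls L" "b \<in> controls L"
  shows "(\<lambda>x. (1/2) *\<^sub>R (a x + b x)) \<in> controls L"
proof -
  have *: "\<bar>a x $ t\<bar> \<le> L" "\<bar>b x $ t\<bar> \<le> L" for x t
    using assms by (auto simp: controls_def)
  have "\<bar>(a x $ t + b x $ t) / 2\<bar> \<le> L" for x t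
    using *[of x t] by (simp add: abs_le_iff field_simps)
  moreover have "(\<lambda>x. a x $ t) \<in> borel_measurable borel" "(\<lambda>x. b x $ t) \<in> borel_measurable borel" for t
    using assms by (auto simp: controls_def)
  moreover have "((1/2) *\<^sub>R (a x + b x)) $ t = ((1/2) *\<^sub>R (a y + b y)) $ t" if "\<forall>s<t. x $ s = y $ s" for x y t
  proof -
    have "a x $ t = a y $ t" "b x $ t = b y $ t" using assms that by (auto simp: controls_def)
    then show ?thesis by simp
  qed
  ultimately show ?thesis
    unfolding controls_def by simp
qed

context control_problem
begin

lemma prob_P: "prob_space P" and sets_P: "sets P = sets borel"
  and moment_P: "integrable P (\<lambda>x. norm x powr p)"
  using P by (auto simp: finite_moment_measures_def)

lemma space_P: "space P = UNIV"
  using sets_eq_imp_space_eq[OF sets_P] by simp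

lemma measurable_P: "borel_measurable P = borel_measurable borel"
  by (rule measurable_cong_sets[OF sets_P refl])

lemma zero_control: "(\<lambda>_. 0) \<in> controls L"
  using L by (simp add: controls_def)

lemma integrable_cost:
  assumes "finite_measure M" and [measurable]: "X \<in> borel_measurable M" "A \<in> borel_measurable M"
    and moment: "integrable M (\<lambda>w. norm (X w) powr p)" and box: "\<And>w. A w \<in> control_box L"
  shows "integrable M (\<lambda>w. f (X w) (A w))"
proof -
  interpret finite_measure M by fact
  obtain C where C: "C > 0" "\<And>x a. a \<in> control_box L \<Longrightarrow> \<bar>f x a\<bar> \<le> C * (1 + norm x powr p)"
    using f_bound by blast
  show ?thesis
  proof (rule Bochner_Integration.integrable_bound)
    show "integrable M (\<lambda>w. C * (1 + norm (X w) powr p))" using moment by simp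
    show "AE w in M. norm (f (X w) (A w)) \<le> norm (C * (1 + norm (X w) powr p))"
      using C(2)[OF box] C(1) by (auto intro: order_trans[OF _ abs_ge_self])
  qed measurable
qed

lemma integrable_cost_control:
  assumes "Q \<in> finite_moment_measures p" "a \<in> controls L"
  shows "integrable Q (\<lambda>x. f x (a x))"
proof (rule integrable_cost)
  have Q: "prob_space Q" "sets Q = sets borel" "integrable Q (\<lambda>x. norm x powr p)"
    using assms(1) by (auto simp: finite_moment_measures_def)
  show "finite_measure Q" using Q(1) by (rule prob_space.finite_measure)
  have "(\<lambda>x. x) \<in> borel_measurable borel" by simp
  then show "a \<in> borel_measurable Q" "(\<lambda>x. x) \<in> borel_measurable Q"
    using controls_measurable[OF assms(2)] by (simp_all add: measurable_cong_sets[OF Q(2) refl])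
qed (use assms in \<open>auto simp: finite_moment_measures_def controls_box\<close>)

lemma bdd_below_cost:
  assumes "Q \<in> finite_moment_measures p"
  shows "bdd_below ((\<lambda>a. \<integral>x. f x (a x) \<partial>Q) ` controls L)"
proof -
  have Q: "prob_space Q" "integrable Q (\<lambda>x. norm x powr p)"
    using assms by (auto simp: finite_moment_measures_def)
  interpret Q: prob_space Q by fact
  obtain C where C: "C > 0" "\<And>x a. a \<in> control_box L \<Longrightarrow> \<bar>f x a\<bar> \<le> C * (1 + norm x powr p)"
    using f_bound by blast
  have "(\<integral>x. - (C * (1 + norm x powr p)) \<partial>Q) \<le> (\<integral>x. f x (a x) \<partial>Q)" if a: "a \<in> controls L" for a
    using Q(2) integrable_cost_control[OF assms a] C(2)[OF controls_box[OF a]]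
    by (intro integral_mono) (auto simp: abs_le_iff minus_le_iff)
  then show ?thesis by (auto simp: bdd_below_def)
qed

lemma control_value_le:
  assumes "Q \<in> finite_moment_measures p" "a \<in> controls L"
  shows "control_value f L Q \<le> (\<integral>x. f x (a x) \<partial>Q)"
  unfolding control_value_def by (rule cINF_lower[OF bdd_below_cost]) (use assms in auto)

lemma control_value_approx:
  assumes "0 < e"
  obtains a where "a \<in> controls L" "(\<integral>x. f x (a x) \<partial>Q) < control_value f L Q + e"
proof -
  have "\<exists>y\<in>(\<lambda>a. \<integral>x. f x (a x) \<partial>Q) ` controls L. y < control_value f L Q + e"
    unfolding control_value_def
    by (rule cInf_lessD) (use zero_control assms in auto)
  then show ?thesis using that by auto
qed

text \<open>The strong convexity constant, truncated so as to be integrable.\<close>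

definition weight :: "(real, 'n) vec \<Rightarrow> real" where
  "weight x = min 1 (max 0 (\<epsilon> x))"

lemma weight: "0 \<le> weight x" "weight x \<le> 1"
  by (auto simp: weight_def)

lemma weight_measurable [measurable]: "weight \<in> borel_measurable borel"
  unfolding weight_def using eps_borel by measurable

lemma AE_eps_pos: "AE x in P. 0 < \<epsilon> x"
proof -
  interpret prob_space P by (rule prob_P)
  have "{x. 0 < \<epsilon> x} \<in> sets P" using eps_borel sets_P by simp
  from prob_eq_1[OF this] eps_pos show ?thesis by simp
qed

lemma integrable_weight:
  assumes "a \<in> controls L" "b \<in> controls L"
  shows "integrable P (\<lambda>x. weight x * (norm (a x - b x))\<^sup>2)"
proof -
  interpret prob_space P by (rule prob_P)
  have "bounded (control_box L :: (real, 'n) vec set)"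
    by (rule compact_imp_bounded[OF compact_control_box])
  then obtain B where B: "\<And>a. a \<in> control_box L \<Longrightarrow> norm (a :: (real, 'n) vec) \<le> B"
    unfolding bounded_iff by blast
  have [measurable]: "a \<in> borel_measurable P" "b \<in> borel_measurable P"
    using assms controls_measurable by (auto simp: measurable_P)
  show ?thesis
  proof (rule integrable_const_bound)
    show "AE x in P. norm (weight x * (norm (a x - b x))\<^sup>2) \<le> 1 * (2 * B)\<^sup>2"
    proof (rule AE_I2)
      fix x
      have "norm (a x - b x) \<le> 2 * B"
        using norm_triangle_ineq4[of "a x" "b x"] B[OF controls_box[OF assms(1), of x]] B[OF controls_box[OF assms(2), of x]]
        by linarith
      then show "norm (weight x * (norm (a x - b x))\<^sup>2) \<le> 1 * (2 * B)\<^sup>2"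
        unfolding norm_mult norm_power using weight[of x] by (intro mult_mono power_mono) auto
    qed
    show "(\<lambda>x. weight x * (norm (a x - b x))\<^sup>2) \<in> borel_measurable P"
      using weight_measurable by (simp add: measurable_P[symmetric])
  qed
qed

text \<open>The midpoint of two nearly optimal controls is admissible, so strong convexity forces them to be
  close to each other.\<close>

lemma weighted_distance_le:
  assumes a: "a \<in> controls L" and b: "b \<in> controls L"
  shows "(\<integral>x. weight x * (norm (a x - b x))\<^sup>2 \<partial>P)
    \<le> 4 * ((\<integral>x. f x (a x) \<partial>P) - control_value f L P + ((\<integral>x. f x (b x) \<partial>P) - control_value f L P))"
proof -
  let ?m = "\<lambda>x. (1/2) *\<^sub>R (a x + b x)"
  note ia = integrable_cost_control[OF P a] and ib = integrable_cost_control[OF P b]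
  note iw = integrable_weight[OF a b]
  have "control_value f L P \<le> (\<integral>x. f x (?m x) \<partial>P)"
    by (rule control_value_le[OF P controls_midpoint[OF a b]])
  also have "\<dots> \<le> (\<integral>x. (f x (a x) + f x (b x)) / 2 - 1/8 * (weight x * (norm (a x - b x))\<^sup>2) \<partial>P)"
  proof (rule integral_mono_AE)
    show "AE x in P. f x (?m x) \<le> (f x (a x) + f x (b x)) / 2 - 1/8 * (weight x * (norm (a x - b x))\<^sup>2)"
      using AE_eps_pos
    proof eventually_elim
      case (elim x)
      have "f x (?m x) \<le> (f x (a x) + f x (b x)) / 2 - \<epsilon> x / 8 * (norm (a x - b x))\<^sup>2"
        by (rule strongly_convex_midpoint[OF C2 strongly_convex]) (use controls_box a b in auto)
      moreover have "weight x * (norm (a x - b x))\<^sup>2 \<le> \<epsilon> x * (norm (a x - b x))\<^sup>2"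
        using elim by (intro mult_right_mono) (auto simp: weight_def)
      ultimately show ?case by simp
    qed
  qed (use integrable_cost_control[OF P controls_midpoint[OF a b]] ia ib iw in auto)
  also have "\<dots> = ((\<integral>x. f x (a x) \<partial>P) + (\<integral>x. f x (b x) \<partial>P)) / 2
      - 1/8 * (\<integral>x. weight x * (norm (a x - b x))\<^sup>2 \<partial>P)"
    using ia ib iw by simp
  finally show ?thesis by (simp add: field_simps)
qed

lemma cost_tendsto:
  assumes a: "\<And>n. a n \<in> controls L" and b: "b \<in> controls L"
    and lim: "AE x in P. (\<lambda>n. a n x) \<longlonglongrightarrow> b x"
  shows "(\<lambda>n. \<integral>x. f x (a n x) \<partial>P) \<longlonglongrightarrow> (\<integral>x. f x (b x) \<partial>P)"
proof -
  interpret prob_space P by (rule prob_P)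
  obtain C where C: "C > 0" "\<And>x a. a \<in> control_box L \<Longrightarrow> \<bar>f x a\<bar> \<le> C * (1 + norm x powr p)"
    using f_bound by blast
  show ?thesis
  proof (rule integral_dominated_convergence)
    show "integrable P (\<lambda>x. C * (1 + norm x powr p))" using moment_P by simp
    show "AE x in P. norm (f x (a n x)) \<le> C * (1 + norm x powr p)" for n
      using C(2) controls_box[OF a] by auto
    show "AE x in P. (\<lambda>n. f x (a n x)) \<longlonglongrightarrow> f x (b x)"
      using lim
    proof eventually_elim
      case (elim x)
      have "isCont (f x) (b x)" using continuous_f by (simp add: continuous_on_eq_continuous_at)
      then show ?case using elim by (rule isCont_tendsto_compose)
    qed
  qed (use integrable_cost_control[OF P] a b in auto)
qed

text \<open>Strong convexity makes a sufficiently fast minimising sequence converge almost surely, so no weak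
  compactness is needed.\<close>

lemma exists_optimal_control: "\<exists>a\<in>controls L. control_value f L P = (\<integral>x. f x (a x) \<partial>P)"
proof -
  let ?v = "control_value f L P"
  have "\<exists>a. a \<in> controls L \<and> (\<integral>x. f x (a x) \<partial>P) < ?v + (1/16) ^ n" for n
    using control_value_approx[of "(1/16) ^ n" P] by auto
  then obtain a where a: "\<And>n. a n \<in> controls L" "\<And>n. (\<integral>x. f x (a n x) \<partial>P) < ?v + (1/16) ^ n"
    by metis
  \<comment> \<open>The distances decay geometrically, so that the sequence converges almost surely.\<close>
  let ?g = "\<lambda>n x. 4 ^ n * (weight x * (norm (a (Suc n) x - a n x))\<^sup>2)"
  have ig: "integrable P (?g n)" for n
    using integrable_weight[OF a(1) a(1)] by simp
  have gpos: "0 \<le> (\<integral>x. ?g n x \<partial>P)" for n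
    by (intro integral_nonneg_AE AE_I2 mult_nonneg_nonneg weight(1)) auto
  have gle: "(\<integral>x. ?g n x \<partial>P) \<le> 8 * (1/4) ^ n" for n
  proof -
    have "(\<integral>x. weight x * (norm (a (Suc n) x - a n x))\<^sup>2 \<partial>P) \<le> 4 * ((1/16) ^ Suc n + (1/16) ^ n)"
      using weighted_distance_le[OF a(1) a(1), of "Suc n" n] a(2)[of n] a(2)[of "Suc n"] by simp
    also have "\<dots> \<le> 8 * (1/16) ^ n" by simp
    finally have "4 ^ n * (\<integral>x. weight x * (norm (a (Suc n) x - a n x))\<^sup>2 \<partial>P) \<le> 4 ^ n * (8 * (1/16) ^ n)"
      by (rule mult_left_mono) simp
    also have "\<dots> = 8 * (4 * (1/16)) ^ n" by (simp only: power_mult_distrib mult_ac)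
    finally show ?thesis by simp
  qed
  have "summable (\<lambda>n. 8 * (1/4) ^ n :: real)"
    by (intro summable_mult summable_geometric) simp
  then have "summable (\<lambda>n. \<integral>x. ?g n x \<partial>P)"
    by (rule summable_comparison_test'[where N = 0]) (use gpos gle in \<open>simp only: real_norm_def abs_of_nonneg\<close>)
  then have "AE x in P. (\<lambda>n. ?g n x) \<longlonglongrightarrow> 0"
    using weight(1) by (intro AE_tendsto_zero_of_summable ig) auto
  then have conv: "AE x in P. \<forall>t. convergent (\<lambda>n. a n x $ t)"
    using AE_eps_pos
  proof eventually_elim
    case (elim x)
    then have w: "weight x > 0" by (simp add: weight_def)
    have "\<forall>\<^sub>F n in sequentially. ?g n x < weight x"
      using order_tendstoD(2)[OF elim(1) w] .
    then obtain N where N: "\<And>n. n \<ge> N \<Longrightarrow> ?g n x < weight x"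
      by (auto simp: eventually_sequentially)
    have dist: "norm (a (Suc n) x - a n x) \<le> (1/2) ^ n" if "n \<ge> N" for n
    proof -
      have "weight x * (4 ^ n * (norm (a (Suc n) x - a n x))\<^sup>2) < weight x * 1"
        using N[OF that] by (simp add: mult_ac)
      then have "4 ^ n * (norm (a (Suc n) x - a n x))\<^sup>2 < 1"
        using w by simp
      moreover have "4 ^ n * (norm (a (Suc n) x - a n x))\<^sup>2 = (2 ^ n * norm (a (Suc n) x - a n x))\<^sup>2"
        by (simp add: power2_eq_square mult_ac flip: power_mult_distrib)
      ultimately have "(2 ^ n * norm (a (Suc n) x - a n x))\<^sup>2 < 1\<^sup>2" by simp
      then have "2 ^ n * norm (a (Suc n) x - a n x) < 1"
        by (rule power2_less_imp_less) simp
      then show ?thesis by (simp add: power_one_over field_simps)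
    qed
    show ?case
    proof
      fix t
      have sg: "summable (\<lambda>n. (1/2) ^ n :: real)" by (rule summable_geometric) simp
      have "norm (a (Suc n) x $ t - a n x $ t) \<le> (1/2) ^ n" if "n \<ge> N" for n
        using dist[OF that] component_le_norm_cart[of "a (Suc n) x - a n x" t] by simp
      then have "summable (\<lambda>n. a (Suc n) x $ t - a n x $ t)"
        by (rule summable_comparison_test'[OF sg])
      then have "convergent (\<lambda>n. \<Sum>k<n. a (Suc k) x $ t - a k x $ t)"
        by (simp add: summable_iff_convergent)
      then have "convergent (\<lambda>n. a n x $ t - a 0 x $ t)"
        by (simp add: sum_lessThan_telescope[of "\<lambda>n. a n x $ t"])
      from convergent_add[OF this convergent_const[of "a 0 x $ t"]]
      show "convergent (\<lambda>n. a n x $ t)" by simp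
    qed
  qed
  \<comment> \<open>The limit is taken in each coordinate separately, so that it remains predictable; clamping bounds the
    unspecified value of \<^const>\<open>lim\<close> where the sequence diverges.\<close>
  define b where "b x = (\<chi> t. max (- L) (min L (lim (\<lambda>n. a n x $ t))))" for x
  have b: "b \<in> controls L"
  proof -
    have "(\<lambda>x. b x $ t) \<in> borel_measurable borel" for t
    proof -
      have [measurable]: "\<And>n. (\<lambda>x. a n x $ t) \<in> borel_measurable borel" using a(1) by (auto simp: controls_def)
      have "(\<lambda>x. lim (\<lambda>n. a n x $ t)) \<in> borel_measurable borel" by measurable
      then show ?thesis by (simp add: b_def)
    qed
    moreover have "b x $ t = b y $ t" if "\<forall>s<t. x $ s = y $ s" for x y t
    proof -
      have "a n x $ t = a n y $ t" for n using a(1)[of n] that by (auto simp: controls_def)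
      then show ?thesis by (simp add: b_def)
    qed
    moreover have "\<bar>b x $ t\<bar> \<le> L" for x t using L by (simp add: b_def abs_le_iff)
    ultimately show ?thesis by (auto simp: controls_def)
  qed
  have lim: "AE x in P. (\<lambda>n. a n x) \<longlonglongrightarrow> b x"
    using conv
  proof eventually_elim
    case (elim x)
    have "(\<lambda>n. a n x $ t) \<longlonglongrightarrow> b x $ t" for t
    proof -
      have lim: "(\<lambda>n. a n x $ t) \<longlonglongrightarrow> lim (\<lambda>n. a n x $ t)" using elim by (simp add: convergent_LIMSEQ_iff)
      have *: "- L \<le> a n x $ t" "a n x $ t \<le> L" for n using controls_box[OF a(1), of n x] by (auto simp: control_box_def)
      have "- L \<le> lim (\<lambda>n. a n x $ t)" "lim (\<lambda>n. a n x $ t) \<le> L"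
        using LIMSEQ_le_const[OF lim, of "- L"] LIMSEQ_le_const2[OF lim, of L] * by auto
      then show ?thesis using lim by (simp add: b_def)
    qed
    then show ?case by (rule vec_tendstoI)
  qed
  have "(\<lambda>n. \<integral>x. f x (a n x) \<partial>P) \<longlonglongrightarrow> (\<integral>x. f x (b x) \<partial>P)"
    by (rule cost_tendsto[OF a(1) b lim])
  moreover have "(\<lambda>n. ?v + (1/16) ^ n) \<longlonglongrightarrow> ?v + 0"
    by (intro tendsto_intros LIMSEQ_power_zero) simp
  ultimately have "(\<integral>x. f x (b x) \<partial>P) \<le> ?v + 0"
    using a(2) by (intro LIMSEQ_le[where X = "\<lambda>n. \<integral>x. f x (a n x) \<partial>P"]) (auto intro: less_imp_le)
  then show ?thesis using b control_value_le[OF P b] by (intro bexI[of _ b]) auto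
qed

lemma tendsto_of_weighted_distance:
  assumes "(\<lambda>n. weight x * (norm (b n - a))\<^sup>2) \<longlonglongrightarrow> 0" "0 < \<epsilon> x"
  shows "b \<longlonglongrightarrow> (a :: (real, 'n) vec)"
proof -
  have w: "weight x > 0" using assms(2) by (simp add: weight_def)
  have "(\<lambda>n. sqrt (inverse (weight x) * (weight x * (norm (b n - a))\<^sup>2))) \<longlonglongrightarrow> sqrt (inverse (weight x) * 0)"
    by (intro tendsto_intros assms(1))
  moreover have "inverse (weight x) * (weight x * (norm (b n - a))\<^sup>2) = (norm (b n - a))\<^sup>2" for n
    using w by simp
  ultimately have "(\<lambda>n. norm (b n - a)) \<longlonglongrightarrow> 0" by simp
  then show ?thesis by (simp add: tendsto_norm_zero_iff LIM_zero_iff)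
qed

lemma optimal_control_unique:
  assumes "a \<in> controls L" "b \<in> controls L"
    and "control_value f L P = (\<integral>x. f x (a x) \<partial>P)" "control_value f L P = (\<integral>x. f x (b x) \<partial>P)"
  shows "AE x in P. b x = a x"
proof -
  have "(\<integral>x. weight x * (norm (b x - a x))\<^sup>2 \<partial>P) \<le> 0"
    using weighted_distance_le[OF assms(2,1)] assms(3,4) by simp
  moreover have "(\<integral>x. weight x * (norm (b x - a x))\<^sup>2 \<partial>P) \<ge> 0"
    using weight(1) by (intro integral_nonneg_AE) auto
  ultimately have "(\<integral>x. weight x * (norm (b x - a x))\<^sup>2 \<partial>P) = 0" by simp
  then have "AE x in P. weight x * (norm (b x - a x))\<^sup>2 = 0"
    using weight(1) by (subst (asm) integral_nonneg_eq_0_iff_AE[OF integrable_weight[OF assms(2,1)]]) auto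
  then show ?thesis using AE_eps_pos
    by eventually_elim (auto simp: weight_def min_def max_def split: if_splits)
qed

lemma integrable_growth: "integrable P (\<lambda>x. C * (1 + norm x powr (p - 1)))"
proof -
  interpret prob_space P by (rule prob_P)
  have "integrable P (\<lambda>x. norm x powr (p - 1))"
  proof (rule Bochner_Integration.integrable_bound)
    show "integrable P (\<lambda>x. 1 + norm x powr p)" using moment_P by simp
    show "AE x in P. norm (norm x powr (p - 1)) \<le> norm (1 + norm x powr p)"
      using p by (auto intro!: powr_le_one_plus)
  qed (simp add: measurable_P)
  then show ?thesis by simp
qed

lemma integrable_grad_x:
  assumes "b \<in> controls L" and [measurable]: "Z \<in> borel_measurable borel" and "\<And>x. norm (Z x) \<le> B"
  shows "integrable P (\<lambda>x. grad_x x (b x) \<bullet> Z x)"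
proof -
  obtain C where C: "C > 0" "\<And>x a. a \<in> control_box L \<Longrightarrow> norm (grad_x x a) \<le> C * (1 + norm x powr (p - 1))"
    using grad_x_bound by blast
  have [measurable]: "b \<in> borel_measurable borel" by (rule controls_measurable[OF assms(1)])
  show ?thesis
  proof (rule Bochner_Integration.integrable_bound)
    show "integrable P (\<lambda>x. (C * (1 + norm x powr (p - 1))) * B)"
      by (intro integrable_mult_left integrable_growth)
    have "norm (grad_x x (b x) \<bullet> Z x) \<le> (C * (1 + norm x powr (p - 1))) * B" for x
      using C(2)[OF controls_box[OF assms(1), of x]] assms(3)[of x] C(1)
      by (intro order_trans[OF Cauchy_Schwarz_ineq2[folded real_norm_def]] mult_mono) auto
    then show "AE x in P. norm (grad_x x (b x) \<bullet> Z x) \<le> norm ((C * (1 + norm x powr (p - 1))) * B)"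
      by (auto intro: order_trans[OF _ abs_ge_self])
  qed (simp add: measurable_P)
qed

text \<open>Nearly optimal controls are close to the optimal one in probability, hence yield nearly the same first-order
  term in any bounded direction.\<close>

lemma gradient_stability:
  assumes a: "a \<in> controls L" "control_value f L P = (\<integral>x. f x (a x) \<partial>P)"
    and Z [measurable]: "Z \<in> borel_measurable borel" and ZB: "\<And>x. norm (Z x) \<le> B"
    and \<eta>: "0 < \<eta>"
  shows "\<exists>\<delta>>0. \<forall>b\<in>controls L. (\<integral>x. f x (b x) \<partial>P) \<le> control_value f L P + \<delta> \<longrightarrow>
    (\<integral>x. grad_x x (a x) \<bullet> Z x \<partial>P) - \<eta> \<le> (\<integral>x. grad_x x (b x) \<bullet> Z x \<partial>P)"
proof (rule ccontr)
  let ?v = "control_value f L P"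
  assume neg: "\<not> ?thesis"
  have "\<exists>b. b \<in> controls L \<and> (\<integral>x. f x (b x) \<partial>P) \<le> ?v + (1/2) ^ n \<and>
     \<not> (\<integral>x. grad_x x (a x) \<bullet> Z x \<partial>P) - \<eta> \<le> (\<integral>x. grad_x x (b x) \<bullet> Z x \<partial>P)" for n
    using neg by (meson half_gt_zero_iff zero_less_one zero_less_power)
  then have "\<forall>n. \<exists>b. b \<in> controls L \<and> (\<integral>x. f x (b x) \<partial>P) \<le> ?v + (1/2) ^ n \<and>
     \<not> (\<integral>x. grad_x x (a x) \<bullet> Z x \<partial>P) - \<eta> \<le> (\<integral>x. grad_x x (b x) \<bullet> Z x \<partial>P)"
    by (intro allI)
  from choice[OF this] obtain b where "\<forall>n. b n \<in> controls L \<and>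
     (\<integral>x. f x (b n x) \<partial>P) \<le> ?v + (1/2) ^ n \<and>
     \<not> (\<integral>x. grad_x x (a x) \<bullet> Z x \<partial>P) - \<eta> \<le> (\<integral>x. grad_x x (b n x) \<bullet> Z x \<partial>P)"
    by (elim exE) (rule that)
  then have b: "b n \<in> controls L" "(\<integral>x. f x (b n x) \<partial>P) \<le> ?v + (1/2) ^ n"
     "\<not> (\<integral>x. grad_x x (a x) \<bullet> Z x \<partial>P) - \<eta> \<le> (\<integral>x. grad_x x (b n x) \<bullet> Z x \<partial>P)" for n
    by simp_all
  have [measurable]: "a \<in> borel_measurable borel" "b n \<in> borel_measurable borel" for n
    using controls_measurable a b by auto
  have gpos: "0 \<le> (\<integral>x. weight x * (norm (b n x - a x))\<^sup>2 \<partial>P)" for n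
    by (intro integral_nonneg_AE AE_I2 mult_nonneg_nonneg weight(1)) auto
  have gle: "(\<integral>x. weight x * (norm (b n x - a x))\<^sup>2 \<partial>P) \<le> 4 * (1/2) ^ n" for n
    using weighted_distance_le[OF b(1) a(1), of n] b(2)[of n] a(2) by simp
  have "summable (\<lambda>n. 4 * (1/2) ^ n :: real)"
    by (intro summable_mult summable_geometric) simp
  then have "summable (\<lambda>n. \<integral>x. weight x * (norm (b n x - a x))\<^sup>2 \<partial>P)"
    by (rule summable_comparison_test'[where N = 0]) (use gpos gle in \<open>simp only: real_norm_def abs_of_nonneg\<close>)
  then have "AE x in P. (\<lambda>n. weight x * (norm (b n x - a x))\<^sup>2) \<longlonglongrightarrow> 0"
    using weight(1) by (intro AE_tendsto_zero_of_summable integrable_weight a b) auto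
  then have lim: "AE x in P. (\<lambda>n. b n x) \<longlonglongrightarrow> a x"
    using AE_eps_pos by eventually_elim (rule tendsto_of_weighted_distance)
  obtain C where C: "C > 0" "\<And>x a. a \<in> control_box L \<Longrightarrow> norm (grad_x x a) \<le> C * (1 + norm x powr (p - 1))"
    using grad_x_bound by blast
  have "(\<lambda>n. \<integral>x. grad_x x (b n x) \<bullet> Z x \<partial>P) \<longlonglongrightarrow> (\<integral>x. grad_x x (a x) \<bullet> Z x \<partial>P)"
  proof (rule integral_dominated_convergence)
    show "integrable P (\<lambda>x. (C * (1 + norm x powr (p - 1))) * B)"
      by (intro integrable_mult_left integrable_growth)
    show "AE x in P. norm (grad_x x (b n x) \<bullet> Z x) \<le> (C * (1 + norm x powr (p - 1))) * B" for n
      using C(2)[OF controls_box[OF b(1)]] ZB C(1)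
      by (intro AE_I2 order_trans[OF Cauchy_Schwarz_ineq2[folded real_norm_def]] mult_mono) auto
    show "AE x in P. (\<lambda>n. grad_x x (b n x) \<bullet> Z x) \<longlonglongrightarrow> grad_x x (a x) \<bullet> Z x"
      using lim
    proof eventually_elim
      case (elim x)
      have "continuous_on UNIV (\<lambda>a. grad_x (fst (x, a)) (snd (x, a)))"
        by (rule continuous_on_compose2[OF continuous_grad_x]) (auto intro!: continuous_intros)
      then have "isCont (grad_x x) (a x)" by (simp add: continuous_on_eq_continuous_at)
      then have "(\<lambda>n. grad_x x (b n x)) \<longlonglongrightarrow> grad_x x (a x)" using elim by (rule isCont_tendsto_compose)
      then show ?case by (intro tendsto_intros)
    qed
  qed (simp_all add: measurable_P)
  then have "\<forall>\<^sub>F n in sequentially. (\<integral>x. grad_x x (a x) \<bullet> Z x \<partial>P) - \<eta> < (\<integral>x. grad_x x (b n x) \<bullet> Z x \<partial>P)"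
    using \<eta> by (intro order_tendstoD(1)) auto
  then show False using b(3) by (auto simp: eventually_sequentially intro: less_imp_le)
qed

end

section \<open>Projection of controls along a causal coupling\<close>

text \<open>The conditional expectation, given \<open>X\<close>, of a predictable function of \<open>Y\<close> is a predictable
  function of \<open>X\<close>.  The map \<open>\<sigma>\<close> is only used to turn a function of the underlying space that depends
  on \<open>X\<close> alone into a function on the path space.\<close>

lemma (in coupled_processes) predictable_projection:
  fixes \<phi> :: "real ^ 'n::{finite,linorder} \<Rightarrow> real"
  assumes causal: "causal \<pi> X Y"
    and \<phi> [measurable]: "\<phi> \<in> borel_measurable borel"
    and adapted: "\<And>x y. (\<And>s. s < t \<Longrightarrow> x $ s = y $ s) \<Longrightarrow> \<phi> x = \<phi> y"
    and bound: "\<And>x. \<bar>\<phi> x\<bar> \<le> B"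
    and \<sigma> [measurable]: "\<sigma> \<in> measurable borel \<pi>" and right_inverse: "\<And>x. X (\<sigma> x) = x"
  shows "\<exists>\<psi>\<in>borel_measurable borel. (\<forall>x y. (\<forall>s<t. x $ s = y $ s) \<longrightarrow> \<psi> x = \<psi> y) \<and> (\<forall>x. \<bar>\<psi> x\<bar> \<le> B) \<and>
    (\<forall>g K. g \<in> borel_measurable (generated_sigma X UNIV) \<longrightarrow> (\<forall>\<omega>. \<bar>g \<omega>\<bar> \<le> K) \<longrightarrow>
      (\<integral>\<omega>. g \<omega> * (\<phi> (Y \<omega>) - \<psi> (X \<omega>)) \<partial>\<pi>) = 0)"
proof (cases "{..<t} = {}")
  case True
  have const: "\<phi> x = \<phi> y" for x y by (rule adapted) (use True in auto)
  have "\<phi> (Y \<omega>) - \<phi> (X \<omega>) = 0" for \<omega> using const[of "Y \<omega>" "X \<omega>"] by simp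
  then show ?thesis
    by (intro bexI[of _ \<phi>] conjI allI impI \<phi> bound const) simp
next
  case False
  define s where "s = Max {..<t}"
  have s: "s < t" using False Max_in[of "{..<t}"] by (auto simp: s_def)
  have past: "{..<t} = {..s}"
    using s by (auto simp: s_def)
  let ?G = "generated_sigma X {..s}"
  interpret G: finite_measure_subalgebra \<pi> ?G by (rule cond_exp_X)
  let ?h = "real_cond_exp \<pi> ?G (\<lambda>\<omega>. \<phi> (Y \<omega>))"
  have B: "0 \<le> B" using bound[of 0] by linarith
  have i\<phi>: "integrable \<pi> (\<lambda>\<omega>. \<phi> (Y \<omega>))"
    using bound by (intro integrable_const_bound[of _ B]) auto
  define \<psi> where "\<psi> x = max (- B) (min B (?h (\<sigma> x)))" for x
  have hG: "?h \<in> borel_measurable ?G" by (rule borel_measurable_cond_exp)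
  have [measurable]: "?h \<in> borel_measurable \<pi>" by (rule borel_measurable_cond_exp2)
  have [measurable]: "\<psi> \<in> borel_measurable borel" unfolding \<psi>_def by measurable
  have h_bounds: "AE \<omega> in \<pi>. - B \<le> ?h \<omega>" "AE \<omega> in \<pi>. ?h \<omega> \<le> B"
    using bound by (auto intro!: G.real_cond_exp_ge_c G.real_cond_exp_le_c i\<phi> simp: abs_le_iff minus_le_iff)
  have h_section: "?h (\<sigma> (X \<omega>)) = ?h \<omega>" for \<omega>
    by (rule generated_sigma_factor[OF hG]) (simp add: right_inverse)
  have \<psi>X: "AE \<omega> in \<pi>. \<psi> (X \<omega>) = ?h \<omega>"
    using h_bounds by eventually_elim (simp add: \<psi>_def h_section)
  have "\<psi> x = \<psi> y" if "\<forall>u<t. x $ u = y $ u" for x y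
  proof -
    have "?h (\<sigma> x) = ?h (\<sigma> y)"
      by (rule generated_sigma_factor[OF hG]) (use that past in \<open>auto simp: right_inverse\<close>)
    then show ?thesis by (simp add: \<psi>_def)
  qed
  moreover have \<psi>B: "\<bar>\<psi> x\<bar> \<le> B" for x using B by (simp add: \<psi>_def abs_le_iff)
  moreover have "(\<integral>\<omega>. g \<omega> * (\<phi> (Y \<omega>) - \<psi> (X \<omega>)) \<partial>\<pi>) = 0"
    if g: "g \<in> borel_measurable (generated_sigma X UNIV)" and K: "\<forall>\<omega>. \<bar>g \<omega>\<bar> \<le> K" for g K
  proof -
    have [measurable]: "g \<in> borel_measurable \<pi>"
      by (rule measurable_from_subalg[OF subalgebra_generated_sigma[OF X space_eq] g])
    have ig: "integrable \<pi> g" using K by (intro integrable_const_bound[of _ K]) auto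
    let ?g' = "real_cond_exp \<pi> ?G g"
    have ig': "integrable \<pi> ?g'" by (rule G.real_cond_exp_int(1)[OF ig])
    have i1: "integrable \<pi> (\<lambda>\<omega>. g \<omega> * \<phi> (Y \<omega>))"
      using bound by (intro integrable_mult_bounded[OF ig]) auto
    have i2: "integrable \<pi> (\<lambda>\<omega>. ?g' \<omega> * \<phi> (Y \<omega>))"
      using bound by (intro integrable_mult_bounded[OF ig']) auto
    have i3: "integrable \<pi> (\<lambda>\<omega>. g \<omega> * \<psi> (X \<omega>))"
      using \<psi>B by (intro integrable_mult_bounded[OF ig]) auto
    have i4: "integrable \<pi> (\<lambda>\<omega>. ?h \<omega> * g \<omega>)"
      by (rule integrable_cong_AE_imp[OF i3]) (use \<psi>X in \<open>auto simp: mult.commute\<close>)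
    have \<phi>Y: "(\<lambda>\<omega>. \<phi> (Y \<omega>)) \<in> borel_measurable (generated_sigma Y {..s})"
      by (rule adapted_measurable_generated_sigma[OF \<phi>]) (use adapted past in blast)
    have "(\<integral>\<omega>. g \<omega> * \<phi> (Y \<omega>) \<partial>\<pi>) = (\<integral>\<omega>. ?g' \<omega> * \<phi> (Y \<omega>) \<partial>\<pi>)"
      by (rule causal_integral[OF causal \<phi>Y g ig i1 i2])
    also have "\<dots> = (\<integral>\<omega>. ?g' \<omega> * ?h \<omega> \<partial>\<pi>)"
      using i2 by (intro G.real_cond_exp_intg(2)[symmetric]) auto
    also have "\<dots> = (\<integral>\<omega>. ?h \<omega> * ?g' \<omega> \<partial>\<pi>)" by (simp add: mult.commute)
    also have "\<dots> = (\<integral>\<omega>. ?h \<omega> * g \<omega> \<partial>\<pi>)"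
      using i4 by (intro G.real_cond_exp_intg(2)) auto
    also have "\<dots> = (\<integral>\<omega>. g \<omega> * \<psi> (X \<omega>) \<partial>\<pi>)"
      using \<psi>X by (intro integral_cong_AE) (auto simp: mult.commute)
    finally show ?thesis using i1 i3 by (simp add: right_diff_distrib)
  qed
  ultimately show ?thesis by (intro bexI[of _ \<psi>]) auto
qed

lemma coupled_processes_coupling:
  assumes "\<pi> \<in> couplings P Q"
  shows "coupled_processes \<pi> fst snd" "coupled_processes \<pi> snd fst"
proof -
  have \<pi>: "prob_space \<pi>" "sets \<pi> = sets borel" using assms by (auto simp: couplings_def)
  have "fst \<in> borel_measurable \<pi>" "snd \<in> borel_measurable \<pi>"
    unfolding measurable_cong_sets[OF \<pi>(2) refl]
    by (simp_all add: borel_prod[symmetric])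
  with \<pi>(1) sets_eq_imp_space_eq[OF \<pi>(2)]
  show "coupled_processes \<pi> fst snd" "coupled_processes \<pi> snd fst"
    by (simp_all add: coupled_processes_def coupled_processes_axioms_def)
qed

text \<open>Projecting a control along the coupling does not increase the cost, by Jensen's inequality in
  the form of the gradient inequality.\<close>

lemma (in control_problem) transfer_control:
  assumes \<pi>: "\<pi> \<in> couplings P' Q" and causal: "causal \<pi> snd fst"
    and Q: "Q \<in> finite_moment_measures p" and a: "a \<in> controls L"
  shows "\<exists>b\<in>controls L. (\<integral>y. f y (b y) \<partial>Q) \<le> (\<integral>\<omega>. f (snd \<omega>) (a (fst \<omega>)) \<partial>\<pi>)"
proof -
  interpret coupled_processes \<pi> snd fst by (rule coupled_processes_coupling[OF \<pi>])
  have sets_\<pi>: "sets \<pi> = sets borel" and Q_eq: "distr \<pi> borel snd = Q"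
    using \<pi> by (auto simp: couplings_def)
  have "(\<lambda>y. (0, y)) \<in> measurable borel (borel :: ((real, 'n) vec \<times> (real, 'n) vec) measure)"
    by (intro borel_measurable_continuous_onI continuous_intros)
  then have \<sigma>: "(\<lambda>y. (0, y)) \<in> measurable borel \<pi>"
    unfolding measurable_cong_sets[OF refl sets_\<pi>] .
  define ok where "ok t \<psi> \<longleftrightarrow> \<psi> \<in> borel_measurable borel \<and>
      (\<forall>x y. (\<forall>s<t. x $ s = y $ s) \<longrightarrow> \<psi> x = \<psi> y) \<and> (\<forall>x. \<bar>\<psi> x\<bar> \<le> L) \<and>
      (\<forall>g K. g \<in> borel_measurable (generated_sigma snd UNIV) \<longrightarrow> (\<forall>\<omega>. \<bar>g \<omega>\<bar> \<le> K) \<longrightarrow>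
        (\<integral>\<omega>. g \<omega> * (a (fst \<omega>) $ t - \<psi> (snd \<omega>)) \<partial>\<pi>) = 0)" for t and \<psi> :: "(real, 'n) vec \<Rightarrow> real"
  have "\<exists>\<psi>. ok t \<psi>" for t
  proof -
    have at: "(\<lambda>x. a x $ t) \<in> borel_measurable borel" "\<And>x. \<bar>a x $ t\<bar> \<le> L"
      "\<And>x y. (\<And>s. s < t \<Longrightarrow> x $ s = y $ s) \<Longrightarrow> a x $ t = a y $ t"
      using a by (simp_all add: controls_def)
    show ?thesis
      using predictable_projection[OF causal at(1,3,2) \<sigma> snd_conv] unfolding ok_def by blast
  qed
  then have "\<forall>t. \<exists>\<psi>. ok t \<psi>" ..
  from choice[OF this] obtain \<psi> where \<psi>: "\<And>t. ok t (\<psi> t)" by blast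
  define b where "b y = (\<chi> t. \<psi> t y)" for y
  have b: "b \<in> controls L"
    using \<psi> by (auto simp: controls_def b_def ok_def)
  have [measurable]: "a \<in> borel_measurable borel" "b \<in> borel_measurable borel"
    using a b controls_measurable by auto
  define G where "G t y = partial_deriv (f y) t (b y)" for t y
  have [measurable]: "G t \<in> borel_measurable borel" for t
    unfolding G_def by (rule grad_a_measurable_compose) measurable
  \<comment> \<open>The gradient in the control need not be integrable, hence the truncation at level \<open>N\<close>.\<close>
  let ?J = "\<lambda>N. {y. \<forall>t. \<bar>G t y\<bar> \<le> real N}"
  have [measurable]: "?J N \<in> sets borel" for N by measurable
  let ?fa = "\<lambda>\<omega>. f (snd \<omega>) (a (fst \<omega>))" and ?fb = "\<lambda>\<omega>. f (snd \<omega>) (b (snd \<omega>))"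
  have moment: "integrable \<pi> (\<lambda>\<omega>. norm (snd \<omega>) powr p)"
    using Q integrable_distr_eq[OF X, of "\<lambda>x. norm x powr p"] by (simp add: Q_eq finite_moment_measures_def)
  have ifa: "integrable \<pi> ?fa" and ifb: "integrable \<pi> ?fb"
    by (auto intro!: integrable_cost[OF finite_measure_axioms _ _ moment] controls_box[OF a] controls_box[OF b])
  have truncated: "0 \<le> (\<integral>\<omega>. indicator (?J N) (snd \<omega>) * (?fa \<omega> - ?fb \<omega>) \<partial>\<pi>)" for N
  proof -
    let ?g = "\<lambda>t \<omega>. indicator (?J N) (snd \<omega>) * G t (snd \<omega>)"
    let ?d = "\<lambda>t \<omega>. a (fst \<omega>) $ t - \<psi> t (snd \<omega>)"
    have gB: "\<bar>?g t \<omega>\<bar> \<le> real N" for t \<omega> by (auto split: split_indicator)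
    have gm: "?g t \<in> borel_measurable (generated_sigma snd UNIV)" for t
    proof (rule adapted_measurable_generated_sigma[where \<phi> = "\<lambda>y. indicator (?J N) y * G t y"])
      show "(\<lambda>y. indicator (?J N) y * G t y) \<in> borel_measurable borel" by measurable
      fix x y :: "(real, 'n) vec" assume "\<And>s. s \<in> UNIV \<Longrightarrow> x $ s = y $ s"
      then have "x = y" by (simp add: vec_eq_iff)
      then show "indicator (?J N) x * G t x = indicator (?J N) y * G t y" by simp
    qed
    have g0: "(\<integral>\<omega>. ?g t \<omega> * ?d t \<omega> \<partial>\<pi>) = 0" for t
      using \<psi>[of t] gm gB unfolding ok_def by blast
    have [measurable]: "\<psi> t \<in> borel_measurable borel" for t using \<psi> by (auto simp: ok_def)
    have ig: "integrable \<pi> (\<lambda>\<omega>. ?g t \<omega> * ?d t \<omega>)" for t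
    proof (rule integrable_const_bound[of _ "real N * (2 * L)"])
      have "\<bar>?d t \<omega>\<bar> \<le> 2 * L" for \<omega>
      proof -
        have "\<bar>a (fst \<omega>) $ t\<bar> \<le> L" "\<bar>\<psi> t (snd \<omega>)\<bar> \<le> L" using a \<psi> by (auto simp: controls_def ok_def)
        then show ?thesis by linarith
      qed
      then have "\<bar>?g t \<omega>\<bar> * \<bar>?d t \<omega>\<bar> \<le> real N * (2 * L)" for \<omega>
        by (intro mult_mono gB) auto
      then show "AE \<omega> in \<pi>. norm (?g t \<omega> * ?d t \<omega>) \<le> real N * (2 * L)"
        by (intro AE_I2) (simp only: real_norm_def abs_mult)
    qed measurable
    have "0 = (\<integral>\<omega>. (\<Sum>t\<in>UNIV. ?g t \<omega> * ?d t \<omega>) \<partial>\<pi>)"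
      using g0 ig by simp
    also have "\<dots> \<le> (\<integral>\<omega>. indicator (?J N) (snd \<omega>) * (?fa \<omega> - ?fb \<omega>) \<partial>\<pi>)"
    proof (rule integral_mono)
      show "integrable \<pi> (\<lambda>\<omega>. indicator (?J N) (snd \<omega>) * (?fa \<omega> - ?fb \<omega>))"
        using ifa ifb by (subst mult.commute, intro integrable_mult_bounded[where B = 1])
          (auto split: split_indicator)
      fix \<omega> :: "(real, 'n) vec \<times> (real, 'n) vec"
      have "f (snd \<omega>) differentiable (at x)" for x
        using C2[of "snd \<omega>"] by (simp add: twice_continuously_differentiable_def)
      from gradient_inequality[OF convex this, of "b (snd \<omega>)" "a (fst \<omega>)"]
      have "(\<Sum>t\<in>UNIV. G t (snd \<omega>) * ?d t \<omega>) \<le> ?fa \<omega> - ?fb \<omega>"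
        by (simp add: G_def b_def)
      then show "(\<Sum>t\<in>UNIV. ?g t \<omega> * ?d t \<omega>) \<le> indicator (?J N) (snd \<omega>) * (?fa \<omega> - ?fb \<omega>)"
        by (simp add: indicator_def)
    qed (use ig in auto)
    finally show ?thesis .
  qed
  have "(\<lambda>N. \<integral>\<omega>. indicator (?J N) (snd \<omega>) * (?fa \<omega> - ?fb \<omega>) \<partial>\<pi>) \<longlonglongrightarrow> (\<integral>\<omega>. ?fa \<omega> - ?fb \<omega> \<partial>\<pi>)"
  proof (rule integral_dominated_convergence)
    show "integrable \<pi> (\<lambda>\<omega>. \<bar>?fa \<omega> - ?fb \<omega>\<bar>)" using ifa ifb by simp
    show "AE \<omega> in \<pi>. (\<lambda>N. indicator (?J N) (snd \<omega>) * (?fa \<omega> - ?fb \<omega>)) \<longlonglongrightarrow> ?fa \<omega> - ?fb \<omega>"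
    proof (rule AE_I2)
      fix \<omega> :: "(real, 'n) vec \<times> (real, 'n) vec"
      let ?m = "Max (range (\<lambda>t. \<bar>G t (snd \<omega>)\<bar>))"
      obtain N0 where N0: "?m \<le> real N0" using real_arch_simple by blast
      have "snd \<omega> \<in> ?J N" if "N \<ge> N0" for N
      proof -
        have "\<bar>G t (snd \<omega>)\<bar> \<le> ?m" for t by (rule Max_ge) auto
        moreover have "real N0 \<le> real N" using that by simp
        ultimately show ?thesis using N0 by (auto intro: order_trans)
      qed
      then have "\<forall>\<^sub>F N in sequentially. indicator (?J N) (snd \<omega>) * (?fa \<omega> - ?fb \<omega>) = ?fa \<omega> - ?fb \<omega>"
        by (auto simp: eventually_sequentially intro!: exI[of _ N0])
      then show "(\<lambda>N. indicator (?J N) (snd \<omega>) * (?fa \<omega> - ?fb \<omega>)) \<longlonglongrightarrow> ?fa \<omega> - ?fb \<omega>"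
        by (rule tendsto_eventually)
    qed
    show "AE \<omega> in \<pi>. norm (indicator (?J N) (snd \<omega>) * (?fa \<omega> - ?fb \<omega>)) \<le> \<bar>?fa \<omega> - ?fb \<omega>\<bar>" for N
      by (auto split: split_indicator)
  qed (use ifa ifb in auto)
  then have "0 \<le> (\<integral>\<omega>. ?fa \<omega> - ?fb \<omega> \<partial>\<pi>)"
    by (rule LIMSEQ_le_const) (use truncated in blast)
  moreover have "(\<integral>\<omega>. ?fb \<omega> \<partial>\<pi>) = (\<integral>y. f y (b y) \<partial>Q)"
    unfolding Q_eq[symmetric] by (rule integral_distr[OF X, symmetric]) measurable
  ultimately show ?thesis using b ifa ifb by (intro bexI[of _ b]) auto
qed

section \<open>Hoelder's inequality and moment estimates\<close>

lemma Hoelder_sum: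
  fixes u v :: "'i \<Rightarrow> 'a \<Rightarrow> real"
  assumes I: "finite I" and pq: "1 < p" "1 < q" "1 / p + 1 / q = 1"
    and m: "\<And>i. i \<in> I \<Longrightarrow> u i \<in> borel_measurable M" "\<And>i. i \<in> I \<Longrightarrow> v i \<in> borel_measurable M"
    and u: "\<And>i. i \<in> I \<Longrightarrow> integrable M (\<lambda>x. \<bar>u i x\<bar> powr q)"
    and v: "\<And>i. i \<in> I \<Longrightarrow> integrable M (\<lambda>x. \<bar>v i x\<bar> powr p)"
  shows "\<And>i. i \<in> I \<Longrightarrow> integrable M (\<lambda>x. u i x * v i x)"
    and "(\<Sum>i\<in>I. \<integral>x. u i x * v i x \<partial>M)
      \<le> (\<Sum>i\<in>I. \<integral>x. \<bar>u i x\<bar> powr q \<partial>M) powr (1 / q) * (\<Sum>i\<in>I. \<integral>x. \<bar>v i x\<bar> powr p \<partial>M) powr (1 / p)"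
proof -
  have young: "u i x * v i x \<le> \<bar>v i x\<bar> powr p / p + \<bar>u i x\<bar> powr q / q"
    and young_abs: "\<bar>u i x * v i x\<bar> \<le> \<bar>v i x\<bar> powr p / p + \<bar>u i x\<bar> powr q / q" for i x
    using Youngs_inequality[OF pq, of "\<bar>v i x\<bar>" "\<bar>u i x\<bar>"] abs_ge_self[of "u i x * v i x"]
    by (auto simp: abs_mult mult.commute)
  show int: "integrable M (\<lambda>x. u i x * v i x)" if i: "i \<in> I" for i
  proof (rule Bochner_Integration.integrable_bound)
    show "integrable M (\<lambda>x. \<bar>v i x\<bar> powr p / p + \<bar>u i x\<bar> powr q / q)"
      using u[OF i] v[OF i] by simp
    show "AE x in M. norm (u i x * v i x) \<le> norm (\<bar>v i x\<bar> powr p / p + \<bar>u i x\<bar> powr q / q)"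
      using young_abs by (auto intro!: order_trans[OF young_abs] AE_I2 simp del: abs_mult)
    show "(\<lambda>x. u i x * v i x) \<in> borel_measurable M"
      using m[OF i] by measurable
  qed
  define A where "A = (\<Sum>i\<in>I. \<integral>x. \<bar>u i x\<bar> powr q \<partial>M)"
  define B where "B = (\<Sum>i\<in>I. \<integral>x. \<bar>v i x\<bar> powr p \<partial>M)"
  have AB: "0 \<le> A" "0 \<le> B" by (auto simp: A_def B_def intro!: sum_nonneg integral_nonneg_AE)
  have zero: "(\<integral>x. u i x * v i x \<partial>M) = 0" if i: "i \<in> I" and "A = 0 \<or> B = 0" for i
  proof -
    have "AE x in M. u i x * v i x = 0"
      using that(2)
    proof
      assume "A = 0"
      then have "(\<integral>x. \<bar>u i x\<bar> powr q \<partial>M) = 0"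
        using i I by (simp add: A_def sum_nonneg_eq_0_iff integral_nonneg_AE)
      then have "AE x in M. \<bar>u i x\<bar> powr q = 0"
        by (subst (asm) integral_nonneg_eq_0_iff_AE[OF u[OF i]]) auto
      then show ?thesis by eventually_elim auto
    next
      assume "B = 0"
      then have "(\<integral>x. \<bar>v i x\<bar> powr p \<partial>M) = 0"
        using i I by (simp add: B_def sum_nonneg_eq_0_iff integral_nonneg_AE)
      then have "AE x in M. \<bar>v i x\<bar> powr p = 0"
        by (subst (asm) integral_nonneg_eq_0_iff_AE[OF v[OF i]]) auto
      then show ?thesis by eventually_elim auto
    qed
    then show ?thesis by (rule integral_eq_zero_AE)
  qed
  have "(\<Sum>i\<in>I. \<integral>x. u i x * v i x \<partial>M) \<le> A powr (1 / q) * B powr (1 / p)"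
  proof (cases "A = 0 \<or> B = 0")
    case True
    then show ?thesis using zero by simp
  next
    case False
    then have AB': "0 < A" "0 < B" using AB by auto
    let ?c = "A powr (1 / q)" and ?d = "B powr (1 / p)"
    have cd: "0 < ?c" "0 < ?d" using AB' by simp_all
    have pw: "?c powr q = A" "?d powr p = B" using AB' pq by (simp_all add: powr_powr)
    have pt: "u i x * v i x \<le> ?c * ?d * (\<bar>v i x\<bar> powr p / (p * B) + \<bar>u i x\<bar> powr q / (q * A))" for i x
    proof -
      have "\<bar>v i x\<bar> / ?d * (\<bar>u i x\<bar> / ?c) \<le> (\<bar>v i x\<bar> / ?d) powr p / p + (\<bar>u i x\<bar> / ?c) powr q / q"
        using cd by (intro Youngs_inequality pq) auto
      also have "\<dots> = \<bar>v i x\<bar> powr p / (p * B) + \<bar>u i x\<bar> powr q / (q * A)"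
        using cd by (simp add: powr_divide pw mult.commute)
      finally have "?c * ?d * (\<bar>v i x\<bar> / ?d * (\<bar>u i x\<bar> / ?c))
          \<le> ?c * ?d * (\<bar>v i x\<bar> powr p / (p * B) + \<bar>u i x\<bar> powr q / (q * A))"
        using cd by (intro mult_left_mono) auto
      moreover have "?c * ?d * (\<bar>v i x\<bar> / ?d * (\<bar>u i x\<bar> / ?c)) = \<bar>u i x * v i x\<bar>"
        using AB' by (simp add: abs_mult field_simps)
      ultimately show ?thesis using abs_ge_self[of "u i x * v i x"] by linarith
    qed
    have "(\<Sum>i\<in>I. \<integral>x. u i x * v i x \<partial>M)
        \<le> (\<Sum>i\<in>I. \<integral>x. ?c * ?d * (\<bar>v i x\<bar> powr p / (p * B) + \<bar>u i x\<bar> powr q / (q * A)) \<partial>M)"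
      by (intro sum_mono integral_mono int pt) (use u v in auto)
    also have "\<dots> = (\<Sum>i\<in>I. ?c * ?d * ((\<integral>x. \<bar>v i x\<bar> powr p \<partial>M) / (p * B) + (\<integral>x. \<bar>u i x\<bar> powr q \<partial>M) / (q * A)))"
      using u v by (intro sum.cong refl) simp
    also have "\<dots> = ?c * ?d * (B / (p * B) + A / (q * A))"
      unfolding sum_distrib_left[symmetric] sum.distrib sum_divide_distrib[symmetric]
      by (simp only: A_def[symmetric] B_def[symmetric])
    also have "B / (p * B) + A / (q * A) = 1" using AB' pq by simp
    finally show ?thesis by simp
  qed
  then show "(\<Sum>i\<in>I. \<integral>x. u i x * v i x \<partial>M)
      \<le> (\<Sum>i\<in>I. \<integral>x. \<bar>u i x\<bar> powr q \<partial>M) powr (1 / q) * (\<Sum>i\<in>I. \<integral>x. \<bar>v i x\<bar> powr p \<partial>M) powr (1 / p)"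
    by (simp add: A_def B_def)
qed

lemma norm_powr_le_sum:
  fixes h :: "real ^ 'n::finite"
  assumes "0 \<le> p"
  shows "norm h powr p \<le> real CARD('n) powr p * (\<Sum>t\<in>UNIV. \<bar>h $ t\<bar> powr p)"
proof -
  let ?m = "Max (range (\<lambda>t. \<bar>h $ t\<bar>))"
  have le: "\<bar>h $ t\<bar> \<le> ?m" for t by (rule Max_ge) auto
  have "?m \<in> range (\<lambda>t. \<bar>h $ t\<bar>)" by (rule Max_in) auto
  then obtain t where t: "?m = \<bar>h $ t\<bar>" by blast
  have "norm h \<le> (\<Sum>t\<in>UNIV. \<bar>h $ t\<bar>)" by (rule norm_le_l1_cart)
  also have "\<dots> \<le> (\<Sum>t\<in>(UNIV :: 'n set). ?m)" by (intro sum_mono le)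
  finally have "norm h powr p \<le> (real CARD('n) * ?m) powr p"
    using assms by (intro powr_mono2) auto
  also have "\<dots> = real CARD('n) powr p * \<bar>h $ t\<bar> powr p"
    unfolding t by (simp add: powr_mult)
  also have "\<bar>h $ t\<bar> powr p \<le> (\<Sum>t\<in>UNIV. \<bar>h $ t\<bar> powr p)"
    by (rule member_le_sum) auto
  finally show ?thesis by (simp add: mult_left_mono)
qed

lemma convex_on_abs_powr:
  assumes "1 \<le> q"
  shows "convex_on UNIV (\<lambda>x :: real. \<bar>x\<bar> powr q)"
proof (rule convex_onI)
  fix t x y :: real assume t: "0 < t" "t < 1"
  let ?a = "\<bar>x\<bar>" and ?b = "\<bar>y\<bar>"
  have small: "s powr q \<le> s" if "0 < s" "s < 1" for s :: real
    using that assms powr_mono'[of 1 q s] by simp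
  have "\<bar>(1 - t) *\<^sub>R x + t *\<^sub>R y\<bar> \<le> (1 - t) * ?a + t * ?b"
    using t by (intro order_trans[OF abs_triangle_ineq]) (simp add: abs_mult)
  then have "\<bar>(1 - t) *\<^sub>R x + t *\<^sub>R y\<bar> powr q \<le> ((1 - t) * ?a + t * ?b) powr q"
    using assms by (intro powr_mono2) auto
  also have "\<dots> \<le> (1 - t) * ?a powr q + t * ?b powr q"
  proof -
    consider "x = 0" | "y = 0" | "x \<noteq> 0" "y \<noteq> 0" by blast
    then show ?thesis
    proof cases
      case 1
      then show ?thesis using t small[of t] assms by (simp add: powr_mult mult_right_mono)
    next
      case 2
      then show ?thesis using t small[of "1 - t"] assms by (simp add: powr_mult mult_right_mono)
    next
      case 3
      then show ?thesis using convex_onD[OF powr_convex[OF assms], of t ?a ?b] t by simp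
    qed
  qed
  finally show "\<bar>(1 - t) *\<^sub>R x + t *\<^sub>R y\<bar> powr q \<le> (1 - t) * \<bar>x\<bar> powr q + t * \<bar>y\<bar> powr q" .
qed simp

lemma integrable_abs_diff_powr:
  fixes u v :: "'a \<Rightarrow> real"
  assumes "0 \<le> p" "u \<in> borel_measurable M" "v \<in> borel_measurable M"
    "integrable M (\<lambda>x. \<bar>u x\<bar> powr p)" "integrable M (\<lambda>x. \<bar>v x\<bar> powr p)"
  shows "integrable M (\<lambda>x. \<bar>u x - v x\<bar> powr p)"
proof (rule Bochner_Integration.integrable_bound)
  show "integrable M (\<lambda>x. 2 powr p * (\<bar>u x\<bar> powr p + \<bar>v x\<bar> powr p))" using assms by simp
  have "\<bar>u x - v x\<bar> powr p \<le> 2 powr p * (\<bar>u x\<bar> powr p + \<bar>v x\<bar> powr p)" for x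
  proof -
    have "\<bar>u x - v x\<bar> powr p \<le> (\<bar>u x\<bar> + \<bar>v x\<bar>) powr p"
      using assms by (intro powr_mono2) auto
    also have "\<dots> \<le> 2 powr p * (\<bar>u x\<bar> powr p + \<bar>v x\<bar> powr p)"
      using assms by (intro powr_add_le) auto
    finally show ?thesis .
  qed
  then show "AE x in M. norm (\<bar>u x - v x\<bar> powr p) \<le> norm (2 powr p * (\<bar>u x\<bar> powr p + \<bar>v x\<bar> powr p))"
    by (auto intro!: AE_I2 order_trans[OF _ abs_ge_self])
qed (use assms(2,3) in measurable)

lemma integrable_component_powr:
  fixes X :: "'a \<Rightarrow> real ^ 'n::finite"
  assumes "0 \<le> p" and [measurable]: "X \<in> borel_measurable M" and "integrable M (\<lambda>w. norm (X w) powr p)"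
  shows "integrable M (\<lambda>w. \<bar>X w $ t\<bar> powr p)"
proof (rule Bochner_Integration.integrable_bound[OF assms(3)])
  show "AE w in M. norm (\<bar>X w $ t\<bar> powr p) \<le> norm (norm (X w) powr p)"
    using assms(1) by (auto intro!: AE_I2 powr_mono2 simp: component_le_norm_cart)
qed measurable

section \<open>The first-order expansion in expectation\<close>

text \<open>The \<open>p\<close>-th power of the transport cost between two processes on the same probability space.\<close>

definition transport_cost :: "real \<Rightarrow> 'w measure \<Rightarrow> ('w \<Rightarrow> real ^ 'n::finite) \<Rightarrow> ('w \<Rightarrow> real ^ 'n) \<Rightarrow> real" where
  "transport_cost p M X Y = (\<Sum>t\<in>UNIV. \<integral>w. \<bar>X w $ t - Y w $ t\<bar> powr p \<partial>M)"

lemma transport_cost_nonneg: "0 \<le> transport_cost p M X Y"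
  unfolding transport_cost_def by (intro sum_nonneg integral_nonneg_AE) auto

context control_problem
begin

lemma tail_growth_tendsto_zero:
  assumes "0 < C"
  shows "\<And>N. integrable P (\<lambda>x. \<bar>C * (indicator {x. N < norm x} x * (1 + norm x powr (p - 1)))\<bar> powr q)"
    and "(\<lambda>N. \<integral>x. \<bar>C * (indicator {x. real N < norm x} x * (1 + norm x powr (p - 1)))\<bar> powr q \<partial>P) \<longlonglongrightarrow> 0"
proof -
  interpret prob_space P by (rule prob_P)
  let ?k = "\<lambda>N x. \<bar>C * (indicator {x. N < norm x} x * (1 + norm x powr (p - 1)))\<bar> powr q"
  let ?b = "\<lambda>x. C powr q * (2 powr q * (1 + norm x powr p))"
  have b: "integrable P ?b" using moment_P by simp
  have le: "?k N x \<le> ?b x" for N and x :: "(real, 'n) vec"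
  proof -
    have "?k N x \<le> (C * (1 + norm x powr (p - 1))) powr q"
      using assms q(1) by (intro powr_mono2) (auto split: split_indicator)
    also have "\<dots> = C powr q * (1 + norm x powr (p - 1)) powr q"
      using assms by (simp add: powr_mult)
    also have "\<dots> \<le> C powr q * (2 powr q * (1 powr q + (norm x powr (p - 1)) powr q))"
      using q(1) by (intro mult_left_mono powr_add_le) auto
    also have "\<dots> = ?b x" by (simp add: powr_powr q(3))
    finally show ?thesis .
  qed
  have m: "?k N \<in> borel_measurable P" for N unfolding measurable_P by measurable
  have bound: "AE x in P. norm (?k N x) \<le> ?b x" for N using le by auto
  show "integrable P (?k N)" for N
    by (rule Bochner_Integration.integrable_bound[OF b m]) (use le in \<open>auto intro!: AE_I2 order_trans[OF _ abs_ge_self]\<close>)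
  have "(\<lambda>N. \<integral>x. ?k (real N) x \<partial>P) \<longlonglongrightarrow> (\<integral>x. 0 \<partial>P)"
  proof (rule integral_dominated_convergence[OF _ m b _ bound])
    show "AE x in P. (\<lambda>N. ?k (real N) x) \<longlonglongrightarrow> 0"
    proof (rule AE_I2)
      fix x
      obtain N0 where "norm x \<le> real N0" using real_arch_simple by blast
      then have "?k (real N) x = 0" if "N \<ge> N0" for N
        using that q(1) by (auto simp: indicator_def)
      then have "\<forall>\<^sub>F N in sequentially. ?k (real N) x = 0"
        by (auto simp: eventually_sequentially)
      then show "(\<lambda>N. ?k (real N) x) \<longlonglongrightarrow> 0" by (rule tendsto_eventually)
    qed
  qed simp
  then show "(\<lambda>N. \<integral>x. ?k (real N) x \<partial>P) \<longlonglongrightarrow> 0" by simp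
qed

text \<open>The expected remainder is of smaller order than the \<open>p\<close>-th root of \<^const>\<open>transport_cost\<close>, uniformly
  over the pair of processes and over the control.\<close>

lemma expected_remainder:
  assumes \<eta>: "0 < \<eta>"
  obtains r0 where "0 < r0"
    and "\<And>r (M :: 'w measure) X Y A. \<lbrakk>0 < r; r < r0; prob_space M;
      X \<in> borel_measurable M; Y \<in> borel_measurable M; A \<in> borel_measurable M;
      distr M borel X = P; \<And>w. A w \<in> control_box L;
      \<And>t. integrable M (\<lambda>w. \<bar>X w $ t - Y w $ t\<bar> powr p); transport_cost p M X Y \<le> r powr p\<rbrakk> \<Longrightarrow>
      integrable M (\<lambda>w. remainder (X w) (Y w) (A w)) \<and> (\<integral>w. \<bar>remainder (X w) (Y w) (A w)\<bar> \<partial>M) \<le> \<eta> * r"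
proof -
  obtain C where C: "C > 0" "\<And>\<eta> N. \<eta> > 0 \<Longrightarrow> N \<ge> 0 \<Longrightarrow> \<exists>K\<ge>0. \<forall>x y. \<forall>a\<in>control_box L.
    \<bar>remainder x y a\<bar> \<le> norm (y - x) *
      (\<eta> + C * (indicator {x. N < norm x} x * (1 + norm x powr (p - 1))) + K * norm (y - x) powr (p - 1))"
    using remainder_bound by blast
  let ?k = "\<lambda>N x. C * (indicator {x. N < norm x} x * (1 + norm x powr (p - 1)))"
  let ?n = "real CARD('n)"
  have n: "?n > 0" by simp
  have "(\<lambda>N. (\<integral>x. \<bar>?k (real N) x\<bar> powr q \<partial>P) powr (1 / q)) \<longlonglongrightarrow> 0 powr (1 / q)"
    using q(1) by (intro tendsto_powr2 tail_growth_tendsto_zero(2)[OF C(1)] tendsto_const always_eventually allI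
        integral_nonneg_AE) auto
  then have "(\<lambda>N. (\<integral>x. \<bar>?k (real N) x\<bar> powr q \<partial>P) powr (1 / q)) \<longlonglongrightarrow> 0" by simp
  moreover have "0 < \<eta> / (3 * ?n)" using \<eta> n by simp
  ultimately have "\<forall>\<^sub>F N in sequentially. (\<integral>x. \<bar>?k (real N) x\<bar> powr q \<partial>P) powr (1 / q) < \<eta> / (3 * ?n)"
    by (rule order_tendstoD(2))
  then obtain N0 :: nat where N0: "(\<integral>x. \<bar>?k (real N0) x\<bar> powr q \<partial>P) powr (1 / q) < \<eta> / (3 * ?n)"
    by (auto simp: eventually_sequentially)
  define N where "N = real N0"
  have N: "(\<integral>x. \<bar>?k N x\<bar> powr q \<partial>P) powr (1 / q) < \<eta> / (3 * ?n)" using N0 by (simp add: N_def)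
  obtain K where K: "K \<ge> 0" "\<And>x y a. a \<in> control_box L \<Longrightarrow>
    \<bar>remainder x y a\<bar> \<le> norm (y - x) * (\<eta> / (3 * ?n) + ?k N x + K * norm (y - x) powr (p - 1))"
    using C(2)[of "\<eta> / (3 * ?n)" N] \<eta> n N_def by (metis divide_pos_pos mult_pos_pos of_nat_0_le_iff zero_less_numeral)
  \<comment> \<open>With \<open>N\<close> and hence \<open>K\<close> fixed, the term of order \<open>p > 1\<close> in \<open>r\<close> is negligible below this radius.\<close>
  define r0 where "r0 = (\<eta> / (3 * (K + 1) * ?n powr p)) powr (1 / (p - 1))"
  have den: "0 < 3 * (K + 1) * ?n powr p" using K(1) n by (intro mult_pos_pos) auto
  have quot: "0 < \<eta> / (3 * (K + 1) * ?n powr p)" using divide_pos_pos[OF \<eta> den] .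
  then have r0: "0 < r0" unfolding r0_def powr_gt_zero by (rule less_imp_neq[THEN not_sym])
  show ?thesis
  proof (rule that[OF r0])
    fix r and M :: "'w measure" and X Y A :: "'w \<Rightarrow> (real, 'n) vec"
    assume r: "0 < r" "r < r0" and M: "prob_space M"
      and meas: "X \<in> borel_measurable M" "Y \<in> borel_measurable M" "A \<in> borel_measurable M"
      and distr: "distr M borel X = P" and A: "\<And>w. A w \<in> control_box L"
      and int: "\<And>t. integrable M (\<lambda>w. \<bar>X w $ t - Y w $ t\<bar> powr p)"
      and cost: "transport_cost p M X Y \<le> r powr p"
    interpret prob_space M by fact
    note [measurable] = meas
    let ?D = "\<lambda>w. norm (Y w - X w)"
    let ?k' = "\<lambda>w. ?k N (X w)"
    have kmeas [measurable]: "?k N \<in> borel_measurable borel" by measurable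
    have D_le: "?D w powr p \<le> ?n powr p * (\<Sum>t\<in>UNIV. \<bar>X w $ t - Y w $ t\<bar> powr p)" for w
      using norm_powr_le_sum[of p "Y w - X w"] p by (simp add: abs_minus_commute)
    have isum: "integrable M (\<lambda>w. ?n powr p * (\<Sum>t\<in>UNIV. \<bar>X w $ t - Y w $ t\<bar> powr p))"
      using int by (intro integrable_mult_right Bochner_Integration.integrable_sum) auto
    have iD: "integrable M (\<lambda>w. ?D w powr p)"
      by (rule Bochner_Integration.integrable_bound[OF isum])
        (use D_le in \<open>auto intro!: AE_I2 order_trans[OF _ abs_ge_self]\<close>)
    have "(\<integral>w. ?D w powr p \<partial>M) \<le> (\<integral>w. ?n powr p * (\<Sum>t\<in>UNIV. \<bar>X w $ t - Y w $ t\<bar> powr p) \<partial>M)"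
      by (intro integral_mono iD isum D_le)
    also have "\<dots> = ?n powr p * transport_cost p M X Y"
      using int by (simp add: transport_cost_def)
    also have "\<dots> \<le> ?n powr p * r powr p" using cost by (intro mult_left_mono) auto
    finally have Dp: "(\<integral>w. ?D w powr p \<partial>M) \<le> ?n powr p * r powr p" .
    then have "(\<integral>w. ?D w powr p \<partial>M) powr (1 / p) \<le> (?n powr p * r powr p) powr (1 / p)"
      using p by (intro powr_mono2) (auto intro!: integral_nonneg_AE)
    also have "\<dots> = ?n * r" using p r n by (simp add: powr_mult powr_powr)
    finally have Dnorm: "(\<integral>w. ?D w powr p \<partial>M) powr (1 / p) \<le> ?n * r" .
    have ik: "integrable M (\<lambda>w. \<bar>?k' w\<bar> powr q)" "(\<integral>w. \<bar>?k' w\<bar> powr q \<partial>M) = (\<integral>x. \<bar>?k N x\<bar> powr q \<partial>P)"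
      using tail_growth_tendsto_zero(1)[OF C(1), of N]
        integrable_distr_eq[OF meas(1), of "\<lambda>x. \<bar>?k N x\<bar> powr q"]
        integral_distr[OF meas(1), of "\<lambda>x. \<bar>?k N x\<bar> powr q"] distr by auto
    have H1: "integrable M (\<lambda>w. 1 * ?D w)" "(\<integral>w. 1 * ?D w \<partial>M) \<le> ?n * r"
    proof -
      show "integrable M (\<lambda>w. 1 * ?D w)"
        using Hoelder_sum(1)[of "{()}" p q "\<lambda>_ _. 1" M "\<lambda>_. ?D"] p q iD by simp
      have "(\<integral>w. 1 * ?D w \<partial>M) \<le> 1 * (\<integral>w. ?D w powr p \<partial>M) powr (1 / p)"
        using Hoelder_sum(2)[of "{()}" p q "\<lambda>_ _. 1" M "\<lambda>_. ?D"] p q iD by (simp add: prob_space)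
      then show "(\<integral>w. 1 * ?D w \<partial>M) \<le> ?n * r" using Dnorm by simp
    qed
    have H2: "integrable M (\<lambda>w. ?k' w * ?D w)" "(\<integral>w. ?k' w * ?D w \<partial>M) \<le> \<eta> / (3 * ?n) * (?n * r)"
    proof -
      show "integrable M (\<lambda>w. ?k' w * ?D w)"
        using Hoelder_sum(1)[of "{()}" p q "\<lambda>_. ?k'" M "\<lambda>_. ?D"] p q iD ik by simp
      have "(\<integral>w. ?k' w * ?D w \<partial>M) \<le> (\<integral>x. \<bar>?k N x\<bar> powr q \<partial>P) powr (1 / q) * (\<integral>w. ?D w powr p \<partial>M) powr (1 / p)"
        using Hoelder_sum(2)[of "{()}" p q "\<lambda>_. ?k'" M "\<lambda>_. ?D"] p q iD ik by simp
      also have "\<dots> \<le> \<eta> / (3 * ?n) * (?n * r)"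
        using N Dnorm \<eta> n by (intro mult_mono) auto
      finally show "(\<integral>w. ?k' w * ?D w \<partial>M) \<le> \<eta> / (3 * ?n) * (?n * r)" .
    qed
    let ?bd = "\<lambda>w. \<eta> / (3 * ?n) * (1 * ?D w) + ?k' w * ?D w + K * ?D w powr p"
    have ibd: "integrable M ?bd" using H1(1) H2(1) iD
      by (intro Bochner_Integration.integrable_add integrable_mult_right) simp_all
    have Rle: "\<bar>remainder (X w) (Y w) (A w)\<bar> \<le> ?bd w" for w
    proof -
      have "?D w * (\<eta> / (3 * ?n) + ?k' w + K * ?D w powr (p - 1))
          = \<eta> / (3 * ?n) * (1 * ?D w) + ?k' w * ?D w + K * (?D w * ?D w powr (p - 1))"
        by (simp add: distrib_left distrib_right mult_ac)
      also have "?D w * ?D w powr (p - 1) = ?D w powr p" using p by (intro powr_minus_one_mult) auto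
      finally show ?thesis using K(2)[of "A w" "X w" "Y w"] A by simp
    qed
    have iR: "integrable M (\<lambda>w. remainder (X w) (Y w) (A w))"
    proof (rule Bochner_Integration.integrable_bound[OF ibd])
      show "(\<lambda>w. remainder (X w) (Y w) (A w)) \<in> borel_measurable M"
        unfolding remainder_def by measurable
      show "AE w in M. norm (remainder (X w) (Y w) (A w)) \<le> norm (?bd w)"
        unfolding real_norm_def using Rle by (intro AE_I2 order_trans[OF _ abs_ge_self])
    qed
    have "(\<integral>w. \<bar>remainder (X w) (Y w) (A w)\<bar> \<partial>M) \<le> (\<integral>w. ?bd w \<partial>M)"
      by (intro integral_mono Rle ibd integrable_abs iR)
    also have "\<dots> = \<eta> / (3 * ?n) * (\<integral>w. 1 * ?D w \<partial>M) + (\<integral>w. ?k' w * ?D w \<partial>M) + K * (\<integral>w. ?D w powr p \<partial>M)"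
      using H1(1) H2(1) iD
      by (simp only: Bochner_Integration.integral_add Bochner_Integration.integrable_add integrable_mult_right
          integral_mult_right_zero)
    also have "\<dots> \<le> \<eta> / (3 * ?n) * (?n * r) + \<eta> / (3 * ?n) * (?n * r) + K * (?n powr p * r powr p)"
      using H1(2) H2(2) Dp K(1) \<eta> n by (intro add_mono mult_left_mono) auto
    also have "K * (?n powr p * r powr p) \<le> \<eta> / 3 * r"
    proof -
      have "r powr (p - 1) \<le> r0 powr (p - 1)" using r p by (intro powr_mono2) auto
      also have "\<dots> = \<eta> / (3 * (K + 1) * ?n powr p)"
      proof -
        have "1 / (p - 1) * (p - 1) = 1" using p by simp
        then show ?thesis unfolding r0_def powr_powr using quot by (simp only: powr_one less_imp_le)
      qed
      finally have "(3 * (K + 1) * ?n powr p) * r powr (p - 1) \<le> \<eta>"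
        using den by (simp add: pos_le_divide_eq mult.commute)
      moreover have "(3 * (K + 1) * ?n powr p) * r powr (p - 1)
          = 3 * (K * ?n powr p * r powr (p - 1)) + 3 * (?n powr p * r powr (p - 1))"
        by (simp add: distrib_left distrib_right mult_ac)
      moreover have "0 \<le> ?n powr p * r powr (p - 1)" by simp
      ultimately have "K * ?n powr p * r powr (p - 1) \<le> \<eta> / 3" by linarith
      then have "r * (K * ?n powr p * r powr (p - 1)) \<le> r * (\<eta> / 3)"
        using r by (intro mult_left_mono) auto
      moreover have "r powr p = r * r powr (p - 1)" using r p by (intro powr_minus_one_mult[symmetric]) auto
      ultimately show ?thesis by (simp add: mult_ac)
    qed
    also have "\<eta> / (3 * ?n) * (?n * r) + \<eta> / (3 * ?n) * (?n * r) + \<eta> / 3 * r = \<eta> * r"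
      using n by (simp add: field_simps)
    finally show "integrable M (\<lambda>w. remainder (X w) (Y w) (A w)) \<and>
        (\<integral>w. \<bar>remainder (X w) (Y w) (A w)\<bar> \<partial>M) \<le> \<eta> * r"
      using iR by simp
  qed
qed

end

section \<open>Bicausal couplings\<close>

lemma finite_moment_measuresD:
  assumes "Q \<in> finite_moment_measures p"
  shows "prob_space Q" "sets Q = sets borel" "integrable Q (\<lambda>x. norm x powr p)" "space Q = UNIV"
  using assms sets_eq_imp_space_eq[of Q borel] by (auto simp: finite_moment_measures_def)

lemma vimage_sets_generated:
  assumes "A \<in> sets (generated_sigma Z UNIV)"
  obtains B where "B \<in> sets borel" "A = Z -` B"
proof -
  obtain B where "B \<in> sets (generated_sigma (\<lambda>x. x) UNIV)" "A = Z -` B"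
    by (rule sets_generated_sigma_vimage[OF assms])
  then show ?thesis by (intro that[of B] subsetD[OF sets_generated_sigma_UNIV])
qed

lemma product_coupling_bicausal:
  fixes P Q :: "(real ^ 'n::{finite,linorder}) measure"
  assumes P: "P \<in> finite_moment_measures p" and Q: "Q \<in> finite_moment_measures p"
  shows "P \<Otimes>\<^sub>M Q \<in> bicausal_couplings P Q"
proof -
  note P' = finite_moment_measuresD[OF P] and Q' = finite_moment_measuresD[OF Q]
  interpret M1: prob_space P by (rule P')
  interpret M2: prob_space Q by (rule Q')
  interpret pair_prob_space P Q ..
  let ?\<pi> = "P \<Otimes>\<^sub>M Q"
  have sets_\<pi>: "sets ?\<pi> = sets borel"
    unfolding borel_prod[symmetric] by (rule sets_pair_measure_cong[OF P'(2) Q'(2)])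
  have space_\<pi>: "space ?\<pi> = UNIV" using P'(4) Q'(4) by (simp add: space_pair_measure)
  have rect: "emeasure ?\<pi> (fst -` A \<inter> snd -` B) = emeasure P A * emeasure Q B"
    if "A \<in> sets borel" "B \<in> sets borel" for A B
  proof -
    have "fst -` A \<inter> snd -` B = A \<times> B" by auto
    moreover have "A \<in> sets P" "B \<in> sets Q" using that P'(2) Q'(2) by simp_all
    ultimately show ?thesis using M2.emeasure_pair_measure_Times by metis
  qed
  have meas: "fst \<in> borel_measurable ?\<pi>" "snd \<in> borel_measurable ?\<pi>"
    unfolding measurable_cong_sets[OF sets_\<pi> refl] by (simp_all add: borel_prod[symmetric])
  have one: "emeasure P UNIV = 1" "emeasure Q UNIV = 1"
    using M1.emeasure_space_1 M2.emeasure_space_1 P' Q' by auto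
  have "distr ?\<pi> borel fst = P"
  proof (rule measure_eqI)
    fix A assume "A \<in> sets (distr ?\<pi> borel fst)"
    then have A: "A \<in> sets borel" by simp
    show "emeasure (distr ?\<pi> borel fst) A = emeasure P A"
      using rect[OF A, of UNIV] one by (simp add: emeasure_distr[OF meas(1) A] space_\<pi>)
  qed (simp add: P')
  moreover have "distr ?\<pi> borel snd = Q"
  proof (rule measure_eqI)
    fix A assume "A \<in> sets (distr ?\<pi> borel snd)"
    then have A: "A \<in> sets borel" by simp
    show "emeasure (distr ?\<pi> borel snd) A = emeasure Q A"
      using rect[OF _ A, of UNIV] one by (simp add: emeasure_distr[OF meas(2) A] space_\<pi>)
  qed (simp add: Q')
  ultimately have coupling: "?\<pi> \<in> couplings P Q"
    using sets_\<pi> by (simp add: couplings_def prob_space_axioms)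
  have indep: "measure ?\<pi> (fst -` A \<inter> snd -` B) = measure ?\<pi> (fst -` A) * measure ?\<pi> (snd -` B)"
    if "A \<in> sets borel" "B \<in> sets borel" for A B
    using rect[OF that] rect[OF that(1), of UNIV] rect[OF _ that(2), of UNIV] one
    by (simp add: measure_def enn2real_mult)
  have "causal ?\<pi> fst snd"
  proof (rule coupled_processes.causal_of_independent[OF coupled_processes_coupling(1)[OF coupling]])
    fix A E :: "((real, 'n) vec \<times> (real, 'n) vec) set"
    assume A: "A \<in> sets (generated_sigma fst UNIV)" and E: "E \<in> sets (generated_sigma snd UNIV)"
    obtain A' where A': "A' \<in> sets borel" "A = fst -` A'" by (rule vimage_sets_generated[OF A])
    obtain E' where E': "E' \<in> sets borel" "E = snd -` E'" by (rule vimage_sets_generated[OF E])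
    show "measure ?\<pi> (A \<inter> E) = measure ?\<pi> A * measure ?\<pi> E"
      using indep A' E' by simp
  qed
  moreover have "causal ?\<pi> snd fst"
  proof (rule coupled_processes.causal_of_independent[OF coupled_processes_coupling(2)[OF coupling]])
    fix A E :: "((real, 'n) vec \<times> (real, 'n) vec) set"
    assume A: "A \<in> sets (generated_sigma snd UNIV)" and E: "E \<in> sets (generated_sigma fst UNIV)"
    obtain A' where A': "A' \<in> sets borel" "A = snd -` A'" by (rule vimage_sets_generated[OF A])
    obtain E' where E': "E' \<in> sets borel" "E = fst -` E'" by (rule vimage_sets_generated[OF E])
    show "measure ?\<pi> (A \<inter> E) = measure ?\<pi> A * measure ?\<pi> E"
      using indep[of E' A'] A' E' by (simp add: Int_commute mult.commute)
  qed
  ultimately show ?thesis using coupling by (simp add: bicausal_couplings_def)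
qed

text \<open>The infimum defining the adapted Wasserstein distance need not be attained, hence the slack between \<open>r\<close>
  and \<open>r'\<close>.  The product coupling shows that it ranges over a nonempty set.\<close>

lemma aw_ball_coupling:
  assumes "1 < p" and P: "P \<in> finite_moment_measures p" and Q: "Q \<in> aw_ball p P r"
    and r: "0 \<le> r" "r < r'"
  obtains \<pi> where "\<pi> \<in> bicausal_couplings P Q" "transport_cost p \<pi> fst snd \<le> r' powr p"
proof -
  let ?S = "(\<lambda>\<pi>. transport_cost p \<pi> fst snd powr (1 / p)) ` bicausal_couplings P Q"
  have Q': "Q \<in> finite_moment_measures p" "Inf ?S \<le> r"
    using Q by (auto simp: aw_ball_def adapted_wasserstein_def transport_cost_def)
  have "?S \<noteq> {}" using product_coupling_bicausal[OF P Q'(1)] by blast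
  moreover have "Inf ?S < r'" using Q'(2) r by simp
  ultimately obtain y where "y \<in> ?S" "y < r'" by (rule cInf_lessD[THEN bexE])
  then obtain \<pi> where \<pi>: "\<pi> \<in> bicausal_couplings P Q" "transport_cost p \<pi> fst snd powr (1 / p) < r'" by blast
  have "transport_cost p \<pi> fst snd = (transport_cost p \<pi> fst snd powr (1 / p)) powr p"
    using assms(1) transport_cost_nonneg[of p \<pi> fst snd] by (simp add: powr_powr)
  also have "\<dots> \<le> r' powr p" using \<pi>(2) assms(1) by (intro powr_mono2) auto
  finally show ?thesis using \<pi>(1) that by blast
qed

section \<open>The upper bound\<close>

context control_problem
begin

lemma integrable_grad_powr:
  assumes a: "a \<in> controls L"
  shows "integrable P (\<lambda>x. \<bar>grad_x x (a x) $ t\<bar> powr q)"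
proof -
  interpret prob_space P by (rule prob_P)
  obtain C where C: "C > 0" "\<And>x a. a \<in> control_box L \<Longrightarrow> norm (grad_x x a) \<le> C * (1 + norm x powr (p - 1))"
    using grad_x_bound by blast
  have [measurable]: "a \<in> borel_measurable borel" by (rule controls_measurable[OF a])
  show ?thesis
  proof (rule Bochner_Integration.integrable_bound)
    show "integrable P (\<lambda>x. C powr q * (2 powr q * (1 + norm x powr p)))" using moment_P by simp
    have "\<bar>grad_x x (a x) $ t\<bar> powr q \<le> C powr q * (2 powr q * (1 + norm x powr p))" for x
    proof -
      have "\<bar>grad_x x (a x) $ t\<bar> \<le> C * (1 + norm x powr (p - 1))"
        using component_le_norm_cart C(2)[OF controls_box[OF a]] by (rule order_trans)
      then have "\<bar>grad_x x (a x) $ t\<bar> powr q \<le> (C * (1 + norm x powr (p - 1))) powr q"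
        using q(1) by (intro powr_mono2) auto
      also have "\<dots> = C powr q * (1 + norm x powr (p - 1)) powr q"
        using C(1) by (simp add: powr_mult)
      also have "\<dots> \<le> C powr q * (2 powr q * (1 powr q + (norm x powr (p - 1)) powr q))"
        using q(1) by (intro mult_left_mono powr_add_le) auto
      also have "\<dots> = C powr q * (2 powr q * (1 + norm x powr p))" by (simp add: powr_powr q(3))
      finally show ?thesis .
    qed
    then show "AE x in P. norm (\<bar>grad_x x (a x) $ t\<bar> powr q) \<le> norm (C powr q * (2 powr q * (1 + norm x powr p)))"
      by (auto intro!: AE_I2 order_trans[OF _ abs_ge_self])
  qed (simp add: measurable_P)
qed

lemma integrable_grad:
  assumes a: "a \<in> controls L"
  shows "integrable P (\<lambda>x. grad_x x (a x) $ t)"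
  using integrable_grad_x[OF a, of "\<lambda>_. axis t 1" 1] by (simp add: inner_axis)

text \<open>The projection of the \<open>t\<close>-th partial derivative, along the control \<open>a\<close>, on the information at
  time \<open>t\<close>.\<close>

definition adapted_grad :: "((real, 'n) vec \<Rightarrow> (real, 'n) vec) \<Rightarrow> 'n \<Rightarrow> (real, 'n) vec \<Rightarrow> real" where
  "adapted_grad a t = real_cond_exp P (canonical_filtration t) (\<lambda>x. grad_x x (a x) $ t)"

text \<open>The coefficient of \<open>r\<close> in the expansion, as a function of the control.\<close>

definition sensitivity :: "((real, 'n) vec \<Rightarrow> (real, 'n) vec) \<Rightarrow> real" where
  "sensitivity a = (\<Sum>t\<in>UNIV. \<integral>x. \<bar>adapted_grad a t x\<bar> powr q \<partial>P) powr (1 / q)"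

lemma sensitivity_nonneg: "0 \<le> sensitivity a"
  by (simp add: sensitivity_def)

lemma filtration_subalgebra: "finite_measure_subalgebra P (canonical_filtration t)"
proof -
  interpret prob_space P by (rule prob_P)
  show ?thesis
    by unfold_locales (rule subalgebra_generated_sigma, simp_all add: measurable_P space_P)
qed

lemma adapted_grad_measurable_filtration: "adapted_grad a t \<in> borel_measurable (canonical_filtration t)"
  unfolding adapted_grad_def by (rule borel_measurable_cond_exp)

lemma adapted_grad_measurable [measurable]: "adapted_grad a t \<in> borel_measurable borel"
  using borel_measurable_cond_exp2[of P "canonical_filtration t"]
  unfolding adapted_grad_def measurable_P .

lemma integrable_adapted_grad:
  assumes a: "a \<in> controls L"
  shows "integrable P (adapted_grad a t)"
    and "integrable P (\<lambda>x. \<bar>adapted_grad a t x\<bar> powr q)"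
proof -
  interpret F: finite_measure_subalgebra P "canonical_filtration t" by (rule filtration_subalgebra)
  let ?g = "\<lambda>x. grad_x x (a x) $ t"
  show "integrable P (adapted_grad a t)"
    unfolding adapted_grad_def by (rule F.real_cond_exp_int(1)[OF integrable_grad[OF a]])
  have "AE x in P. \<bar>adapted_grad a t x\<bar> powr q \<le> real_cond_exp P (canonical_filtration t) (\<lambda>x. \<bar>?g x\<bar> powr q) x"
    unfolding adapted_grad_def
    by (rule F.real_cond_exp_jensens_inequality(2)[where I = UNIV and q = "\<lambda>u. \<bar>u\<bar> powr q"])
      (use integrable_grad[OF a] integrable_grad_powr[OF a] q(1) in \<open>auto intro: convex_on_abs_powr\<close>)
  then have "AE x in P. norm (\<bar>adapted_grad a t x\<bar> powr q)
      \<le> norm (real_cond_exp P (canonical_filtration t) (\<lambda>x. \<bar>?g x\<bar> powr q) x)"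
    by eventually_elim (simp add: order_trans[OF _ abs_ge_self])
  moreover have "(\<lambda>x. \<bar>adapted_grad a t x\<bar> powr q) \<in> borel_measurable P"
    unfolding measurable_P by measurable
  ultimately show "integrable P (\<lambda>x. \<bar>adapted_grad a t x\<bar> powr q)"
    by (intro Bochner_Integration.integrable_bound[OF F.real_cond_exp_int(1)[OF integrable_grad_powr[OF a]]])
qed

lemma integrable_mult_Hoelder:
  fixes u v :: "'a \<Rightarrow> real"
  assumes "u \<in> borel_measurable M" "v \<in> borel_measurable M"
    "integrable M (\<lambda>x. \<bar>u x\<bar> powr q)" "integrable M (\<lambda>x. \<bar>v x\<bar> powr p)"
  shows "integrable M (\<lambda>x. u x * v x)"
  using Hoelder_sum(1)[of "{()}" p q "\<lambda>_. u" M "\<lambda>_. v"] p q assms by simp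

text \<open>Causality from the first to the second coordinate allows each partial derivative to be replaced by its
  projection on the information at the time of the corresponding displacement; Hoelder's inequality does the
  rest.\<close>

lemma first_order_term_le:
  assumes a: "a \<in> controls L" and Q: "Q \<in> finite_moment_measures p"
    and \<pi>: "\<pi> \<in> couplings P Q" and causal: "causal \<pi> fst snd"
  shows "integrable \<pi> (\<lambda>\<omega>. grad_x (fst \<omega>) (a (fst \<omega>)) \<bullet> (snd \<omega> - fst \<omega>))"
    and "\<And>t. integrable \<pi> (\<lambda>\<omega>. \<bar>fst \<omega> $ t - snd \<omega> $ t\<bar> powr p)"
    and "(\<integral>\<omega>. grad_x (fst \<omega>) (a (fst \<omega>)) \<bullet> (snd \<omega> - fst \<omega>) \<partial>\<pi>)
      \<le> sensitivity a * transport_cost p \<pi> fst snd powr (1 / p)"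
proof -
  interpret coupled_processes \<pi> fst snd by (rule coupled_processes_coupling[OF \<pi>])
  have distr: "distr \<pi> borel fst = P" "distr \<pi> borel snd = Q" using \<pi> by (auto simp: couplings_def)
  have [measurable]: "a \<in> borel_measurable borel" by (rule controls_measurable[OF a])
  have pullback: "integrable \<pi> (\<lambda>\<omega>. k (fst \<omega>))"
    if "integrable P k" "k \<in> borel_measurable borel" for k :: "(real, 'n) vec \<Rightarrow> real"
    using integrable_distr_eq[OF X that(2)] that(1) distr by simp
  have mX: "integrable \<pi> (\<lambda>\<omega>. norm (fst \<omega>) powr p)"
    by (rule pullback[OF moment_P]) measurable
  have mY: "integrable \<pi> (\<lambda>\<omega>. norm (snd \<omega>) powr p)"
    using integrable_distr_eq[OF Y, of "\<lambda>x. norm x powr p"] finite_moment_measuresD(3)[OF Q] distr by simp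
  have p0: "0 \<le> p" using p by simp
  note iX = integrable_component_powr[OF p0 X mX] and iY = integrable_component_powr[OF p0 Y mY]
  have iD: "integrable \<pi> (\<lambda>\<omega>. \<bar>snd \<omega> $ t - fst \<omega> $ t\<bar> powr p)" for t
    by (rule integrable_abs_diff_powr[OF p0 _ _ iY iX]) measurable
  then show iD': "integrable \<pi> (\<lambda>\<omega>. \<bar>fst \<omega> $ t - snd \<omega> $ t\<bar> powr p)" for t
    by (simp add: abs_minus_commute)
  let ?g = "\<lambda>t \<omega>. grad_x (fst \<omega>) (a (fst \<omega>)) $ t"
  let ?h = "\<lambda>t \<omega>. adapted_grad a t (fst \<omega>)"
  have ig: "integrable \<pi> (\<lambda>\<omega>. \<bar>?g t \<omega>\<bar> powr q)" for t
    by (rule pullback[OF integrable_grad_powr[OF a]]) measurable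
  have ih: "integrable \<pi> (\<lambda>\<omega>. \<bar>?h t \<omega>\<bar> powr q)" for t
    by (rule pullback[OF integrable_adapted_grad(2)[OF a]]) measurable
  have igX: "integrable \<pi> (\<lambda>\<omega>. ?g t \<omega> * fst \<omega> $ t)" for t
    by (rule integrable_mult_Hoelder[OF _ _ ig iX]) measurable
  have igY: "integrable \<pi> (\<lambda>\<omega>. ?g t \<omega> * snd \<omega> $ t)" for t
    by (rule integrable_mult_Hoelder[OF _ _ ig iY]) measurable
  have ihX: "integrable \<pi> (\<lambda>\<omega>. ?h t \<omega> * fst \<omega> $ t)" for t
    by (rule integrable_mult_Hoelder[OF _ _ ih iX]) measurable
  have ihY: "integrable \<pi> (\<lambda>\<omega>. ?h t \<omega> * snd \<omega> $ t)" for t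
    by (rule integrable_mult_Hoelder[OF _ _ ih iY]) measurable
  have project: "(\<integral>\<omega>. ?g t \<omega> * (snd \<omega> $ t - fst \<omega> $ t) \<partial>\<pi>) = (\<integral>\<omega>. ?h t \<omega> * (snd \<omega> $ t - fst \<omega> $ t) \<partial>\<pi>)" for t
  proof -
    let ?G = "generated_sigma fst {..t}"
    interpret G: finite_measure_subalgebra \<pi> ?G by (rule cond_exp_X)
    let ?E = "real_cond_exp \<pi> ?G (?g t)"
    have E: "AE \<omega> in \<pi>. ?E \<omega> = ?h t \<omega>"
      unfolding adapted_grad_def
      by (rule real_cond_exp_distr[OF distr(1) integrable_grad[OF a]])
    have [measurable]: "?E \<in> borel_measurable \<pi>" by (rule borel_measurable_cond_exp2)
    have g1: "integrable \<pi> (?g t)" by (rule pullback[OF integrable_grad[OF a]]) measurable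
    have gm: "?g t \<in> borel_measurable (generated_sigma fst UNIV)"
    proof (rule adapted_measurable_generated_sigma[where \<phi> = "\<lambda>x. grad_x x (a x) $ t"])
      show "(\<lambda>x. grad_x x (a x) $ t) \<in> borel_measurable borel" by measurable
      fix x y :: "(real, 'n) vec" assume "\<And>s. s \<in> UNIV \<Longrightarrow> x $ s = y $ s"
      then have "x = y" by (simp add: vec_eq_iff)
      then show "grad_x x (a x) $ t = grad_x y (a y) $ t" by simp
    qed
    have iEY: "integrable \<pi> (\<lambda>\<omega>. ?E \<omega> * snd \<omega> $ t)"
      by (rule integrable_cong_AE_imp[OF ihY[of t]]) (use E in auto)
    have "(\<integral>\<omega>. ?g t \<omega> * snd \<omega> $ t \<partial>\<pi>) = (\<integral>\<omega>. ?E \<omega> * snd \<omega> $ t \<partial>\<pi>)"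
      by (rule causal_integral[OF causal generated_sigma_coordinate gm g1 igY iEY]) simp
    also have "\<dots> = (\<integral>\<omega>. ?h t \<omega> * snd \<omega> $ t \<partial>\<pi>)"
      using E by (intro integral_cong_AE) auto
    finally have 1: "(\<integral>\<omega>. ?g t \<omega> * snd \<omega> $ t \<partial>\<pi>) = (\<integral>\<omega>. ?h t \<omega> * snd \<omega> $ t \<partial>\<pi>)" .
    have "(\<integral>\<omega>. fst \<omega> $ t * ?g t \<omega> \<partial>\<pi>) = (\<integral>\<omega>. fst \<omega> $ t * ?E \<omega> \<partial>\<pi>)"
    proof (rule G.real_cond_exp_intg(2)[symmetric])
      show "integrable \<pi> (\<lambda>\<omega>. fst \<omega> $ t * ?g t \<omega>)" using igX[of t] by (simp add: mult.commute)
      show "(\<lambda>\<omega>. fst \<omega> $ t) \<in> borel_measurable ?G" by (rule generated_sigma_coordinate) simp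
    qed measurable
    also have "\<dots> = (\<integral>\<omega>. ?h t \<omega> * fst \<omega> $ t \<partial>\<pi>)"
      using E by (intro integral_cong_AE) (auto simp: mult.commute)
    finally have 2: "(\<integral>\<omega>. ?g t \<omega> * fst \<omega> $ t \<partial>\<pi>) = (\<integral>\<omega>. ?h t \<omega> * fst \<omega> $ t \<partial>\<pi>)"
      by (simp add: mult.commute)
    show ?thesis
      using 1 2 igX igY ihX ihY by (simp add: right_diff_distrib)
  qed
  have igD: "integrable \<pi> (\<lambda>\<omega>. ?g t \<omega> * (snd \<omega> $ t - fst \<omega> $ t))" for t
    using igX igY by (simp add: right_diff_distrib)
  show "integrable \<pi> (\<lambda>\<omega>. grad_x (fst \<omega>) (a (fst \<omega>)) \<bullet> (snd \<omega> - fst \<omega>))"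
    using igD by (simp add: inner_vec_def)
  have hnorm: "(\<integral>\<omega>. \<bar>?h t \<omega>\<bar> powr q \<partial>\<pi>) = (\<integral>x. \<bar>adapted_grad a t x\<bar> powr q \<partial>P)" for t
  proof -
    have "(\<lambda>x. \<bar>adapted_grad a t x\<bar> powr q) \<in> borel_measurable borel" by measurable
    from integral_distr[OF X this] show ?thesis by (simp add: distr(1))
  qed
  have "(\<integral>\<omega>. grad_x (fst \<omega>) (a (fst \<omega>)) \<bullet> (snd \<omega> - fst \<omega>) \<partial>\<pi>)
      = (\<Sum>t\<in>UNIV. \<integral>\<omega>. ?g t \<omega> * (snd \<omega> $ t - fst \<omega> $ t) \<partial>\<pi>)"
    using igD by (simp add: inner_vec_def)
  also have "\<dots> = (\<Sum>t\<in>UNIV. \<integral>\<omega>. ?h t \<omega> * (snd \<omega> $ t - fst \<omega> $ t) \<partial>\<pi>)"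
    by (simp only: project)
  also have "\<dots> \<le> (\<Sum>t\<in>UNIV. \<integral>\<omega>. \<bar>?h t \<omega>\<bar> powr q \<partial>\<pi>) powr (1 / q)
      * (\<Sum>t\<in>UNIV. \<integral>\<omega>. \<bar>snd \<omega> $ t - fst \<omega> $ t\<bar> powr p \<partial>\<pi>) powr (1 / p)"
    using p q ih iD by (intro Hoelder_sum(2)) auto
  finally show "(\<integral>\<omega>. grad_x (fst \<omega>) (a (fst \<omega>)) \<bullet> (snd \<omega> - fst \<omega>) \<partial>\<pi>)
      \<le> sensitivity a * transport_cost p \<pi> fst snd powr (1 / p)"
    by (simp add: sensitivity_def transport_cost_def abs_minus_commute hnorm)
qed

text \<open>The optimal control for \<open>P\<close>, projected along a nearly optimal bicausal coupling, is a competitor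
  for \<open>Q\<close>.\<close>

lemma value_upper_bound:
  assumes a: "a \<in> controls L" and opt: "control_value f L P = (\<integral>x. f x (a x) \<partial>P)" and \<eta>: "0 < \<eta>"
  shows "\<exists>r0>0. \<forall>r. 0 < r \<longrightarrow> r < r0 \<longrightarrow> (\<forall>Q\<in>aw_ball p P r.
    control_value f L Q \<le> control_value f L P + r * sensitivity a + \<eta> * r)"
proof -
  let ?v = "control_value f L"
  let ?V = "sensitivity a"
  from \<eta> have "0 < \<eta> / 2" by simp
  then obtain r0 where r0: "0 < r0"
    "\<And>r (M :: ((real, 'n) vec \<times> (real, 'n) vec) measure) X Y A. \<lbrakk>0 < r; r < r0; prob_space M;
      X \<in> borel_measurable M; Y \<in> borel_measurable M; A \<in> borel_measurable M;
      distr M borel X = P; \<And>w. A w \<in> control_box L;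
      \<And>t. integrable M (\<lambda>w. \<bar>X w $ t - Y w $ t\<bar> powr p); transport_cost p M X Y \<le> r powr p\<rbrakk> \<Longrightarrow>
      integrable M (\<lambda>w. remainder (X w) (Y w) (A w)) \<and>
        (\<integral>w. \<bar>remainder (X w) (Y w) (A w)\<bar> \<partial>M) \<le> \<eta> / 2 * r"
    by (rule expected_remainder[where 'w = "(real, 'n) vec \<times> (real, 'n) vec"]) (rule that; blast)
  have [measurable]: "a \<in> borel_measurable borel" by (rule controls_measurable[OF a])
  have main: "?v Q \<le> ?v P + r' * (?V + \<eta> / 2)"
    if r: "0 < r" "r < r'" "r' < r0" and Q: "Q \<in> aw_ball p P r" for r r' Q
  proof -
    have Q': "Q \<in> finite_moment_measures p" using Q by (simp add: aw_ball_def)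
    obtain \<pi> where \<pi>: "\<pi> \<in> bicausal_couplings P Q" "transport_cost p \<pi> fst snd \<le> r' powr p"
      using aw_ball_coupling[OF p P Q _ r(2)] r(1) by auto
    then have c: "\<pi> \<in> couplings P Q" "causal \<pi> fst snd" "causal \<pi> snd fst"
      by (auto simp: bicausal_couplings_def)
    interpret coupled_processes \<pi> fst snd by (rule coupled_processes_coupling[OF c(1)])
    have distr: "distr \<pi> borel fst = P" "distr \<pi> borel snd = Q" using c by (auto simp: couplings_def)
    note fo = first_order_term_le[OF a Q' c(1,2)]
    have rem: "integrable \<pi> (\<lambda>\<omega>. remainder (fst \<omega>) (snd \<omega>) (a (fst \<omega>)))"
      "(\<integral>\<omega>. \<bar>remainder (fst \<omega>) (snd \<omega>) (a (fst \<omega>))\<bar> \<partial>\<pi>) \<le> \<eta> / 2 * r'"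
      using r0(2)[OF _ r(3) prob_space_axioms X Y _ distr(1) controls_box[OF a] fo(2) \<pi>(2)] r(1,2)
      by simp_all
    have ifX: "integrable \<pi> (\<lambda>\<omega>. f (fst \<omega>) (a (fst \<omega>)))"
      "(\<integral>\<omega>. f (fst \<omega>) (a (fst \<omega>)) \<partial>\<pi>) = ?v P"
      using integrable_cost_control[OF P a] integrable_distr_eq[OF X, of "\<lambda>x. f x (a x)"]
        integral_distr[OF X, of "\<lambda>x. f x (a x)"] distr opt by auto
    obtain b where b: "b \<in> controls L" "(\<integral>y. f y (b y) \<partial>Q) \<le> (\<integral>\<omega>. f (snd \<omega>) (a (fst \<omega>)) \<partial>\<pi>)"
      using transfer_control[OF c(1,3) Q' a] by blast
    have "?v Q \<le> (\<integral>\<omega>. f (snd \<omega>) (a (fst \<omega>)) \<partial>\<pi>)"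
      using control_value_le[OF Q' b(1)] b(2) by simp
    also have "\<dots> = (\<integral>\<omega>. f (fst \<omega>) (a (fst \<omega>)) + grad_x (fst \<omega>) (a (fst \<omega>)) \<bullet> (snd \<omega> - fst \<omega>)
        + remainder (fst \<omega>) (snd \<omega>) (a (fst \<omega>)) \<partial>\<pi>)"
      by (simp add: remainder_def)
    also have "\<dots> = ?v P + (\<integral>\<omega>. grad_x (fst \<omega>) (a (fst \<omega>)) \<bullet> (snd \<omega> - fst \<omega>) \<partial>\<pi>)
        + (\<integral>\<omega>. remainder (fst \<omega>) (snd \<omega>) (a (fst \<omega>)) \<partial>\<pi>)"
      using ifX fo(1) rem(1) by simp
    also have "(\<integral>\<omega>. remainder (fst \<omega>) (snd \<omega>) (a (fst \<omega>)) \<partial>\<pi>) \<le> \<eta> / 2 * r'"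
      using rem(2) integral_abs_bound[of \<pi> "\<lambda>\<omega>. remainder (fst \<omega>) (snd \<omega>) (a (fst \<omega>))"] by linarith
    also have "(\<integral>\<omega>. grad_x (fst \<omega>) (a (fst \<omega>)) \<bullet> (snd \<omega> - fst \<omega>) \<partial>\<pi>) \<le> ?V * r'"
    proof -
      have "transport_cost p \<pi> fst snd powr (1 / p) \<le> (r' powr p) powr (1 / p)"
        using \<pi>(2) p transport_cost_nonneg[of p \<pi> fst snd] by (intro powr_mono2) auto
      also have "\<dots> = r'" using r p by (simp add: powr_powr)
      finally show ?thesis
        using fo(3) sensitivity_nonneg[of a] by (meson mult_left_mono order_trans)
    qed
    finally show ?thesis by (simp add: algebra_simps)
  qed
  show ?thesis
  proof (rule exI[of _ "r0 / 2"], intro conjI allI impI ballI)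
    show "0 < r0 / 2" using r0 by simp
    fix r Q assume r: "0 < r" "r < r0 / 2" and Q: "Q \<in> aw_ball p P r"
    \<comment> \<open>A slightly larger radius, chosen so that the slack costs exactly the remaining half of \<open>\<eta>\<close>.\<close>
    define r' where "r' = r * ((?V + \<eta>) / (?V + \<eta> / 2))"
    have V: "0 \<le> ?V" by (rule sensitivity_nonneg)
    have "1 < (?V + \<eta>) / (?V + \<eta> / 2)" "(?V + \<eta>) / (?V + \<eta> / 2) \<le> 2"
      using V \<eta> by (simp_all add: field_simps)
    then have "r < r'" "r' \<le> r * 2" unfolding r'_def using r by (simp_all only: mult_less_cancel_left1 mult_le_cancel_left_pos) auto
    then have "?v Q \<le> ?v P + r' * (?V + \<eta> / 2)" using r Q by (intro main[of r]) auto
    also have "r' * (?V + \<eta> / 2) = r * (?V + \<eta>)" using V \<eta> by (simp add: r'_def)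
    finally show "?v Q \<le> ?v P + r * ?V + \<eta> * r" by (simp add: algebra_simps)
  qed
qed

end

section \<open>Lipschitz functions of a part of the path\<close>

text \<open>Bounded functions that are Lipschitz continuous as functions of the coordinates in \<open>I\<close>; in
  particular they do not depend on the other coordinates.\<close>

definition lipschitz_coords :: "'n set \<Rightarrow> (real ^ 'n::finite \<Rightarrow> real) \<Rightarrow> bool" where
  "lipschitz_coords I \<psi> \<longleftrightarrow>
    (\<exists>K\<ge>0. \<forall>x y. \<bar>\<psi> x - \<psi> y\<bar> \<le> K * norm (restrict_coords I x - restrict_coords I y)) \<and>
    (\<exists>B. \<forall>x. \<bar>\<psi> x\<bar> \<le> B)"

lemma lipschitz_coordsI:
  assumes "\<And>x y. \<bar>\<psi> x - \<psi> y\<bar> \<le> K * norm (restrict_coords I x - restrict_coords I y)"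
    "\<And>x. \<bar>\<psi> x\<bar> \<le> B" "0 \<le> K"
  shows "lipschitz_coords I \<psi>"
  using assms unfolding lipschitz_coords_def by blast

lemma restrict_coords_diff: "restrict_coords I x - restrict_coords I y = restrict_coords I (x - y)"
  by (simp add: vec_eq_iff)

lemma norm_restrict_coords_mono:
  assumes "I \<subseteq> J" shows "norm (restrict_coords I x) \<le> norm (restrict_coords J x)"
  by (rule norm_le_componentwise_cart) (use assms in auto)

lemma norm_restrict_coords_le: "norm (restrict_coords I x) \<le> norm x"
  by (rule norm_le_componentwise_cart) auto

lemma restrict_coords_borel [measurable]: "restrict_coords I \<in> borel_measurable borel"
  by (rule borel_measurable_vecI) simp

lemma lipschitz_coords_const: "lipschitz_coords I (\<lambda>_. c)"
  by (rule lipschitz_coordsI[of _ 0 _ "\<bar>c\<bar>"]) auto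

lemma lipschitz_coords_measurable:
  assumes "lipschitz_coords I \<psi>" shows "\<psi> \<in> borel_measurable borel"
proof -
  obtain K where K: "K \<ge> 0" "\<And>x y. \<bar>\<psi> x - \<psi> y\<bar> \<le> K * norm (restrict_coords I x - restrict_coords I y)"
    using assms by (auto simp: lipschitz_coords_def)
  have "K-lipschitz_on UNIV \<psi>"
  proof (rule lipschitz_onI)
    show "dist (\<psi> x) (\<psi> y) \<le> K * dist x y" for x y
      using order_trans[OF K(2)[unfolded restrict_coords_diff] mult_left_mono[OF norm_restrict_coords_le K(1)]]
      by (simp add: dist_norm)
  qed fact
  then show ?thesis by (intro borel_measurable_continuous_onI lipschitz_on_continuous_on)
qed

lemma lipschitz_coords_adapted:
  assumes "lipschitz_coords I \<psi>" "\<And>s. s \<in> I \<Longrightarrow> x $ s = y $ s" shows "\<psi> x = \<psi> y"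
proof -
  have "restrict_coords I x - restrict_coords I y = 0" using assms(2) by (simp add: vec_eq_iff)
  moreover obtain K where "\<bar>\<psi> x - \<psi> y\<bar> \<le> K * norm (restrict_coords I x - restrict_coords I y)"
    using assms(1) unfolding lipschitz_coords_def by blast
  ultimately show ?thesis by simp
qed

lemma lipschitz_coords_add:
  assumes "lipschitz_coords I \<phi>" "lipschitz_coords I \<psi>"
  shows "lipschitz_coords I (\<lambda>x. \<phi> x + \<psi> x)"
proof -
  obtain K B where K: "K \<ge> 0" "\<And>x y. \<bar>\<phi> x - \<phi> y\<bar> \<le> K * norm (restrict_coords I x - restrict_coords I y)"
    "\<And>x. \<bar>\<phi> x\<bar> \<le> B" using assms(1) by (auto simp: lipschitz_coords_def)
  obtain K' B' where K': "K' \<ge> 0" "\<And>x y. \<bar>\<psi> x - \<psi> y\<bar> \<le> K' * norm (restrict_coords I x - restrict_coords I y)"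
    "\<And>x. \<bar>\<psi> x\<bar> \<le> B'" using assms(2) by (auto simp: lipschitz_coords_def)
  have "\<bar>\<phi> x + \<psi> x - (\<phi> y + \<psi> y)\<bar> \<le> (K + K') * norm (restrict_coords I x - restrict_coords I y)" for x y
    using K(2)[of x y] K'(2)[of x y] by (simp add: distrib_right)
  moreover have "\<bar>\<phi> x + \<psi> x\<bar> \<le> B + B'" for x using K(3)[of x] K'(3)[of x] by linarith
  ultimately show ?thesis using K(1) K'(1) by (intro lipschitz_coordsI[of _ "K + K'" _ "B + B'"]) auto
qed

lemma lipschitz_coords_scale:
  assumes "lipschitz_coords I \<phi>"
  shows "lipschitz_coords I (\<lambda>x. c * \<phi> x)"
proof -
  obtain K B where K: "K \<ge> 0" "\<And>x y. \<bar>\<phi> x - \<phi> y\<bar> \<le> K * norm (restrict_coords I x - restrict_coords I y)"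
    "\<And>x. \<bar>\<phi> x\<bar> \<le> B" using assms(1) by (auto simp: lipschitz_coords_def)
  have "\<bar>c * \<phi> x - c * \<phi> y\<bar> \<le> \<bar>c\<bar> * K * norm (restrict_coords I x - restrict_coords I y)" for x y
    using mult_left_mono[OF K(2)[of x y], of "\<bar>c\<bar>"] by (simp add: abs_mult right_diff_distrib[symmetric] mult.assoc)
  moreover have "\<bar>c * \<phi> x\<bar> \<le> \<bar>c\<bar> * B" for x using mult_left_mono[OF K(3)[of x], of "\<bar>c\<bar>"] by (simp add: abs_mult)
  ultimately show ?thesis using K(1) by (intro lipschitz_coordsI[of _ "\<bar>c\<bar> * K" _ "\<bar>c\<bar> * B"]) auto
qed

lemma lipschitz_coords_clamp:
  assumes "lipschitz_coords I \<phi>"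
  shows "lipschitz_coords I (\<lambda>x. max (- M) (min M (\<phi> x)))"
proof -
  obtain K where K: "K \<ge> 0" "\<And>x y. \<bar>\<phi> x - \<phi> y\<bar> \<le> K * norm (restrict_coords I x - restrict_coords I y)"
    using assms(1) by (auto simp: lipschitz_coords_def)
  have "\<bar>max (- M) (min M (\<phi> x)) - max (- M) (min M (\<phi> y))\<bar> \<le> \<bar>\<phi> x - \<phi> y\<bar>" for x y
    by (auto simp: max_def min_def)
  then have "\<bar>max (- M) (min M (\<phi> x)) - max (- M) (min M (\<phi> y))\<bar> \<le> K * norm (restrict_coords I x - restrict_coords I y)" for x y
    by (rule order_trans[OF _ K(2)])
  moreover have "\<bar>max (- M) (min M (\<phi> x))\<bar> \<le> \<bar>M\<bar>" for x by (auto simp: max_def min_def)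
  ultimately show ?thesis using K(1) by (intro lipschitz_coordsI[of _ K _ "\<bar>M\<bar>"]) auto
qed

text \<open>A measurable set of paths depending on the coordinates in \<open>I\<close> is approximated from within by
  a compact set of restricted paths, and the indicator of the latter by Lipschitz functions.\<close>

lemma lipschitz_coords_approx_indicator:
  fixes P :: "(real ^ 'n::finite) measure"
  assumes "finite_measure P" and sets_P: "sets P = sets borel"
    and A: "A \<in> sets (generated_sigma (\<lambda>x. x) I)" and e: "0 < e"
  shows "\<exists>\<psi>. lipschitz_coords I \<psi> \<and> (\<integral>x. \<bar>indicator A x - \<psi> x\<bar> \<partial>P) < e"
proof -
  interpret finite_measure P by fact
  have measP: "borel_measurable P = borel_measurable borel" by (rule measurable_cong_sets[OF sets_P refl])
  have spaceP: "space P = UNIV" using sets_eq_imp_space_eq[OF sets_P] by simp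
  have Ab [measurable]: "A \<in> sets borel" using A sets_generated_sigma_UNIV by blast
  let ?r = "restrict_coords I :: real ^ 'n \<Rightarrow> _"
  have r [measurable]: "?r \<in> measurable P borel" unfolding measP by measurable
  have rA: "?r x \<in> A \<longleftrightarrow> x \<in> A" for x
  proof -
    have "(indicator A :: _ \<Rightarrow> real) \<in> borel_measurable (generated_sigma (\<lambda>x. x) I)"
      by (rule borel_measurable_indicator[OF A])
    then have "(indicator A (?r x) :: real) = indicator A x"
      by (rule generated_sigma_factor) simp
    then show ?thesis by (cases "?r x \<in> A"; cases "x \<in> A") simp_all
  qed
  define \<nu> where "\<nu> = distr P borel ?r"
  interpret \<nu>: finite_measure \<nu> unfolding \<nu>_def by (rule finite_measure_distr[OF r])
  have "emeasure \<nu> A = (SUP K \<in> {K. K \<subseteq> A \<and> compact K}. emeasure \<nu> K)"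
    by (rule inner_regular) (simp_all add: \<nu>_def \<nu>.emeasure_eq_measure[unfolded \<nu>_def])
  have "\<exists>K. K \<subseteq> A \<and> compact K \<and> measure \<nu> A < measure \<nu> K + e / 2"
  proof (rule ccontr)
    assume neg: "\<not> ?thesis"
    have "emeasure \<nu> A \<le> ennreal (measure \<nu> A - e / 2)"
      unfolding \<open>emeasure \<nu> A = _\<close>
    proof (rule SUP_least)
      fix K assume "K \<in> {K. K \<subseteq> A \<and> compact K}"
      then have "measure \<nu> K \<le> measure \<nu> A - e / 2" using neg by auto
      then show "emeasure \<nu> K \<le> ennreal (measure \<nu> A - e / 2)"
        by (simp add: \<nu>.emeasure_eq_measure ennreal_leI)
    qed
    moreover have "measure \<nu> {} \<le> measure \<nu> A - e / 2" using neg by auto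
    ultimately show False using e by (simp add: \<nu>.emeasure_eq_measure)
  qed
  then obtain K where K: "K \<subseteq> A" "compact K" "measure \<nu> A < measure \<nu> K + e / 2" by blast
  have Kb [measurable]: "K \<in> sets borel" using K(2) by (intro borel_closed compact_imp_closed)
  have first: "(\<integral>x. \<bar>indicator A x - indicator K (?r x)\<bar> \<partial>P) < e / 2"
  proof -
    have "\<bar>indicator A x - indicator K (?r x)\<bar> = (indicator A (?r x) - indicator K (?r x) :: real)" for x
      using K(1) rA[of x] by (auto simp: indicator_def)
    then have "(\<integral>x. \<bar>indicator A x - indicator K (?r x)\<bar> \<partial>P) = (\<integral>x. (indicator A (?r x) - indicator K (?r x) :: real) \<partial>P)"
      by simp
    also have "\<dots> = (\<integral>x. indicator A x - indicator K x \<partial>\<nu>)"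
      unfolding \<nu>_def by (rule integral_distr[OF r, symmetric]) measurable
    also have "\<dots> = measure \<nu> A - measure \<nu> K"
      using Kb Ab by (subst Bochner_Integration.integral_diff) (auto simp: \<nu>_def \<nu>.emeasure_eq_measure[unfolded \<nu>_def])
    finally show ?thesis using K(3) by simp
  qed
  show ?thesis
  proof (cases "K = {}")
    case True
    then show ?thesis using first e lipschitz_coords_const[of I 0]
      by (intro exI[of _ "\<lambda>_. 0"]) auto
  next
    case False
    define \<psi> where "\<psi> k x = max 0 (1 - real k * infdist (?r x) K)" for k x
    have lip: "lipschitz_coords I (\<psi> k)" for k
    proof -
      have "\<bar>\<psi> k x - \<psi> k y\<bar> \<le> real k * norm (?r x - ?r y)" for x y
      proof -
        have "\<bar>\<psi> k x - \<psi> k y\<bar> \<le> \<bar>(1 - real k * infdist (?r x) K) - (1 - real k * infdist (?r y) K)\<bar>"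
          unfolding \<psi>_def by (auto simp: max_def)
        also have "\<dots> = \<bar>real k * (infdist (?r y) K - infdist (?r x) K)\<bar>"
          by (simp add: right_diff_distrib)
        also have "\<dots> = real k * \<bar>infdist (?r x) K - infdist (?r y) K\<bar>"
          by (simp add: abs_mult abs_minus_commute)
        also have "\<dots> \<le> real k * norm (?r x - ?r y)"
          by (intro mult_left_mono) (auto simp: infdist_triangle_abs dist_norm[symmetric])
        finally show ?thesis .
      qed
      moreover have "\<bar>\<psi> k x\<bar> \<le> 1" for x by (auto simp: \<psi>_def infdist_nonneg)
      ultimately show ?thesis by (intro lipschitz_coordsI[of _ "real k" _ 1]) auto
    qed
    note m\<psi> [measurable] = lipschitz_coords_measurable[OF lip]
    have "(\<lambda>k. \<integral>x. \<bar>indicator A x - \<psi> k x\<bar> \<partial>P) \<longlonglongrightarrow> (\<integral>x. \<bar>indicator A x - indicator K (?r x) :: real\<bar> \<partial>P)"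
    proof (rule integral_dominated_convergence)
      show "integrable P (\<lambda>_. 2 :: real)" by simp
      have "\<bar>indicator A x - \<psi> k x\<bar> \<le> 2" for k x
      proof -
        have "0 \<le> real k * infdist (?r x) K" by (simp add: infdist_nonneg)
        then have "0 \<le> \<psi> k x" "\<psi> k x \<le> 1" by (auto simp: \<psi>_def)
        then show ?thesis by (auto simp: indicator_def)
      qed
      then show "AE x in P. norm (\<bar>indicator A x - \<psi> k x\<bar>) \<le> 2" for k by simp
      have "(\<lambda>k. \<psi> k x) \<longlonglongrightarrow> indicator K (?r x)" for x
      proof (cases "?r x \<in> K")
        case True
        then show ?thesis by (simp add: \<psi>_def)
      next
        case notin: False
        then have d: "infdist (?r x) K > 0"
          using infdist_pos_not_in_closed[OF compact_imp_closed[OF K(2)] False] by blast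
        obtain k0 where "1 / infdist (?r x) K \<le> real k0" using real_arch_simple by blast
        then have k0: "1 \<le> real k0 * infdist (?r x) K" using d by (simp add: field_simps)
        have "\<psi> k x = 0" if "k \<ge> k0" for k
        proof -
          have "real k0 * infdist (?r x) K \<le> real k * infdist (?r x) K" using that d by (intro mult_right_mono) auto
          then show ?thesis using k0 by (simp add: \<psi>_def)
        qed
        then have "\<forall>\<^sub>F k in sequentially. \<psi> k x = indicator K (?r x)"
          using notin by (auto simp: eventually_sequentially)
        then show ?thesis by (rule tendsto_eventually)
      qed
      then show "AE x in P. (\<lambda>k. \<bar>indicator A x - \<psi> k x\<bar>) \<longlonglongrightarrow> \<bar>indicator A x - indicator K (?r x)\<bar>"
        by (intro AE_I2 tendsto_intros)
    qed (auto simp: measP)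
    from order_tendstoD(2)[OF this, of e] first e
    have "\<forall>\<^sub>F k in sequentially. (\<integral>x. \<bar>indicator A x - \<psi> k x\<bar> \<partial>P) < e" by simp
    then show ?thesis using lip by (auto simp: eventually_sequentially)
  qed
qed

lemma lipschitz_coords_dense:
  fixes P :: "(real ^ 'n::finite) measure" and h :: "real ^ 'n \<Rightarrow> real"
  assumes "finite_measure P" and sets_P: "sets P = sets borel"
    and h: "integrable P h" "h \<in> borel_measurable (generated_sigma (\<lambda>x. x) I)" and e: "0 < e"
  shows "\<exists>\<psi>. lipschitz_coords I \<psi> \<and> (\<integral>x. \<bar>h x - \<psi> x\<bar> \<partial>P) < e"
proof -
  interpret finite_measure P by fact
  have measP: "borel_measurable P = borel_measurable borel" by (rule measurable_cong_sets[OF sets_P refl])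
  have spaceP: "space P = UNIV" using sets_eq_imp_space_eq[OF sets_P] by simp
  let ?G = "generated_sigma (\<lambda>x. x) I :: (real ^ 'n) measure"
  have sub: "subalgebra P ?G"
    by (rule subalgebra_generated_sigma) (simp_all add: measP spaceP)
  let ?M = "restr_to_subalg P ?G"
  have ilip: "integrable P \<psi>" if l: "lipschitz_coords I \<psi>" for \<psi>
  proof -
    obtain B where "\<And>x. \<bar>\<psi> x\<bar> \<le> B" using l by (auto simp: lipschitz_coords_def)
    then show ?thesis using lipschitz_coords_measurable[OF l]
      by (intro integrable_const_bound[of _ B]) (auto simp: measP)
  qed
  have "integrable ?M h" by (rule integrable_in_subalg[OF sub h(2,1)])
  then have "\<forall>e>0. \<exists>\<psi>. lipschitz_coords I \<psi> \<and> (\<integral>x. \<bar>h x - \<psi> x\<bar> \<partial>P) < e"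
  proof (induction rule: integrable_induct)
    case (base A c)
    then have A: "A \<in> sets ?G" by (simp add: sets_restr_to_subalg[OF sub])
    show ?case
    proof (intro allI impI)
      fix e :: real assume e: "0 < e"
      obtain \<psi> where \<psi>: "lipschitz_coords I \<psi>" "(\<integral>x. \<bar>indicator A x - \<psi> x\<bar> \<partial>P) < e / (\<bar>c\<bar> + 1)"
        using lipschitz_coords_approx_indicator[OF assms(1,2) A, of "e / (\<bar>c\<bar> + 1)"] e by auto
      have "\<bar>indicator A x *\<^sub>R c - c * \<psi> x\<bar> = \<bar>c\<bar> * \<bar>indicator A x - \<psi> x\<bar>" for x
        by (simp add: abs_mult[symmetric] right_diff_distrib mult.commute)
      then have "(\<integral>x. \<bar>indicator A x *\<^sub>R c - c * \<psi> x\<bar> \<partial>P) = \<bar>c\<bar> * (\<integral>x. \<bar>indicator A x - \<psi> x\<bar> \<partial>P)"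
        by simp
      also have "\<dots> \<le> (\<bar>c\<bar> + 1) * (\<integral>x. \<bar>indicator A x - \<psi> x\<bar> \<partial>P)"
        by (intro mult_right_mono integral_nonneg_AE) auto
      also have "\<dots> < e" using \<psi>(2) by (simp add: pos_less_divide_eq mult.commute)
      finally show "\<exists>\<psi>. lipschitz_coords I \<psi> \<and> (\<integral>x. \<bar>indicator A x *\<^sub>R c - \<psi> x\<bar> \<partial>P) < e"
        using lipschitz_coords_scale[OF \<psi>(1)] by blast
    qed
  next
    case (add f g)
    show ?case
    proof (intro allI impI)
      fix e :: real assume e: "0 < e"
      obtain \<phi> where \<phi>: "lipschitz_coords I \<phi>" "(\<integral>x. \<bar>f x - \<phi> x\<bar> \<partial>P) < e / 2" using add.IH(1) e by (meson half_gt_zero)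
      obtain \<psi> where \<psi>: "lipschitz_coords I \<psi>" "(\<integral>x. \<bar>g x - \<psi> x\<bar> \<partial>P) < e / 2" using add.IH(2) e by (meson half_gt_zero)
      have i: "integrable P f" "integrable P g"
        by (rule integrable_from_subalg[OF sub], rule add.hyps)+
      have "(\<integral>x. \<bar>f x + g x - (\<phi> x + \<psi> x)\<bar> \<partial>P) \<le> (\<integral>x. \<bar>f x - \<phi> x\<bar> + \<bar>g x - \<psi> x\<bar> \<partial>P)"
        using i ilip[OF \<phi>(1)] ilip[OF \<psi>(1)] by (intro integral_mono) auto
      also have "\<dots> = (\<integral>x. \<bar>f x - \<phi> x\<bar> \<partial>P) + (\<integral>x. \<bar>g x - \<psi> x\<bar> \<partial>P)"
        using i ilip[OF \<phi>(1)] ilip[OF \<psi>(1)] by simp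
      also have "\<dots> < e" using \<phi>(2) \<psi>(2) by simp
      finally show "\<exists>\<psi>. lipschitz_coords I \<psi> \<and> (\<integral>x. \<bar>f x + g x - \<psi> x\<bar> \<partial>P) < e"
        using lipschitz_coords_add[OF \<phi>(1) \<psi>(1)] by blast
    qed
  next
    case (lim f s)
    show ?case
    proof (intro allI impI)
      fix e :: real assume e: "0 < e"
      have i: "integrable P f" "\<And>i. integrable P (s i)"
        by (rule integrable_from_subalg[OF sub], rule lim.hyps)+
      have "(\<lambda>i. \<integral>x. \<bar>f x - s i x\<bar> \<partial>P) \<longlonglongrightarrow> (\<integral>x. \<bar>f x - f x\<bar> \<partial>P)"
      proof (rule integral_dominated_convergence)
        show "integrable P (\<lambda>x. 3 * \<bar>f x\<bar>)" using i by simp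
        show "AE x in P. (\<lambda>i. \<bar>f x - s i x\<bar>) \<longlonglongrightarrow> \<bar>f x - f x\<bar>"
          using lim.hyps(2) by (intro AE_I2 tendsto_intros) (simp add: space_restr_to_subalg spaceP)
        have "\<bar>f x - s i x\<bar> \<le> 3 * \<bar>f x\<bar>" for i x
          using lim.hyps(3)[of x i] by (simp add: space_restr_to_subalg spaceP)
        then show "AE x in P. norm (\<bar>f x - s i x\<bar>) \<le> 3 * \<bar>f x\<bar>" for i by simp
      qed (use i in auto)
      then have "(\<lambda>i. \<integral>x. \<bar>f x - s i x\<bar> \<partial>P) \<longlonglongrightarrow> 0" by simp
      from order_tendstoD(2)[OF this, of "e / 2"] e obtain i where si: "(\<integral>x. \<bar>f x - s i x\<bar> \<partial>P) < e / 2"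
        by (auto simp: eventually_sequentially)
      obtain \<psi> where \<psi>: "lipschitz_coords I \<psi>" "(\<integral>x. \<bar>s i x - \<psi> x\<bar> \<partial>P) < e / 2" using lim.IH e by (meson half_gt_zero)
      have "(\<integral>x. \<bar>f x - \<psi> x\<bar> \<partial>P) \<le> (\<integral>x. \<bar>f x - s i x\<bar> + \<bar>s i x - \<psi> x\<bar> \<partial>P)"
        using i ilip[OF \<psi>(1)] by (intro integral_mono) auto
      also have "\<dots> = (\<integral>x. \<bar>f x - s i x\<bar> \<partial>P) + (\<integral>x. \<bar>s i x - \<psi> x\<bar> \<partial>P)"
        using i ilip[OF \<psi>(1)] by simp
      also have "\<dots> < e" using si \<psi>(2) by simp
      finally show "\<exists>\<psi>. lipschitz_coords I \<psi> \<and> (\<integral>x. \<bar>f x - \<psi> x\<bar> \<partial>P) < e" using \<psi>(1) by blast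
    qed
  qed
  then show ?thesis using e by blast
qed

lemma lipschitz_coords_AE_approx:
  fixes P :: "(real ^ 'n::finite) measure" and h :: "real ^ 'n \<Rightarrow> real"
  assumes fin: "finite_measure P" and sets_P: "sets P = sets borel"
    and h: "h \<in> borel_measurable (generated_sigma (\<lambda>x. x) I)" and M: "\<And>x. \<bar>h x\<bar> \<le> M"
  shows "\<exists>\<psi>. (\<forall>n. lipschitz_coords I (\<psi> n)) \<and> (\<forall>n x. \<bar>\<psi> n x\<bar> \<le> M) \<and>
    (AE x in P. (\<lambda>n. \<psi> n x) \<longlonglongrightarrow> h x)"
proof -
  interpret finite_measure P by fact
  have measP: "borel_measurable P = borel_measurable borel" by (rule measurable_cong_sets[OF sets_P refl])
  have hP: "h \<in> borel_measurable P"
    using h sets_generated_sigma_UNIV[of I] sets_P sets_eq_imp_space_eq[OF sets_P]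
    by (auto simp: measurable_def)
  then have ih: "integrable P h" using M by (intro integrable_const_bound[of _ M]) auto
  have M0: "0 \<le> M" using M[of 0] by linarith
  have "\<forall>n. \<exists>\<psi>. lipschitz_coords I \<psi> \<and> (\<integral>x. \<bar>h x - \<psi> x\<bar> \<partial>P) < (1/2) ^ n"
    using lipschitz_coords_dense[OF fin sets_P ih h] by simp
  from choice[OF this] obtain \<phi> where \<phi>: "\<And>n. lipschitz_coords I (\<phi> n)"
    "\<And>n. (\<integral>x. \<bar>h x - \<phi> n x\<bar> \<partial>P) < (1/2) ^ n" by blast
  define \<psi> where "\<psi> n x = max (- M) (min M (\<phi> n x))" for n x
  have lip: "lipschitz_coords I (\<psi> n)" for n unfolding \<psi>_def by (rule lipschitz_coords_clamp[OF \<phi>(1)])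
  have bd: "\<bar>\<psi> n x\<bar> \<le> M" for n x using M0 by (simp add: \<psi>_def abs_le_iff)
  have m: "\<phi> n \<in> borel_measurable P" "\<psi> n \<in> borel_measurable P" for n
    using lipschitz_coords_measurable \<phi>(1) lip by (auto simp: measP)
  have i: "integrable P (\<lambda>x. \<bar>h x - \<psi> n x\<bar>)" for n
    using ih integrable_const_bound[of "\<psi> n" M] m bd by auto
  have i': "integrable P (\<phi> n)" for n
  proof -
    obtain B where "\<And>x. \<bar>\<phi> n x\<bar> \<le> B" using \<phi>(1)[of n] by (auto simp: lipschitz_coords_def)
    then show ?thesis using m by (intro integrable_const_bound[of _ B]) auto
  qed
  have closer: "\<bar>h x - \<psi> n x\<bar> \<le> \<bar>h x - \<phi> n x\<bar>" for n x
    using M[of x] by (auto simp: \<psi>_def max_def min_def abs_le_iff)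
  have "(\<integral>x. \<bar>h x - \<psi> n x\<bar> \<partial>P) \<le> (1/2) ^ n" for n
    using integral_mono[OF i _ closer, of n] ih i'[of n] \<phi>(2)[of n] by auto
  moreover have "0 \<le> (\<integral>x. \<bar>h x - \<psi> n x\<bar> \<partial>P)" for n by (rule integral_nonneg_AE) auto
  moreover have sg: "summable (\<lambda>n. (1/2) ^ n :: real)" by (rule summable_geometric) simp
  ultimately have "summable (\<lambda>n. \<integral>x. \<bar>h x - \<psi> n x\<bar> \<partial>P)"
    by (intro summable_comparison_test'[OF sg, of 0]) (simp only: real_norm_def abs_of_nonneg)
  then have "AE x in P. (\<lambda>n. \<bar>h x - \<psi> n x\<bar>) \<longlonglongrightarrow> 0"
    by (intro AE_tendsto_zero_of_summable i) auto
  then have "AE x in P. (\<lambda>n. \<psi> n x) \<longlonglongrightarrow> h x"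
  proof eventually_elim
    case (elim x)
    then have "(\<lambda>n. h x - \<psi> n x) \<longlonglongrightarrow> 0" by (simp add: tendsto_rabs_zero_iff)
    from tendsto_diff[OF tendsto_const[of "h x"] this] show ?case by simp
  qed
  then show ?thesis using lip bd by (intro exI[of _ \<psi>]) simp
qed

section \<open>The direction of steepest ascent\<close>

text \<open>Equality in Hoelder's inequality is approached in a direction proportional to
  \<open>sgn h \<bar>h\<bar>\<^sup>q\<^sup>-\<^sup>1\<close>, where \<open>h\<close> is the adapted gradient; truncating it and
  approximating it almost surely gives a bounded adapted direction that is Lipschitz in the path.\<close>

lemma (in control_problem) steepest_direction:
  assumes a: "a \<in> controls L" and \<eta>: "0 < \<eta>"
  obtains Z where "\<And>t. lipschitz_coords {..t} (\<lambda>x. Z x $ t)"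
    "(\<Sum>t\<in>UNIV. \<integral>x. \<bar>Z x $ t\<bar> powr p \<partial>P) \<le> 1"
    "sensitivity a - \<eta> \<le> (\<integral>x. grad_x x (a x) \<bullet> Z x \<partial>P)"
proof -
  interpret prob_space P by (rule prob_P)
  let ?V = "sensitivity a" and ?h = "adapted_grad a"
  define A where "A = (\<Sum>t\<in>UNIV. \<integral>x. \<bar>?h t x\<bar> powr q \<partial>P)"
  have V: "?V = A powr (1 / q)" by (simp add: sensitivity_def A_def)
  have A0: "0 \<le> A" unfolding A_def by (intro sum_nonneg integral_nonneg_AE) auto
  show ?thesis
  proof (cases "A = 0")
    case True
    then show ?thesis using \<eta>
      by (intro that[of "\<lambda>_. 0"]) (simp_all add: lipschitz_coords_const V)
  next
    case False
    then have A: "A > 0" using A0 by simp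
    then have Vpos: "?V > 0" by (simp add: V)
    have Vq: "?V powr q = A" using A q(1) by (simp add: V powr_powr)
    define w where "w N t x = (if \<bar>?h t x\<bar> \<le> real N then sgn (?h t x) * (\<bar>?h t x\<bar> powr (q - 1) / ?V powr (q - 1)) else 0)" for N :: nat and t x
    have hq: "\<bar>u\<bar> * \<bar>u\<bar> powr (q - 1) = \<bar>u\<bar> powr q" for u :: real
      using q(1) by (intro powr_minus_one_mult) auto
    have hw: "?h t x * w N t x = (if \<bar>?h t x\<bar> \<le> real N then \<bar>?h t x\<bar> powr q / ?V powr (q - 1) else 0)" for N t x
    proof -
      have "?h t x * (sgn (?h t x) * (\<bar>?h t x\<bar> powr (q - 1) / ?V powr (q - 1)))
          = (?h t x * sgn (?h t x)) * \<bar>?h t x\<bar> powr (q - 1) / ?V powr (q - 1)" by simp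
      also have "?h t x * sgn (?h t x) = \<bar>?h t x\<bar>" by (simp add: abs_sgn)
      finally show ?thesis by (simp add: w_def hq)
    qed
    have w_p: "\<bar>w N t x\<bar> powr p \<le> \<bar>?h t x\<bar> powr q / A" for N t x
    proof (cases "\<bar>?h t x\<bar> \<le> real N \<and> ?h t x \<noteq> 0")
      case True
      then have "\<bar>w N t x\<bar> powr p = (\<bar>?h t x\<bar> powr (q - 1) / ?V powr (q - 1)) powr p"
        by (simp add: w_def abs_mult abs_sgn_eq)
      also have "\<dots> = \<bar>?h t x\<bar> powr q / A"
        by (simp add: powr_divide powr_powr q(5) Vq)
      finally show ?thesis by simp
    next
      case False
      then have "w N t x = 0" by (auto simp: w_def)
      then show ?thesis using A by simp
    qed
    have w_bound: "\<bar>w N t x\<bar> \<le> real N powr (q - 1) / ?V powr (q - 1)" for N t x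
    proof (cases "\<bar>?h t x\<bar> \<le> real N \<and> ?h t x \<noteq> 0")
      case True
      then have "\<bar>?h t x\<bar> powr (q - 1) \<le> real N powr (q - 1)" using q(1) by (intro powr_mono2) auto
      then show ?thesis using True by (simp add: w_def abs_mult abs_sgn_eq divide_right_mono)
    next
      case False
      then have "w N t x = 0" by (auto simp: w_def)
      then show ?thesis by simp
    qed
    have w_filt: "w N t \<in> borel_measurable (canonical_filtration t)" for N t
      unfolding w_def using adapted_grad_measurable_filtration[of a t] by measurable
    have w_meas [measurable]: "w N t \<in> borel_measurable borel" for N t
      unfolding w_def by measurable
    note ihq = integrable_adapted_grad(2)[OF a] and ih = integrable_adapted_grad(1)[OF a]
    have mhq: "(\<lambda>x. \<bar>?h t x\<bar> powr q) \<in> borel_measurable P" for t using ihq by auto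
    have "(\<lambda>N. \<Sum>t\<in>UNIV. \<integral>x. ?h t x * w N t x \<partial>P) \<longlonglongrightarrow> (\<Sum>t\<in>UNIV. \<integral>x. \<bar>?h t x\<bar> powr q / ?V powr (q - 1) \<partial>P)"
    proof (intro tendsto_sum integral_dominated_convergence)
      fix t
      show "integrable P (\<lambda>x. \<bar>?h t x\<bar> powr q / ?V powr (q - 1))" using ihq by simp
      show "AE x in P. (\<lambda>N. ?h t x * w N t x) \<longlonglongrightarrow> \<bar>?h t x\<bar> powr q / ?V powr (q - 1)"
      proof (rule AE_I2)
        fix x
        obtain N0 where "\<bar>?h t x\<bar> \<le> real N0" using real_arch_simple by blast
        then have "\<forall>\<^sub>F N in sequentially. ?h t x * w N t x = \<bar>?h t x\<bar> powr q / ?V powr (q - 1)"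
          unfolding eventually_sequentially hw by (intro exI[of _ N0]) auto
        then show "(\<lambda>N. ?h t x * w N t x) \<longlonglongrightarrow> \<bar>?h t x\<bar> powr q / ?V powr (q - 1)" by (rule tendsto_eventually)
      qed
      show "AE x in P. norm (?h t x * w N t x) \<le> \<bar>?h t x\<bar> powr q / ?V powr (q - 1)" for N
        unfolding hw by auto
    qed (auto simp: measurable_P)
    also have "(\<Sum>t\<in>UNIV. \<integral>x. \<bar>?h t x\<bar> powr q / ?V powr (q - 1) \<partial>P) = A / ?V powr (q - 1)"
      by (simp add: A_def sum_divide_distrib)
    also have "\<dots> = ?V" using Vpos by (simp add: Vq[symmetric] powr_diff)
    finally have "(\<lambda>N. \<Sum>t\<in>UNIV. \<integral>x. ?h t x * w N t x \<partial>P) \<longlonglongrightarrow> ?V" .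
    from order_tendstoD(1)[OF this, of "?V - \<eta> / 3"] \<eta> obtain N
      where N: "?V - \<eta> / 3 < (\<Sum>t\<in>UNIV. \<integral>x. ?h t x * w N t x \<partial>P)"
      by (auto simp: eventually_sequentially)
    \<comment> \<open>Shrinking the direction makes the norm constraint strict, so that it survives approximation.\<close>
    define d where "d = min (1/2) (\<eta> / (3 * ?V))"
    have d: "0 < d" "d \<le> 1/2" "d * ?V \<le> \<eta> / 3"
    proof -
      show "0 < d" "d \<le> 1/2" using \<eta> Vpos by (auto simp: d_def)
      have "d * ?V \<le> \<eta> / (3 * ?V) * ?V" using Vpos by (intro mult_right_mono) (auto simp: d_def)
      then show "d * ?V \<le> \<eta> / 3" using Vpos by simp
    qed
    define M where "M = real N powr (q - 1) / ?V powr (q - 1)"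
    let ?k = "\<lambda>t x. (1 - d) * w N t x"
    have kB: "\<bar>?k t x\<bar> \<le> M" for t x
    proof -
      have "(1 - d) * \<bar>w N t x\<bar> \<le> 1 * M" using d w_bound[of N t x] by (intro mult_mono) (auto simp: M_def)
      then show ?thesis using d by (simp add: abs_mult)
    qed
    have kfilt: "?k t \<in> borel_measurable (canonical_filtration t)" for t using w_filt by simp
    have "\<exists>\<psi>. (\<forall>n. lipschitz_coords {..t} (\<psi> n)) \<and> (\<forall>n x. \<bar>\<psi> n x\<bar> \<le> M) \<and> (AE x in P. (\<lambda>n. \<psi> n x) \<longlonglongrightarrow> ?k t x)" for t
      by (rule lipschitz_coords_AE_approx[OF finite_measure_axioms sets_P kfilt[of t] kB])
    then have "\<forall>t. \<exists>\<psi>. (\<forall>n. lipschitz_coords {..t} (\<psi> n)) \<and> (\<forall>n x. \<bar>\<psi> n x\<bar> \<le> M) \<and> (AE x in P. (\<lambda>n. \<psi> n x) \<longlonglongrightarrow> ?k t x)" ..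
    from choice[OF this] obtain \<psi> where \<psi>: "\<And>t n. lipschitz_coords {..t} (\<psi> t n)" "\<And>t n x. \<bar>\<psi> t n x\<bar> \<le> M"
      "\<And>t. AE x in P. (\<lambda>n. \<psi> t n x) \<longlonglongrightarrow> ?k t x" by blast
    have [measurable]: "\<psi> t n \<in> borel_measurable borel" for t n by (rule lipschitz_coords_measurable[OF \<psi>(1)])
    have "(\<lambda>n. \<Sum>t\<in>UNIV. \<integral>x. \<bar>\<psi> t n x\<bar> powr p \<partial>P) \<longlonglongrightarrow> (\<Sum>t\<in>UNIV. \<integral>x. \<bar>?k t x\<bar> powr p \<partial>P)"
    proof (intro tendsto_sum integral_dominated_convergence)
      fix t
      show "integrable P (\<lambda>_. M powr p)" by simp
      show "AE x in P. norm (\<bar>\<psi> t n x\<bar> powr p) \<le> M powr p" for n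
        using p by (auto intro!: AE_I2 powr_mono2 \<psi>(2))
      show "AE x in P. (\<lambda>n. \<bar>\<psi> t n x\<bar> powr p) \<longlonglongrightarrow> \<bar>?k t x\<bar> powr p"
        using \<psi>(3)[of t]
      proof eventually_elim
        case (elim x)
        then show ?case using p by (intro tendsto_powr2 tendsto_rabs tendsto_const) auto
      qed
    qed (auto simp: measurable_P)
    moreover have "(\<Sum>t\<in>UNIV. \<integral>x. \<bar>?k t x\<bar> powr p \<partial>P) < 1"
    proof -
      have k_le: "\<bar>?k t x\<bar> powr p \<le> (1 - d) powr p * (\<bar>?h t x\<bar> powr q / A)" for t x
      proof -
        have "\<bar>?k t x\<bar> powr p = (1 - d) powr p * \<bar>w N t x\<bar> powr p"
          using d by (simp add: abs_mult powr_mult)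
        then show ?thesis using mult_left_mono[OF w_p[of N t x], of "(1 - d) powr p"] by simp
      qed
      have ik: "integrable P (\<lambda>x. \<bar>?k t x\<bar> powr p)" for t
        by (rule integrable_const_bound[of _ "M powr p"])
          (use kB p in \<open>auto intro!: AE_I2 powr_mono2 simp: measurable_P\<close>)
      have "integrable P (\<lambda>x. (1 - d) powr p * (\<bar>?h t x\<bar> powr q / A))" for t
        using ihq by simp
      then have "(\<Sum>t\<in>UNIV. \<integral>x. \<bar>?k t x\<bar> powr p \<partial>P) \<le> (\<Sum>t\<in>UNIV. \<integral>x. (1 - d) powr p * (\<bar>?h t x\<bar> powr q / A) \<partial>P)"
        by (intro sum_mono integral_mono ik k_le)
      also have "\<dots> = (1 - d) powr p"
        using A by (simp add: sum_distrib_left[symmetric] sum_divide_distrib[symmetric] A_def[symmetric])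
      also have "\<dots> < 1 powr p" using d p by (intro powr_less_mono2) auto
      finally show ?thesis by simp
    qed
    ultimately have ev1: "\<forall>\<^sub>F n in sequentially. (\<Sum>t\<in>UNIV. \<integral>x. \<bar>\<psi> t n x\<bar> powr p \<partial>P) < 1"
      by (rule order_tendstoD(2))
    have "(\<lambda>n. \<Sum>t\<in>UNIV. \<integral>x. ?h t x * \<psi> t n x \<partial>P) \<longlonglongrightarrow> (\<Sum>t\<in>UNIV. \<integral>x. ?h t x * ?k t x \<partial>P)"
    proof (intro tendsto_sum integral_dominated_convergence)
      fix t
      show "integrable P (\<lambda>x. \<bar>?h t x\<bar> * M)" using ih by simp
      show "AE x in P. norm (?h t x * \<psi> t n x) \<le> \<bar>?h t x\<bar> * M" for n
        using \<psi>(2) by (auto simp: abs_mult intro!: AE_I2 mult_left_mono)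
      show "AE x in P. (\<lambda>n. ?h t x * \<psi> t n x) \<longlonglongrightarrow> ?h t x * ?k t x"
        using \<psi>(3)[of t] by eventually_elim (intro tendsto_intros)
    qed (auto simp: measurable_P)
    moreover have "?V - \<eta> < (\<Sum>t\<in>UNIV. \<integral>x. ?h t x * ?k t x \<partial>P)"
    proof -
      have "(\<Sum>t\<in>UNIV. \<integral>x. ?h t x * ?k t x \<partial>P) = (1 - d) * (\<Sum>t\<in>UNIV. \<integral>x. ?h t x * w N t x \<partial>P)"
        by (simp add: sum_distrib_left mult.left_commute)
      moreover have "(1 - d) * (?V - \<eta> / 3) < (1 - d) * (\<Sum>t\<in>UNIV. \<integral>x. ?h t x * w N t x \<partial>P)"
        using N d by (intro mult_strict_left_mono) auto
      moreover have "(1 - d) * (?V - \<eta> / 3) = ?V - \<eta> / 3 - d * ?V + d * (\<eta> / 3)"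
        by (simp only: left_diff_distrib right_diff_distrib mult_1)
      moreover have "0 \<le> d * (\<eta> / 3)" using d \<eta> by simp
      ultimately show ?thesis using d(3) \<eta> by linarith
    qed
    ultimately have ev2: "\<forall>\<^sub>F n in sequentially. ?V - \<eta> < (\<Sum>t\<in>UNIV. \<integral>x. ?h t x * \<psi> t n x \<partial>P)"
      by (rule order_tendstoD(1))
    obtain n where n: "(\<Sum>t\<in>UNIV. \<integral>x. \<bar>\<psi> t n x\<bar> powr p \<partial>P) < 1"
      "?V - \<eta> < (\<Sum>t\<in>UNIV. \<integral>x. ?h t x * \<psi> t n x \<partial>P)"
      using eventually_happens[OF eventually_conj[OF ev1 ev2]] by auto
    define Z where "Z x = (\<chi> t. \<psi> t n x)" for x
    have "(\<integral>x. grad_x x (a x) \<bullet> Z x \<partial>P) = (\<Sum>t\<in>UNIV. \<integral>x. ?h t x * \<psi> t n x \<partial>P)"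
    proof -
      have ig: "integrable P (\<lambda>x. \<psi> t n x * grad_x x (a x) $ t)" for t
        using integrable_mult_bounded[OF integrable_grad[OF a, of t], of "\<psi> t n" M] \<psi>(2)
        by (simp add: measurable_P mult.commute)
      have "(\<integral>x. \<psi> t n x * ?h t x \<partial>P) = (\<integral>x. \<psi> t n x * grad_x x (a x) $ t \<partial>P)" for t
      proof -
        interpret F: finite_measure_subalgebra P "canonical_filtration t" by (rule filtration_subalgebra)
        have "\<psi> t n \<in> borel_measurable (canonical_filtration t)"
        proof (rule adapted_measurable_generated_sigma[where Z = "\<lambda>x. x"])
          show "\<psi> t n x = \<psi> t n y" if "\<And>s. s \<in> {..t} \<Longrightarrow> x $ s = y $ s" for x y
            by (rule lipschitz_coords_adapted[OF \<psi>(1) that])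
        qed measurable
        then show ?thesis unfolding adapted_grad_def
          using ig[of t] integrable_grad[OF a, of t] by (intro F.real_cond_exp_intg(2)) auto
      qed
      then have "(\<Sum>t\<in>UNIV. \<integral>x. ?h t x * \<psi> t n x \<partial>P) = (\<Sum>t\<in>UNIV. \<integral>x. \<psi> t n x * grad_x x (a x) $ t \<partial>P)"
        by (simp add: mult.commute)
      also have "\<dots> = (\<integral>x. grad_x x (a x) \<bullet> Z x \<partial>P)"
        using ig by (simp add: inner_vec_def Z_def mult.commute)
      finally show ?thesis by simp
    qed
    then show ?thesis using n \<psi>(1) by (intro that[of Z]) (simp_all add: Z_def)
  qed
qed

section \<open>Adapted perturbations of the identity\<close>

text \<open>For small \<open>r\<close>, Banach's fixed point theorem inverts \<open>x \<mapsto> x + r Z x\<close>.  Since the Lipschitz bound holds up to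
  each time, the inverse is adapted as well.\<close>

lemma adapted_perturbation:
  fixes Z :: "real ^ 'n::{finite,linorder} \<Rightarrow> real ^ 'n::{finite,linorder}"
  assumes lip: "\<And>t. lipschitz_coords {..t} (\<lambda>x. Z x $ t)"
  shows "\<exists>r0>0. \<forall>r. 0 < r \<longrightarrow> r < r0 \<longrightarrow> (\<exists>S\<in>borel_measurable borel.
    (\<forall>x. S (x + r *\<^sub>R Z x) = x) \<and> (\<forall>t y y'. (\<forall>s\<le>t. y $ s = y' $ s) \<longrightarrow> S y $ t = S y' $ t))"
proof -
  have "\<forall>t. \<exists>K. 0 \<le> K \<and> (\<forall>x y. \<bar>Z x $ t - Z y $ t\<bar> \<le> K * norm (restrict_coords {..t} x - restrict_coords {..t} y))"
    using lip unfolding lipschitz_coords_def by blast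
  from choice[OF this] obtain K where K: "\<And>t. 0 \<le> K t"
    "\<And>t x y. \<bar>Z x $ t - Z y $ t\<bar> \<le> K t * norm (restrict_coords {..t} (x - y))"
    unfolding restrict_coords_diff by blast
  define K0 where "K0 = (\<Sum>t\<in>UNIV. K t)"
  have K0: "0 \<le> K0" unfolding K0_def by (intro sum_nonneg K)
  \<comment> \<open>Up to each time, the direction is Lipschitz in the path up to that time.\<close>
  have ZK: "norm (restrict_coords J (Z x - Z y)) \<le> K0 * norm (restrict_coords J (x - y))"
    if J: "\<And>t. t \<in> J \<Longrightarrow> {..t} \<subseteq> J" for J x y
  proof -
    have "norm (restrict_coords J (Z x - Z y)) \<le> (\<Sum>t\<in>UNIV. \<bar>restrict_coords J (Z x - Z y) $ t\<bar>)"
      by (rule norm_le_l1_cart)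
    also have "\<dots> \<le> (\<Sum>t\<in>UNIV. K t * norm (restrict_coords J (x - y)))"
    proof (rule sum_mono)
      fix t
      show "\<bar>restrict_coords J (Z x - Z y) $ t\<bar> \<le> K t * norm (restrict_coords J (x - y))"
      proof (cases "t \<in> J")
        case True
        then show ?thesis
          using order_trans[OF K(2)[of x t y] mult_left_mono[OF norm_restrict_coords_mono[OF J[OF True]] K(1)]] by simp
      next
        case False
        then show ?thesis using K(1) by simp
      qed
    qed
    finally show ?thesis by (simp add: K0_def sum_distrib_right)
  qed
  show ?thesis
  proof (rule exI[of _ "1 / (2 * (K0 + 1))"], intro conjI allI impI)
    show "0 < 1 / (2 * (K0 + 1))" using K0 by simp
    fix r assume r: "0 < r" "r < 1 / (2 * (K0 + 1))"
    have rK: "r * K0 \<le> 1/2"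
    proof -
      have "r * (K0 + 1) \<le> 1/2" using r K0 by (simp add: field_simps)
      then show ?thesis using r by (simp add: algebra_simps)
    qed
    have contr: "norm (r *\<^sub>R restrict_coords J (Z x - Z y)) \<le> 1/2 * norm (restrict_coords J (x - y))"
      if J: "\<And>t. t \<in> J \<Longrightarrow> {..t} \<subseteq> J" for J x y
    proof -
      have "norm (r *\<^sub>R restrict_coords J (Z x - Z y)) \<le> r * (K0 * norm (restrict_coords J (x - y)))"
        using r ZK[OF J, of x y] by simp
      also have "\<dots> \<le> 1/2 * norm (restrict_coords J (x - y))"
        using mult_right_mono[OF rK, of "norm (restrict_coords J (x - y))"] by (simp add: mult.assoc)
      finally show ?thesis .
    qed
    have [simp]: "restrict_coords UNIV x = x" for x :: "(real, 'n) vec" by (simp add: vec_eq_iff)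
    have fixpoint: "\<exists>!x. y - r *\<^sub>R Z x = x" for y
    proof (rule banach_fix_type[of "1/2"], simp, simp, intro allI)
      fix x x'
      have "dist (y - r *\<^sub>R Z x) (y - r *\<^sub>R Z x') = norm (r *\<^sub>R restrict_coords UNIV (Z x' - Z x))"
        by (simp add: dist_norm scaleR_diff_right)
      also have "\<dots> \<le> 1/2 * norm (restrict_coords UNIV (x' - x))" by (rule contr) simp
      finally show "dist (y - r *\<^sub>R Z x) (y - r *\<^sub>R Z x') \<le> 1/2 * dist x x'"
        by (simp add: dist_norm norm_minus_commute)
    qed
    define S where "S y = (THE x. y - r *\<^sub>R Z x = x)" for y
    have S: "y - r *\<^sub>R Z (S y) = S y" for y unfolding S_def by (rule theI'[OF fixpoint])
    have S_inv: "S (x + r *\<^sub>R Z x) = x" for x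
      using fixpoint[of "x + r *\<^sub>R Z x"] S[of "x + r *\<^sub>R Z x"] by (metis add_diff_cancel_right')
    have S_diff: "norm (restrict_coords J (S y - S y')) \<le> 2 * norm (restrict_coords J (y - y'))"
      if J: "\<And>t. t \<in> J \<Longrightarrow> {..t} \<subseteq> J" for J y y'
    proof -
      have "S y - S y' = (y - y') - r *\<^sub>R (Z (S y) - Z (S y'))"
        using S[of y] S[of y'] by (metis (no_types, lifting) diff_diff_eq2 diff_add_eq diff_diff_add scaleR_diff_right add_diff_eq add.commute diff_diff_eq)
      then have "restrict_coords J (S y - S y') = restrict_coords J (y - y') - r *\<^sub>R restrict_coords J (Z (S y) - Z (S y'))"
        by (simp add: vec_eq_iff)
      then have "norm (restrict_coords J (S y - S y'))
          \<le> norm (restrict_coords J (y - y')) + norm (r *\<^sub>R restrict_coords J (Z (S y) - Z (S y')))"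
        by (metis norm_triangle_ineq4)
      then show ?thesis using contr[OF J, of "S y" "S y'"] by simp
    qed
    have "2-lipschitz_on UNIV S"
      using S_diff[of UNIV] by (intro lipschitz_onI) (auto simp: dist_norm)
    then have "S \<in> borel_measurable borel"
      by (intro borel_measurable_continuous_onI lipschitz_on_continuous_on)
    moreover have "S y $ t = S y' $ t" if "\<forall>s\<le>t. y $ s = y' $ s" for t y y'
    proof -
      have "restrict_coords {..t} (y - y') = 0" using that by (simp add: vec_eq_iff)
      then have "norm (restrict_coords {..t} (S y - S y')) \<le> 0"
        using S_diff[of "{..t}" y y'] by (auto intro: order_trans)
      then have "restrict_coords {..t} (S y - S y') $ t = 0" by simp
      then show ?thesis by simp
    qed
    ultimately show "\<exists>S\<in>borel_measurable borel.
      (\<forall>x. S (x + r *\<^sub>R Z x) = x) \<and> (\<forall>t y y'. (\<forall>s\<le>t. y $ s = y' $ s) \<longrightarrow> S y $ t = S y' $ t)"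
      using S_inv by blast
  qed
qed

lemma (in coupled_processes) causal_of_map:
  assumes F: "F \<in> borel_measurable borel" and AE: "AE \<omega> in \<pi>. Y \<omega> = F (X \<omega>)"
    and adapted: "\<And>t x y. (\<And>s. s \<le> t \<Longrightarrow> x $ s = y $ s) \<Longrightarrow> F x $ t = F y $ t"
  shows "causal \<pi> X Y"
proof (rule causal_of_adapted)
  fix t E assume "E \<in> sets (generated_sigma Y {..t})"
  then obtain B where B: "B \<in> sets (generated_sigma (\<lambda>x. x) {..t})" "E = Y -` B"
    by (rule sets_generated_sigma_vimage)
  have "(\<lambda>\<omega>. F (X \<omega>)) \<in> measurable (generated_sigma X {..t}) (generated_sigma (\<lambda>x. x) {..t})"
  proof (rule measurable_generated_sigma)
    fix s assume s: "s \<in> {..t}"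
    show "(\<lambda>\<omega>. F (X \<omega>) $ s) \<in> borel_measurable (generated_sigma X {..t})"
    proof (rule adapted_measurable_generated_sigma[where \<phi> = "\<lambda>x. F x $ s"])
      show "(\<lambda>x. F x $ s) \<in> borel_measurable borel" using F by measurable
      show "F x $ s = F y $ s" if "\<And>u. u \<in> {..t} \<Longrightarrow> x $ u = y $ u" for x y
        using that s by (intro adapted) auto
    qed
  qed
  from measurable_sets[OF this B(1)]
  have "(\<lambda>\<omega>. F (X \<omega>)) -` B \<in> sets (generated_sigma X {..t})" by simp
  moreover have "AE \<omega> in \<pi>. \<omega> \<in> E \<longleftrightarrow> \<omega> \<in> (\<lambda>\<omega>. F (X \<omega>)) -` B"
    using AE by eventually_elim (simp add: B)
  ultimately show "\<exists>E'\<in>sets (generated_sigma X {..t}). AE \<omega> in \<pi>. \<omega> \<in> E \<longleftrightarrow> \<omega> \<in> E'" by blast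
qed

text \<open>Moving every path along an adapted direction gives a measure in the ball: the graph of an adapted
  bijection with adapted inverse is a bicausal coupling.\<close>

lemma (in control_problem) perturbed_measure_in_ball:
  assumes lip: "\<And>t. lipschitz_coords {..t} (\<lambda>x. Z x $ t)"
    and norm1: "(\<Sum>t\<in>UNIV. \<integral>x. \<bar>Z x $ t\<bar> powr p \<partial>P) \<le> 1" and r: "0 < r"
    and S: "S \<in> borel_measurable borel" "\<And>x. S (x + r *\<^sub>R Z x) = x"
      "\<And>t y y'. (\<And>s. s \<le> t \<Longrightarrow> y $ s = y' $ s) \<Longrightarrow> S y $ t = S y' $ t"
  shows "distr P borel (\<lambda>x. x + r *\<^sub>R Z x) \<in> aw_ball p P r"
    and "transport_cost p P (\<lambda>x. x) (\<lambda>x. x + r *\<^sub>R Z x) \<le> r powr p"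
    and "\<And>t. integrable P (\<lambda>x. \<bar>x $ t - (x + r *\<^sub>R Z x) $ t\<bar> powr p)"
proof -
  interpret prob_space P by (rule prob_P)
  let ?F = "\<lambda>x. x + r *\<^sub>R Z x"
  have Zm [measurable]: "Z \<in> borel_measurable borel"
    by (rule borel_measurable_vecI) (rule lipschitz_coords_measurable[OF lip])
  have F [measurable]: "?F \<in> borel_measurable borel" by measurable
  have FP [measurable]: "?F \<in> borel_measurable P" by (simp add: measurable_P)
  let ?Q = "distr P borel ?F"
  have "\<forall>t. \<exists>B. \<forall>x. \<bar>Z x $ t\<bar> \<le> B" using lip by (simp add: lipschitz_coords_def)
  from choice[OF this] obtain B where B: "\<And>t x. \<bar>Z x $ t\<bar> \<le> B t" by blast
  have int: "integrable P (\<lambda>x. \<bar>Z x $ t\<bar> powr p)" for t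
    by (rule integrable_const_bound[of _ "B t powr p"])
      (use p B in \<open>auto intro!: AE_I2 powr_mono2 simp: measurable_P\<close>)
  have scale: "\<bar>x $ t - ?F x $ t\<bar> powr p = r powr p * \<bar>Z x $ t\<bar> powr p" for x t
    using r by (simp add: abs_mult powr_mult)
  show "integrable P (\<lambda>x. \<bar>x $ t - ?F x $ t\<bar> powr p)" for t
    unfolding scale using int by simp
  have "transport_cost p P (\<lambda>x. x) ?F = r powr p * (\<Sum>t\<in>UNIV. \<integral>x. \<bar>Z x $ t\<bar> powr p \<partial>P)"
    unfolding transport_cost_def scale by (simp add: sum_distrib_left)
  also have "\<dots> \<le> r powr p * 1" by (intro mult_left_mono norm1) simp
  finally show cost: "transport_cost p P (\<lambda>x. x) ?F \<le> r powr p" by simp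
  have Q: "?Q \<in> finite_moment_measures p"
  proof -
    have "norm (?F x) powr p \<le> 2 powr p * (norm x powr p + (r * (\<Sum>t\<in>UNIV. B t)) powr p)" for x
    proof -
      have "norm (Z x) \<le> (\<Sum>t\<in>UNIV. B t)"
        by (rule order_trans[OF norm_le_l1_cart]) (intro sum_mono B)
      then have "r * norm (Z x) \<le> r * (\<Sum>t\<in>UNIV. B t)" using r by (intro mult_left_mono) auto
      then have "norm (?F x) \<le> norm x + r * (\<Sum>t\<in>UNIV. B t)"
        using norm_triangle_ineq[of x "r *\<^sub>R Z x"] r unfolding norm_scaleR by linarith
      then have "norm (?F x) powr p \<le> (norm x + r * (\<Sum>t\<in>UNIV. B t)) powr p"
        using p by (intro powr_mono2) auto
      also have "\<dots> \<le> 2 powr p * (norm x powr p + (r * (\<Sum>t\<in>UNIV. B t)) powr p)"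
        using p r \<open>norm (Z x) \<le> _\<close> by (intro powr_add_le mult_nonneg_nonneg) (auto intro: order_trans[OF norm_ge_zero])
      finally show ?thesis .
    qed
    then have le: "norm (norm (?F x) powr p) \<le> norm (2 powr p * (norm x powr p + (r * (\<Sum>t\<in>UNIV. B t)) powr p))" for x
      unfolding real_norm_def by (simp only: abs_of_nonneg powr_ge_zero order_trans[OF _ abs_ge_self])
    have "integrable P (\<lambda>x. norm (?F x) powr p)"
    proof (rule Bochner_Integration.integrable_bound)
      show "integrable P (\<lambda>x. 2 powr p * (norm x powr p + (r * (\<Sum>t\<in>UNIV. B t)) powr p))"
        using moment_P by simp
      show "(\<lambda>x. norm (?F x) powr p) \<in> borel_measurable P" by measurable
      show "AE x in P. norm (norm (?F x) powr p) \<le> norm (2 powr p * (norm x powr p + (r * (\<Sum>t\<in>UNIV. B t)) powr p))"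
        by (rule AE_I2, rule le)
    qed
    then show ?thesis
      by (simp add: finite_moment_measures_def prob_space_distr integrable_distr_eq)
  qed
  let ?g = "\<lambda>x. (x, ?F x)"
  have g [measurable]: "?g \<in> borel_measurable P"
    by (intro borel_measurable_Pair FP) (simp add: measurable_P)
  define \<pi> where "\<pi> = distr P borel ?g"
  have fs [measurable]: "fst \<in> borel_measurable (borel :: ((real, 'n) vec \<times> (real, 'n) vec) measure)"
    "snd \<in> borel_measurable (borel :: ((real, 'n) vec \<times> (real, 'n) vec) measure)"
    by (simp_all add: borel_prod[symmetric])
  have "distr P borel (\<lambda>x. x) = P"
    by (rule distr_id2) (simp add: sets_P)
  then have \<pi>: "\<pi> \<in> couplings P ?Q"
    unfolding couplings_def \<pi>_def by (simp add: prob_space_distr g distr_distr[OF fs(1) g] distr_distr[OF fs(2) g] comp_def)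
  have graph: "AE \<omega> in \<pi>. snd \<omega> = ?F (fst \<omega>)"
  proof -
    have "(\<lambda>\<omega>. norm (snd \<omega> - ?F (fst \<omega>))) \<in> borel_measurable borel"
      by measurable
    from measurable_sets[OF this, of "{0}"]
    have "{\<omega> \<in> space borel. snd \<omega> = ?F (fst \<omega>)} \<in> sets borel"
      by (simp add: vimage_def)
    then show ?thesis unfolding \<pi>_def by (subst AE_distr_iff[OF g]) auto
  qed
  have "causal \<pi> fst snd"
  proof (rule coupled_processes.causal_of_map[OF coupled_processes_coupling(1)[OF \<pi>] F graph])
    fix t and x y :: "(real, 'n) vec" assume *: "\<And>s. s \<le> t \<Longrightarrow> x $ s = y $ s"
    then have "Z x $ t = Z y $ t" by (intro lipschitz_coords_adapted[OF lip]) auto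
    then show "?F x $ t = ?F y $ t" using * by simp
  qed
  moreover have "causal \<pi> snd fst"
  proof (rule coupled_processes.causal_of_map[OF coupled_processes_coupling(2)[OF \<pi>] S(1)])
    show "AE \<omega> in \<pi>. fst \<omega> = S (snd \<omega>)" using graph by eventually_elim (simp add: S(2))
  qed (rule S(3))
  ultimately have bi: "\<pi> \<in> bicausal_couplings P ?Q" using \<pi> by (simp add: bicausal_couplings_def)
  have "transport_cost p \<pi> fst snd = transport_cost p P (\<lambda>x. x) ?F"
  proof -
    have "(\<lambda>\<omega> :: (real, 'n) vec \<times> (real, 'n) vec. \<bar>fst \<omega> $ t - snd \<omega> $ t\<bar> powr p) \<in> borel_measurable borel" for t
    proof -
      have [measurable]: "(\<lambda>\<omega> :: (real, 'n) vec \<times> (real, 'n) vec. fst \<omega> $ t - snd \<omega> $ t) \<in> borel_measurable borel"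
        by (intro borel_measurable_diff borel_measurable_vec_nth fs)
      show ?thesis by measurable
    qed
    from integral_distr[OF g this] show ?thesis by (simp add: transport_cost_def \<pi>_def)
  qed
  then have "transport_cost p \<pi> fst snd powr (1 / p) \<le> (r powr p) powr (1 / p)"
    using cost p transport_cost_nonneg[of p P "\<lambda>x. x" ?F] by (intro powr_mono2) auto
  also have "\<dots> = r" using r p by (simp add: powr_powr)
  finally have "transport_cost p \<pi> fst snd powr (1 / p) \<le> r" .
  moreover have "adapted_wasserstein p P ?Q \<le> transport_cost p \<pi> fst snd powr (1 / p)"
    unfolding adapted_wasserstein_def transport_cost_def
    by (rule cINF_lower[OF _ bi]) (auto simp: bdd_below_def intro!: exI[of _ 0])
  ultimately show "?Q \<in> aw_ball p P r" using Q by (simp add: aw_ball_def)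
qed

section \<open>The lower bound\<close>

context control_problem
begin

lemma first_order_bound:
  assumes Z [measurable]: "Z \<in> borel_measurable borel" and B: "\<And>x. norm (Z x) \<le> B"
  shows "\<exists>G\<ge>0. \<forall>b\<in>controls L. \<bar>\<integral>x. grad_x x (b x) \<bullet> Z x \<partial>P\<bar> \<le> G"
proof -
  obtain C where C: "C > 0" "\<And>x a. a \<in> control_box L \<Longrightarrow> norm (grad_x x a) \<le> C * (1 + norm x powr (p - 1))"
    using grad_x_bound by blast
  let ?g = "\<lambda>x. (C * (1 + norm x powr (p - 1))) * B"
  have ig: "integrable P ?g" by (intro integrable_mult_left integrable_growth)
  have B0: "0 \<le> B" using order_trans[OF norm_ge_zero B[of 0]] .
  have "\<bar>\<integral>x. grad_x x (b x) \<bullet> Z x \<partial>P\<bar> \<le> (\<integral>x. ?g x \<partial>P)" if b: "b \<in> controls L" for b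
  proof -
    have le: "\<bar>grad_x x (b x) \<bullet> Z x\<bar> \<le> ?g x" for x
      using C(2)[OF controls_box[OF b, of x]] B[of x] C(1)
      by (intro order_trans[OF Cauchy_Schwarz_ineq2] mult_mono) auto
    have "\<bar>\<integral>x. grad_x x (b x) \<bullet> Z x \<partial>P\<bar> \<le> (\<integral>x. \<bar>grad_x x (b x) \<bullet> Z x\<bar> \<partial>P)"
      by (rule integral_abs_bound)
    also have "\<dots> \<le> (\<integral>x. ?g x \<partial>P)"
      by (intro integral_mono integrable_abs integrable_grad_x[OF b Z B] ig le)
    finally show ?thesis .
  qed
  moreover have "0 \<le> (\<integral>x. ?g x \<partial>P)"
    using C(1) B0 by (intro integral_nonneg_AE) auto
  ultimately show ?thesis by blast
qed

text \<open>Against the perturbed measure, a nearly optimal control is, after composition with the perturbation, nearly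
  optimal for \<open>P\<close>, and therefore close to the optimal control; it cannot avoid the first-order increase.\<close>

lemma value_lower_bound:
  assumes a: "a \<in> controls L" and opt: "control_value f L P = (\<integral>x. f x (a x) \<partial>P)" and \<eta>: "0 < \<eta>"
  shows "\<exists>r0>0. \<forall>r. 0 < r \<longrightarrow> r < r0 \<longrightarrow> (\<exists>Q\<in>aw_ball p P r.
    control_value f L P + r * sensitivity a - \<eta> * r \<le> control_value f L Q)"
proof -
  let ?v = "control_value f L"
  let ?V = "sensitivity a"
  interpret prob_space P by (rule prob_P)
  have \<eta>4: "0 < \<eta> / 4" using \<eta> by simp
  obtain Z where Z: "\<And>t. lipschitz_coords {..t} (\<lambda>x. Z x $ t)"
    "(\<Sum>t\<in>UNIV. \<integral>x. \<bar>Z x $ t\<bar> powr p \<partial>P) \<le> 1"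
    "?V - \<eta> / 4 \<le> (\<integral>x. grad_x x (a x) \<bullet> Z x \<partial>P)"
    using steepest_direction[OF a \<eta>4] by blast
  have Zm [measurable]: "Z \<in> borel_measurable borel"
    by (rule borel_measurable_vecI) (rule lipschitz_coords_measurable[OF Z(1)])
  have "\<forall>t. \<exists>B. \<forall>x. \<bar>Z x $ t\<bar> \<le> B" using Z(1) by (simp add: lipschitz_coords_def)
  from choice[OF this] obtain B where B: "\<And>t x. \<bar>Z x $ t\<bar> \<le> B t" by blast
  have ZB: "norm (Z x) \<le> (\<Sum>t\<in>UNIV. B t)" for x
    by (rule order_trans[OF norm_le_l1_cart]) (intro sum_mono B)
  obtain G where G: "0 \<le> G" "\<And>b. b \<in> controls L \<Longrightarrow> \<bar>\<integral>x. grad_x x (b x) \<bullet> Z x \<partial>P\<bar> \<le> G"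
    using first_order_bound[OF Zm ZB] by blast
  obtain \<delta> where \<delta>: "\<delta> > 0" "\<And>b. b \<in> controls L \<Longrightarrow> (\<integral>x. f x (b x) \<partial>P) \<le> ?v P + \<delta> \<Longrightarrow>
      (\<integral>x. grad_x x (a x) \<bullet> Z x \<partial>P) - \<eta> / 4 \<le> (\<integral>x. grad_x x (b x) \<bullet> Z x \<partial>P)"
    using gradient_stability[OF a opt Zm ZB \<eta>4] by blast
  obtain r1 where r1: "r1 > 0" "\<And>r. 0 < r \<Longrightarrow> r < r1 \<Longrightarrow> \<exists>S\<in>borel_measurable borel.
    (\<forall>x. S (x + r *\<^sub>R Z x) = x) \<and> (\<forall>t y y'. (\<forall>s\<le>t. y $ s = y' $ s) \<longrightarrow> S y $ t = S y' $ t)"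
    using adapted_perturbation[OF Z(1)] by blast
  obtain r2 where r2: "r2 > 0" "\<And>r Q. 0 < r \<Longrightarrow> r < r2 \<Longrightarrow> Q \<in> aw_ball p P r \<Longrightarrow>
    ?v Q \<le> ?v P + r * ?V + 1 * r"
    using value_upper_bound[OF a opt zero_less_one] by blast
  obtain r3 where r3: "0 < r3"
    "\<And>r (M :: (real, 'n) vec measure) X Y A. \<lbrakk>0 < r; r < r3; prob_space M;
      X \<in> borel_measurable M; Y \<in> borel_measurable M; A \<in> borel_measurable M;
      distr M borel X = P; \<And>w. A w \<in> control_box L;
      \<And>t. integrable M (\<lambda>w. \<bar>X w $ t - Y w $ t\<bar> powr p); transport_cost p M X Y \<le> r powr p\<rbrakk> \<Longrightarrow>
      integrable M (\<lambda>w. remainder (X w) (Y w) (A w)) \<and>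
        (\<integral>w. \<bar>remainder (X w) (Y w) (A w)\<bar> \<partial>M) \<le> \<eta> / 4 * r"
    using \<eta>4 by (rule expected_remainder[where 'w = "(real, 'n) vec"]) (rule that; blast)
  define c where "c = ?V + 1 + \<eta> / 2 + G"
  have c: "c > 0" using sensitivity_nonneg[of a] \<eta> G(1) by (simp add: c_def)
  define r0 where "r0 = min (min r1 r2) (min r3 (\<delta> / c))"
  have r0: "r0 > 0" using r1 r2 r3 \<delta> c by (simp add: r0_def)
  show ?thesis
  proof (rule exI[of _ r0], intro conjI allI impI r0)
    fix r assume r: "0 < r" "r < r0"
    then have rr: "r < r1" "r < r2" "r < r3" "r < \<delta> / c" by (auto simp: r0_def)
    let ?F = "\<lambda>x. x + r *\<^sub>R Z x"
    let ?Q = "distr P borel ?F"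
    obtain S where S: "S \<in> borel_measurable borel" "\<And>x. S (?F x) = x"
      "\<And>t y y'. (\<And>s. s \<le> t \<Longrightarrow> y $ s = y' $ s) \<Longrightarrow> S y $ t = S y' $ t"
      using r1(2)[OF r(1) rr(1)] by blast
    note ball = perturbed_measure_in_ball[OF Z(1,2) r(1) S]
    have Fm [measurable]: "?F \<in> borel_measurable borel" by measurable
    have FP: "?F \<in> borel_measurable P" by (simp add: measurable_P)
    have r\<eta>: "0 < \<eta> / 4 * r" using r \<eta> by simp
    obtain b0 where b0: "b0 \<in> controls L" "(\<integral>y. f y (b0 y) \<partial>?Q) < ?v ?Q + \<eta> / 4 * r"
      by (rule control_value_approx[OF r\<eta>])
    \<comment> \<open>Read along the perturbed path, the control is predictable in the original path.\<close>
    define b where "b x = b0 (?F x)" for x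
    have b: "b \<in> controls L"
    proof -
      have b0m [measurable]: "b0 \<in> borel_measurable borel" by (rule controls_measurable[OF b0(1)])
      have "b x $ t = b y $ t" if "\<forall>s<t. x $ s = y $ s" for x y t
        unfolding b_def
      proof (rule controls_adapted[OF b0(1)])
        fix s assume s: "s < t"
        have "Z x $ s = Z y $ s"
          by (rule lipschitz_coords_adapted[OF Z(1)]) (use that s in auto)
        then show "?F x $ s = ?F y $ s" using that s by simp
      qed
      moreover have "(\<lambda>x. b x $ t) \<in> borel_measurable borel" for t unfolding b_def by measurable
      moreover have "\<bar>b x $ t\<bar> \<le> L" for x t using b0(1) by (simp add: b_def controls_def)
      ultimately show ?thesis by (auto simp: controls_def)
    qed
    have bm [measurable]: "b \<in> borel_measurable borel" by (rule controls_measurable[OF b])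
    have dP: "distr P borel (\<lambda>x. x) = P" by (rule distr_id2) (simp add: sets_P)
    have idP: "(\<lambda>x. x) \<in> borel_measurable P" and bP: "b \<in> borel_measurable P"
      by (simp_all add: measurable_P)
    from r3(2)[OF r(1) rr(3) prob_space_axioms idP FP bP dP controls_box[OF b] ball(3) ball(2)]
    have rem: "integrable P (\<lambda>x. remainder x (?F x) (b x))"
      "(\<integral>x. \<bar>remainder x (?F x) (b x)\<bar> \<partial>P) \<le> \<eta> / 4 * r"
      by blast+
    let ?D = "\<lambda>b. \<integral>x. grad_x x (b x) \<bullet> Z x \<partial>P"
    have "(\<integral>y. f y (b0 y) \<partial>?Q) = (\<integral>x. f (?F x) (b x) \<partial>P)"
    proof -
      have [measurable]: "b0 \<in> borel_measurable borel" by (rule controls_measurable[OF b0(1)])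
      have "(\<lambda>y. f y (b0 y)) \<in> borel_measurable borel" by measurable
      from integral_distr[OF FP this] show ?thesis by (simp add: b_def)
    qed
    also have "\<dots> = (\<integral>x. f x (b x) + r * (grad_x x (b x) \<bullet> Z x) + remainder x (?F x) (b x) \<partial>P)"
      by (simp add: remainder_def)
    also have "\<dots> = (\<integral>x. f x (b x) \<partial>P) + r * ?D b + (\<integral>x. remainder x (?F x) (b x) \<partial>P)"
      using integrable_cost_control[OF P b] integrable_grad_x[OF b Zm ZB] rem(1) by simp
    finally have expand: "(\<integral>y. f y (b0 y) \<partial>?Q)
        = (\<integral>x. f x (b x) \<partial>P) + r * ?D b + (\<integral>x. remainder x (?F x) (b x) \<partial>P)" .
    have rem_abs: "\<bar>\<integral>x. remainder x (?F x) (b x) \<partial>P\<bar> \<le> \<eta> / 4 * r"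
      using rem(2) integral_abs_bound[of P "\<lambda>x. remainder x (?F x) (b x)"] by linarith
    have "(\<integral>x. f x (b x) \<partial>P) \<le> ?v P + \<delta>"
    proof -
      have "?v ?Q \<le> ?v P + r * ?V + r" using r2(2)[OF r(1) rr(2) ball(1)] by simp
      moreover have "- (r * ?D b) \<le> r * G"
      proof -
        have "- ?D b \<le> G" using G(2)[OF b] by linarith
        from mult_left_mono[OF this, of r] r show ?thesis by simp
      qed
      moreover have "r * c \<le> \<delta>" using rr(4) c by (simp add: pos_less_divide_eq)
      moreover have "r * c = r * ?V + r + \<eta> / 4 * r + \<eta> / 4 * r + r * G"
        by (simp add: c_def algebra_simps)
      ultimately show ?thesis using expand rem_abs b0(2) by linarith
    qed
    from \<delta>(2)[OF b this] have "?V - \<eta> / 2 \<le> ?D b" using Z(3) by simp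
    from mult_left_mono[OF this, of r] r have "r * ?V - \<eta> / 2 * r \<le> r * ?D b"
      by (simp add: algebra_simps)
    moreover have "?v P \<le> (\<integral>x. f x (b x) \<partial>P)" by (rule control_value_le[OF P b])
    ultimately have "?v P + r * ?V - \<eta> * r \<le> ?v ?Q"
      using expand rem_abs b0(2) by linarith
    then show "\<exists>Q\<in>aw_ball p P r. ?v P + r * ?V - \<eta> * r \<le> ?v Q" using ball(1) by blast
  qed
qed

lemma value_expansion:
  assumes a: "a \<in> controls L" and opt: "control_value f L P = (\<integral>x. f x (a x) \<partial>P)"
  shows "(\<lambda>r. (SUP Q\<in>aw_ball p P r. control_value f L Q) - (control_value f L P + r * sensitivity a))
    \<in> o[at_right 0](\<lambda>r. r)"
proof (rule landau_o.smallI)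
  fix \<eta> :: real assume \<eta>: "0 < \<eta>"
  let ?v = "control_value f L"
  obtain r1 where r1: "r1 > 0" "\<And>r Q. 0 < r \<Longrightarrow> r < r1 \<Longrightarrow> Q \<in> aw_ball p P r \<Longrightarrow>
    ?v Q \<le> ?v P + r * sensitivity a + \<eta> * r"
    using value_upper_bound[OF a opt \<eta>] by blast
  obtain r2 where r2: "r2 > 0" "\<And>r. 0 < r \<Longrightarrow> r < r2 \<Longrightarrow> \<exists>Q\<in>aw_ball p P r.
    ?v P + r * sensitivity a - \<eta> * r \<le> ?v Q"
    using value_lower_bound[OF a opt \<eta>] by blast
  have "norm ((SUP Q\<in>aw_ball p P r. ?v Q) - (?v P + r * sensitivity a)) \<le> \<eta> * norm r"
    if r: "0 < r" "r < min r1 r2" for r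
  proof -
    obtain Q where Q: "Q \<in> aw_ball p P r" "?v P + r * sensitivity a - \<eta> * r \<le> ?v Q"
      using r2(2)[of r] r by auto
    have upper: "?v Q' \<le> ?v P + r * sensitivity a + \<eta> * r" if "Q' \<in> aw_ball p P r" for Q'
      using r1(2)[of r Q'] r that by simp
    have "?v Q \<le> (SUP Q\<in>aw_ball p P r. ?v Q)"
      by (rule cSUP_upper[OF Q(1)]) (use upper in \<open>auto simp: bdd_above_def\<close>)
    moreover have "(SUP Q\<in>aw_ball p P r. ?v Q) \<le> ?v P + r * sensitivity a + \<eta> * r"
      using Q(1) upper by (intro cSUP_least) auto
    ultimately show ?thesis using Q(2) r by (simp add: abs_le_iff)
  qed
  then show "\<forall>\<^sub>F r in at_right 0. norm ((SUP Q\<in>aw_ball p P r. ?v Q) - (?v P + r * sensitivity a)) \<le> \<eta> * norm r"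
    unfolding eventually_at_right_field using r1(1) r2(1) by (intro exI[of _ "min r1 r2"]) auto
qed

end

section \<open>The sensitivity of the value\<close>

theorem theorem2p4:
  fixes p q L :: real
    and P :: "(real ^ 'n::{finite,linorder}) measure"
    and f :: "real ^ 'n::{finite,linorder} \<Rightarrow> real ^ 'n::{finite,linorder} \<Rightarrow> real"
    and \<epsilon> :: "real ^ 'n::{finite,linorder} \<Rightarrow> real"
  assumes "1 < p" and "q = p / (p - 1)" and "0 \<le> L"
    and "P \<in> finite_moment_measures p"
    and convex: "\<And>x. convex_on UNIV (f x)"
    and C2: "\<And>x. twice_continuously_differentiable (f x)"
    and eps_borel: "\<epsilon> \<in> borel_measurable borel"
    and eps_pos: "measure P {x. 0 < \<epsilon> x} = 1"
    and strongly_convex: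
      "\<And>x a. a \<in> control_box L \<Longrightarrow> positive_semidefinite (hessian (f x) a - mat (\<epsilon> x))"
    and differentiable_x: "\<And>a x. (\<lambda>x. f x a) differentiable (at x)"
    and continuous_partials:
      "\<And>t. continuous_on UNIV (\<lambda>(x, a). partial_deriv (\<lambda>x. f x a) t x)"
    and growth:
      "\<exists>c>0. \<forall>x. \<forall>a\<in>control_box L.
         (\<Sum>s\<in>UNIV. \<bar>partial_deriv (\<lambda>x. f x a) s x\<bar>) \<le> c * (1 + (\<Sum>s\<in>UNIV. \<bar>x $ s\<bar> powr (p - 1)))"
  shows "\<exists>a\<in>controls L.
    control_value f L P = (\<integral>x. f x (a x) \<partial>P) \<and>
    (\<forall>b\<in>controls L. control_value f L P = (\<integral>x. f x (b x) \<partial>P) \<longrightarrow> (AE x in P. b x = a x)) \<and>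
    (\<lambda>r. (SUP Q\<in>aw_ball p P r. control_value f L Q) -
         (control_value f L P +
          r * (\<Sum>t\<in>UNIV. \<integral>x. \<bar>real_cond_exp P (canonical_filtration t)
                 (\<lambda>y. partial_deriv (\<lambda>x. f x (a y)) t y) x\<bar> powr q \<partial>P) powr (1 / q)))
      \<in> o[at_right 0](\<lambda>r. r)"
proof -
  interpret control_problem p q L P f \<epsilon>
    by (rule control_problem.intro) fact+
  obtain a where a: "a \<in> controls L" "control_value f L P = (\<integral>x. f x (a x) \<partial>P)"
    using exists_optimal_control by blast
  have "sensitivity a = (\<Sum>t\<in>UNIV. \<integral>x. \<bar>real_cond_exp P (canonical_filtration t)
      (\<lambda>y. partial_deriv (\<lambda>x. f x (a y)) t y) x\<bar> powr q \<partial>P) powr (1 / q)"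
    unfolding sensitivity_def adapted_grad_def grad_x_nth ..
  with value_expansion[OF a] optimal_control_unique[OF a(1) _ a(2)] a
  show ?thesis by (intro bexI[of _ a]) auto
qed

end
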